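(* Let $\gamma\in\mathbb{R}$ with $\gamma\neq0$. Then for every divergence-free vector field $\mathbf{u}\in C_0^\infty(\mathbb{R}^2)$, which is assumed in addition to satisfy $\mathbf{u}(\mathbf{0})=\mathbf{0}$ in the case $\gamma<0$, the inequality $$\int_{\mathbb{R}^2}|x|^{2\gamma-2}|\mathbf{u}|^2\,dx\le C_{2,\gamma}\int_{\mathbb{R}^2}|x|^{2\gamma}|\nabla\mathbf{u}|^2\,dx$$ holds with the best (smallest possible) constant $$C_{2,\gamma}=\begin{cases}\gamma^{-2}\,\dfrac{1+(1-\gamma)^2}{3+(1-\gamma)^2}, & \gamma\in[-\sqrt3-1,\sqrt3-1],\\[3mm] (\gamma^2+1)^{-1}, & \text{otherwise}.\end{cases}$$
   Context: Vector fields $\mathbf{u}:\mathbb{R}^2\to\mathbb{R}^2$ are real; $C_0^\infty(\mathbb{R}^2)$ denotes smooth compactly supported fields; $|\nabla\mathbf{u}|^2=\sum_{i,j}(\partial_{x_i}u_j)^2$ in Cartesian coordinates. No symmetry of $\mathbf{u}$ is assumed. *)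

theory Defs
  imports "HOL-Analysis.Analysis"
begin

text \<open>Being of class \<open>C\<^sup>k\<close> on the whole space: all iterated directional derivatives of order at
  most \<open>k\<close> exist as Frechet derivatives and are continuous.\<close>

primrec Ck :: "nat \<Rightarrow> ('a::real_normed_vector \<Rightarrow> 'b::real_normed_vector) \<Rightarrow> bool" where
  "Ck 0 f \<longleftrightarrow> continuous_on UNIV f"
| "Ck (Suc k) f \<longleftrightarrow>
     (\<forall>x. f differentiable (at x)) \<and> (\<forall>v. Ck k (\<lambda>x. frechet_derivative f (at x) v))"

definition smooth_compact_support :: "(real^2 \<Rightarrow> real^2) \<Rightarrow> bool" where
  "smooth_compact_support u \<longleftrightarrow> (\<forall>k. Ck k u) \<and> compact (closure {x. u x \<noteq> 0})"

text \<open>\<open>partial i j u\<close> is the \<open>i\<close>-th partial derivative of the \<open>j\<close>-th component of \<open>u\<close>.\<close>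

definition partial :: "2 \<Rightarrow> 2 \<Rightarrow> (real^2 \<Rightarrow> real^2) \<Rightarrow> real^2 \<Rightarrow> real" where
  "partial i j u x = frechet_derivative (\<lambda>y. u y $ j) (at x) (axis i 1)"

definition divergence_free :: "(real^2 \<Rightarrow> real^2) \<Rightarrow> bool" where
  "divergence_free u \<longleftrightarrow> (\<forall>x. (\<Sum>i\<in>UNIV. partial i i u x) = 0)"

definition grad_norm_sq :: "(real^2 \<Rightarrow> real^2) \<Rightarrow> real^2 \<Rightarrow> real" where
  "grad_norm_sq u x = (\<Sum>i\<in>UNIV. \<Sum>j\<in>UNIV. (partial i j u x)\<^sup>2)"

definition admissible :: "real \<Rightarrow> (real^2 \<Rightarrow> real^2) set" where
  "admissible \<gamma> = {u. smooth_compact_support u \<and> divergence_free u \<and> (\<gamma> < 0 \<longrightarrow> u 0 = 0)}"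

text \<open>The integrals take values in \<open>[0, \<infinity>]\<close>, as they may diverge at the origin when
  \<open>\<gamma> \<le> -1\<close>. The convention \<open>0 powr a = 0\<close> only affects the null set \<open>{0}\<close>.\<close>

definition hardy_lhs :: "real \<Rightarrow> (real^2 \<Rightarrow> real^2) \<Rightarrow> ennreal" where
  "hardy_lhs \<gamma> u = (\<integral>\<^sup>+x. ennreal (norm x powr (2 * \<gamma> - 2) * (norm (u x))\<^sup>2) \<partial>lborel)"

definition hardy_rhs :: "real \<Rightarrow> (real^2 \<Rightarrow> real^2) \<Rightarrow> ennreal" where
  "hardy_rhs \<gamma> u = (\<integral>\<^sup>+x. ennreal (norm x powr (2 * \<gamma>) * grad_norm_sq u x) \<partial>lborel)"

definition hardy_const :: "real \<Rightarrow> real" where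
  "hardy_const \<gamma> =
    (if \<gamma> \<in> {- sqrt 3 - 1 .. sqrt 3 - 1}
     then 1 / \<gamma>\<^sup>2 * ((1 + (1 - \<gamma>)\<^sup>2) / (3 + (1 - \<gamma>)\<^sup>2))
     else 1 / (\<gamma>\<^sup>2 + 1))"

end

theory Submission
  imports Defs "HOL-Computational_Algebra.Polynomial"
begin

text \<open>In the coordinates \<open>x = e\<^sup>t (cos \<theta>, sin \<theta>)\<close>, let \<open>f\<close> and \<open>h\<close> be the radial and the angular
component of \<open>e\<^bsup>\<gamma>t\<^esup> u\<close>, and put \<open>a = 1 - \<gamma>\<close>. The two integrals turn into the integrals of
\<open>f\<^sup>2 + h\<^sup>2\<close> and of \<open>(f\<^sub>t - \<gamma>f)\<^sup>2 + (h\<^sub>t - \<gamma>h)\<^sup>2 + (f\<^sub>\<theta> - h)\<^sup>2 + (h\<^sub>\<theta> + f)\<^sup>2\<close> over the strip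
\<open>\<real> \<times> (-\<pi>, \<pi>)\<close>, and \<open>u\<close> is divergence free iff \<open>h\<^sub>\<theta> = - (f\<^sub>t + a f)\<close>. All coefficients are
constant, so the quotient of the two integrals is seen mode by mode. With frequency \<open>\<tau>\<close> in \<open>t\<close> and
wave number \<open>k\<close> in \<open>\<theta>\<close> it is \<open>\<gamma>\<^sup>2 + 1 + \<tau>\<^sup>2\<close> for \<open>k = 0\<close>, where \<open>f\<close> vanishes, and
\<open>\<gamma>\<^sup>2 + 1 + \<tau>\<^sup>2 + k\<^sup>2 - 4 a k\<^sup>2 / (k\<^sup>2 + \<tau>\<^sup>2 + a\<^sup>2)\<close> for \<open>k \<ge> 1\<close>. If \<open>a \<le> 0\<close>,
no value is below \<open>\<gamma>\<^sup>2 + 1\<close>, the one of mode \<open>0\<close> at \<open>\<tau> = 0\<close>. If \<open>a > 0\<close>, the quotient grows with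
\<open>\<tau>\<^sup>2\<close>, and at \<open>\<tau> = 0\<close> the bound \<open>4 a \<le> 4 + a\<^sup>2\<close> shows that modes \<open>k \<ge> 2\<close> are not below mode \<open>0\<close>
either. So the best constant is the reciprocal of
\<open>\<gamma>\<^sup>2 + 1 + min 0 ((1 + a\<^sup>2 - 4 a) / (1 + a\<^sup>2))\<close>; the fraction is the difference between modes
\<open>1\<close> and \<open>0\<close> at \<open>\<tau> = 0\<close>, and it is negative exactly when \<open>\<gamma>\<close> lies strictly between \<open>- \<surd>3 - 1\<close> and \<open>\<surd>3 - 1\<close>.

The inequality is proved without Fourier expansions, one circle at a time
(\<open>slice_inequality\<close>). Expanding the energy and integrating by parts in \<open>\<theta>\<close> leaves, besides
squares, only terms \<open>f f\<^sub>t\<close> and \<open>h h\<^sub>t\<close>, whose integrals over the circle are derivatives in \<open>t\<close>. Two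
facts about functions on a circle replace the spectral decomposition: a function of mean zero satisfies
\<open>\<integral>f\<^sub>\<theta>\<^sup>2 \<ge> 4 \<integral>f\<^sup>2 - 3 A\<close>, where \<open>A\<close> is the part of \<open>\<integral>f\<^sup>2\<close> in mode \<open>1\<close>
(\<open>second_angular_gap\<close>), and Bessel's inequality for \<open>h\<close> together with the divergence
equation gives \<open>\<integral>h\<^sup>2 \<ge> a\<^sup>2 A + a A'\<close> (\<open>angular_bound\<close>). Integration in \<open>t\<close> then leaves a
boundary term at \<open>t \<rightarrow> -\<infinity>\<close>. It tends to zero, since \<open>u\<close> is bounded if \<open>\<gamma> > 0\<close>, and because
\<open>u\<close> vanishes at the origin and has finite energy if \<open>\<gamma> < 0\<close> (\<open>decay_of_finite_energy\<close>).

The constant is optimal because of fields that consist of mode \<open>0\<close> or of mode \<open>1\<close> alone, with an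
amplitude that is a smooth bump in \<open>\<epsilon>t\<close>: their frequencies \<open>\<tau>\<close> concentrate at \<open>0\<close> as
\<open>\<epsilon> \<rightarrow> 0\<close> (\<open>swirl\<close>, \<open>dipole\<close>, \<open>constant_lower_bound\<close>).\<close>

section \<open>Spectral gaps on the circle\<close>

lemma has_integral_real_derivative:
  fixes W w :: "real \<Rightarrow> real"
  assumes "a \<le> b" "\<And>x. (W has_real_derivative w x) (at x)"
  shows "(w has_integral (W b - W a)) {a..b}"
  by (rule fundamental_theorem_of_calculus[OF assms(1)])
    (simp add: has_real_derivative_iff_has_vector_derivative[symmetric]
      has_field_derivative_at_within[OF assms(2)])

lemma DERIV_trig_square_primitives:
  fixes x :: real
  shows "((\<lambda>x. (x + sin x * cos x) / 2) has_real_derivative (cos x)\<^sup>2) (at x)"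
    and "((\<lambda>x. (x - sin x * cos x) / 2) has_real_derivative (sin x)\<^sup>2) (at x)"
  by (auto intro!: derivative_eq_intros simp: power2_eq_square sin_squared_eq[unfolded power2_eq_square])

text \<open>The first Dirichlet eigenfunction is positive inside the interval but zero at the end points, so its
logarithmic derivative is unbounded. A cosine centred at the midpoint, of slightly smaller frequency \<open>\<mu> < \<pi> / (b - a)\<close>,
is positive on the closed interval: completing a square with its logarithmic derivative gives the inequality with
\<open>\<mu>\<^sup>2\<close>, and \<open>\<mu>\<close> can be taken arbitrarily close to \<open>\<pi> / (b - a)\<close>.\<close>

lemma dirichlet_inequality:
  fixes G g :: "real \<Rightarrow> real"
  assumes "a < b" and G: "\<And>x. (G has_real_derivative g x) (at x)" and g: "continuous_on UNIV g"
    and "G a = 0" "G b = 0"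
  shows "(pi / (b - a))\<^sup>2 * integral {a..b} (\<lambda>x. (G x)\<^sup>2) \<le> integral {a..b} (\<lambda>x. (g x)\<^sup>2)"
proof -
  have contG: "continuous_on S G" for S
    using G by (meson DERIV_isCont continuous_at_imp_continuous_on)
  have contg: "continuous_on S g" for S
    using g continuous_on_subset by blast
  have I: "((\<lambda>x. (G x)\<^sup>2) has_integral integral {a..b} (\<lambda>x. (G x)\<^sup>2)) {a..b}"
    "((\<lambda>x. (g x)\<^sup>2) has_integral integral {a..b} (\<lambda>x. (g x)\<^sup>2)) {a..b}"
    by (intro integrable_integral integrable_continuous_real continuous_intros contG contg)+
  show ?thesis
  proof (rule field_le_mult_one_interval)
    fix z :: real assume z: "0 < z" "z < 1"
    define \<mu> where "\<mu> = sqrt z * pi / (b - a)"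
    define m where "m = (a + b) / 2"
    have \<mu>: "\<mu>\<^sup>2 = z * (pi / (b - a))\<^sup>2" "\<mu> > 0"
      using z \<open>a < b\<close> by (auto simp: \<mu>_def power_mult_distrib power_divide)
    have cos0: "cos (\<mu> * (x - m)) \<noteq> 0" if "x \<in> {a..b}" for x
    proof -
      have "\<bar>x - m\<bar> \<le> (b - a) / 2" using that by (auto simp: m_def abs_if field_simps)
      then have "\<bar>\<mu> * (x - m)\<bar> \<le> \<mu> * ((b - a) / 2)"
        using \<mu>(2) by (simp add: abs_mult)
      also have "\<dots> = sqrt z * (pi / 2)" using \<open>a < b\<close> by (simp add: \<mu>_def)
      also have "\<dots> < 1 * (pi / 2)" using z by (intro mult_strict_right_mono) auto
      finally have "cos (\<mu> * (x - m)) > 0" by (intro cos_gt_zero_pi) auto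
      then show ?thesis by simp
    qed
    define w where "w x = \<mu>\<^sup>2 * (1 + (tan (\<mu> * (x - m)))\<^sup>2) * (G x)\<^sup>2
                       + \<mu> * tan (\<mu> * (x - m)) * (2 * G x * g x)" for x
    have "((\<lambda>x. \<mu> * tan (\<mu> * (x - m)) * (G x)\<^sup>2) has_real_derivative w x) (at x within {a..b})"
      if "x \<in> {a..b}" for x
    proof -
      have "w x = \<mu> * (inverse ((cos (\<mu> * (x - m)))\<^sup>2) * \<mu>) * (G x)\<^sup>2
          + 2 * G x * g x * (\<mu> * tan (\<mu> * (x - m)))"
        unfolding w_def tan_sec[OF cos0[OF that]] by (simp add: power2_eq_square field_simps)
      moreover have "((\<lambda>x. \<mu> * (x - m)) has_real_derivative \<mu>) (at x)"
        by (auto intro!: derivative_eq_intros)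
      note DERIV_chain2[OF DERIV_tan[OF cos0[OF that]] this]
      note DERIV_mult[OF DERIV_cmult[OF this, of \<mu>] DERIV_power[OF G, of 2]]
      ultimately have "((\<lambda>x. \<mu> * tan (\<mu> * (x - m)) * (G x)\<^sup>2) has_real_derivative w x) (at x)"
        by (simp add: mult.commute mult.left_commute)
      then show ?thesis using has_field_derivative_at_within by blast
    qed
    then have "(w has_integral (\<mu> * tan (\<mu> * (b - m)) * (G b)\<^sup>2 - \<mu> * tan (\<mu> * (a - m)) * (G a)\<^sup>2)) {a..b}"
      using \<open>a < b\<close> by (intro fundamental_theorem_of_calculus)
        (auto simp: has_real_derivative_iff_has_vector_derivative)
    then have "(w has_integral 0) {a..b}" using assms by simp
    then have int: "((\<lambda>x. (g x)\<^sup>2 + w x - \<mu>\<^sup>2 * (G x)\<^sup>2) has_integral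
        (integral {a..b} (\<lambda>x. (g x)\<^sup>2) + 0 - \<mu>\<^sup>2 * integral {a..b} (\<lambda>x. (G x)\<^sup>2))) {a..b}"
      by (intro has_integral_diff has_integral_add I has_integral_mult_right)
    have square: "(g x)\<^sup>2 + w x - \<mu>\<^sup>2 * (G x)\<^sup>2 = (g x + \<mu> * tan (\<mu> * (x - m)) * G x)\<^sup>2" for x
      unfolding w_def by (simp add: power2_eq_square algebra_simps)
    have "0 \<le> integral {a..b} (\<lambda>x. (g x)\<^sup>2) + 0 - \<mu>\<^sup>2 * integral {a..b} (\<lambda>x. (G x)\<^sup>2)"
      by (rule has_integral_nonneg[OF int]) (simp only: square zero_le_power2)
    then show "z * ((pi / (b - a))\<^sup>2 * integral {a..b} (\<lambda>x. (G x)\<^sup>2)) \<le> integral {a..b} (\<lambda>x. (g x)\<^sup>2)"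
      using \<mu> by simp
  qed
qed

lemma integral_over_period:
  fixes f :: "real \<Rightarrow> real"
  assumes f: "continuous_on UNIV f" and per: "\<And>x. f (x + p) = f x" and "p > 0"
  shows "integral {c..c + p} f = integral {d..d + p} f"
proof -
  have cont: "continuous_on S f" for S using f continuous_on_subset by blast
  have int: "f integrable_on {a..b}" for a b by (intro integrable_continuous_real cont)
  have le: "integral {c..c + p} f = integral {d..d + p} f" if "c \<le> d" for c d
  proof -
    have "integral {c..d} f + integral {d..d + p} f = integral {c..d + p} f"
      using that \<open>p > 0\<close> by (intro Henstock_Kurzweil_Integration.integral_combine int) auto
    moreover have "integral {c..c + p} f + integral {c + p..d + p} f = integral {c..d + p} f"
      using that \<open>p > 0\<close> by (intro Henstock_Kurzweil_Integration.integral_combine int) auto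
    moreover have "integral {c + p..d + p} f = integral {c..d} (f \<circ> (\<lambda>x. x + p))"
      using integral_shift[of c p d f] cont by (simp add: add.commute)
    ultimately show ?thesis using per by (simp add: o_def)
  qed
  show ?thesis using le[of c d] le[of d c] by linarith
qed

lemma periodic_derivative:
  fixes f :: "real \<Rightarrow> real"
  assumes f: "\<And>x. (f has_real_derivative f' x) (at x)" and per: "\<And>x. f (x + p) = f x"
  shows "f' (x + p) = f' x"
proof -
  have "((\<lambda>x. f (x + p)) has_real_derivative f' (x + p)) (at x)"
    using f[of "x + p"] by (simp add: DERIV_shift)
  then show ?thesis using f[of x] per DERIV_unique by simp
qed


text \<open>The four zeros cut the circle into arcs of length \<open>\<pi> / 2\<close>, whose first Dirichlet eigenvalue is \<open>4\<close>.\<close>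

lemma wirtinger_four_zeros:
  fixes G g :: "real \<Rightarrow> real"
  assumes G: "\<And>x. (G has_real_derivative g x) (at x)" and g: "continuous_on UNIV g"
    and per: "\<And>x. G (x + 2 * pi) = G x"
    and z: "G c = 0" "G (c + pi / 2) = 0" "G (c + pi) = 0" "G (c + 3 * pi / 2) = 0"
  shows "4 * integral {-pi..pi} (\<lambda>x. (G x)\<^sup>2) \<le> integral {-pi..pi} (\<lambda>x. (g x)\<^sup>2)"
proof -
  have contG: "continuous_on S G" for S
    using G by (meson DERIV_isCont continuous_at_imp_continuous_on)
  have contg: "continuous_on S g" for S
    using g continuous_on_subset by blast
  have quarter: "4 * integral {x..x + pi / 2} (\<lambda>x. (G x)\<^sup>2) \<le> integral {x..x + pi / 2} (\<lambda>x. (g x)\<^sup>2)"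
    if "G x = 0" "G (x + pi / 2) = 0" for x
    using dirichlet_inequality[OF _ G g that] by simp
  have quarters: "c + pi / 2 + pi / 2 = c + pi" "c + pi + pi / 2 = c + 3 * pi / 2"
      "c + 3 * pi / 2 + pi / 2 = c + 2 * pi"
    by simp_all
  have split: "integral {c..c + 2 * pi} F = integral {c..c + pi / 2} F
      + integral {c + pi / 2..c + pi / 2 + pi / 2} F + integral {c + pi..c + pi + pi / 2} F
      + integral {c + 3 * pi / 2..c + 3 * pi / 2 + pi / 2} F" 
    if "\<And>S. continuous_on S F" for F :: "real \<Rightarrow> real"
  proof -
    have int: "F integrable_on {a..b}" for a b by (intro integrable_continuous_real that)
    have add: "integral {a..a'} F + integral {a'..b} F = integral {a..b} F" if "a \<le> a'" "a' \<le> b" for a a' b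
      using that by (intro Henstock_Kurzweil_Integration.integral_combine int) auto
    show ?thesis
      using add[of c "c + pi / 2" "c + pi / 2 + pi / 2"] add[of c "c + pi" "c + pi + pi / 2"]
        add[of c "c + 3 * pi / 2" "c + 3 * pi / 2 + pi / 2"]
      unfolding quarters by simp
  qed
  have shift: "integral {-pi..pi} F = integral {c..c + 2 * pi} F"
    if "\<And>S. continuous_on S F" "\<And>x. F (x + 2 * pi) = F x" for F :: "real \<Rightarrow> real"
    using integral_over_period[of F "2 * pi" "-pi" c] that by simp
  have [simp]: "g (x + 2 * pi) = g x" for x by (rule periodic_derivative[OF G per])
  have lin: "4 * X' \<le> Y'" if "X = a + b + c + d" "Y = a' + b' + c' + d'"
    "4 * a \<le> a'" "4 * b \<le> b'" "4 * c \<le> c'" "4 * d \<le> d'" "X' = X" "Y' = Y"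
    for X Y X' Y' a b c d a' b' c' d' :: real
    using that by argo
  have "integral {c..c + 2 * pi} (\<lambda>x. (G x)\<^sup>2) = integral {c..c + pi / 2} (\<lambda>x. (G x)\<^sup>2)
      + integral {c + pi / 2..c + pi / 2 + pi / 2} (\<lambda>x. (G x)\<^sup>2) + integral {c + pi..c + pi + pi / 2} (\<lambda>x. (G x)\<^sup>2)
      + integral {c + 3 * pi / 2..c + 3 * pi / 2 + pi / 2} (\<lambda>x. (G x)\<^sup>2)"
    by (rule split) (intro continuous_intros contG)
  moreover have "integral {c..c + 2 * pi} (\<lambda>x. (g x)\<^sup>2) = integral {c..c + pi / 2} (\<lambda>x. (g x)\<^sup>2)
      + integral {c + pi / 2..c + pi / 2 + pi / 2} (\<lambda>x. (g x)\<^sup>2) + integral {c + pi..c + pi + pi / 2} (\<lambda>x. (g x)\<^sup>2)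
      + integral {c + 3 * pi / 2..c + 3 * pi / 2 + pi / 2} (\<lambda>x. (g x)\<^sup>2)"
    by (rule split) (intro continuous_intros contg)
  moreover have "4 * integral {c..c + pi / 2} (\<lambda>x. (G x)\<^sup>2) \<le> integral {c..c + pi / 2} (\<lambda>x. (g x)\<^sup>2)"
    "4 * integral {c + pi / 2..c + pi / 2 + pi / 2} (\<lambda>x. (G x)\<^sup>2) \<le> integral {c + pi / 2..c + pi / 2 + pi / 2} (\<lambda>x. (g x)\<^sup>2)"
    "4 * integral {c + pi..c + pi + pi / 2} (\<lambda>x. (G x)\<^sup>2) \<le> integral {c + pi..c + pi + pi / 2} (\<lambda>x. (g x)\<^sup>2)"
    "4 * integral {c + 3 * pi / 2..c + 3 * pi / 2 + pi / 2} (\<lambda>x. (G x)\<^sup>2)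
      \<le> integral {c + 3 * pi / 2..c + 3 * pi / 2 + pi / 2} (\<lambda>x. (g x)\<^sup>2)"
    by (rule quarter; use z per[of c] quarters in \<open>simp only:\<close>)+
  moreover have "integral {-pi..pi} (\<lambda>x. (G x)\<^sup>2) = integral {c..c + 2 * pi} (\<lambda>x. (G x)\<^sup>2)"
    by (rule shift) (simp_all add: per contG continuous_on_power)
  moreover have "integral {-pi..pi} (\<lambda>x. (g x)\<^sup>2) = integral {c..c + 2 * pi} (\<lambda>x. (g x)\<^sup>2)"
    by (rule shift) (simp_all add: contg continuous_on_power)
  ultimately show ?thesis by (rule lin)
qed

text \<open>Four equidistant values \<open>y\<^sub>0, y\<^sub>1, y\<^sub>2, y\<^sub>3\<close> can be interpolated by \<open>1, cos, sin\<close> iff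
\<open>y\<^sub>0 - y\<^sub>1 + y\<^sub>2 - y\<^sub>3 = 0\<close>. This alternating sum changes sign when the points are rotated by a quarter
turn, so it vanishes for some position of the points.\<close>

lemma exists_trig_interpolant:
  fixes f :: "real \<Rightarrow> real"
  assumes f: "continuous_on UNIV f" and per: "\<And>x. f (x + 2 * pi) = f x"
  obtains c c0 c1 c2 where "\<forall>x \<in> {c, c + pi / 2, c + pi, c + 3 * pi / 2}. f x = c0 + c1 * cos x + c2 * sin x"
proof -
  define D where "D x = f x - f (x + pi / 2) + f (x + pi) - f (x + 3 * pi / 2)" for x
  have quarters: "pi / 2 + pi / 2 = pi" "pi / 2 + pi = 3 * pi / 2" "pi / 2 + 3 * pi / 2 = 0 + 2 * pi"
      by linarith+
  have anti: "D (pi / 2) = - D 0"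
      using per[of 0] unfolding D_def quarters by (simp only: add_0)
  have cont: "continuous_on {0..pi / 2} D"
    unfolding D_def
    by (intro continuous_intros continuous_on_compose2[OF f]) auto
  have "\<exists>c. 0 \<le> c \<and> c \<le> pi / 2 \<and> D c = 0"
  proof (cases "D 0 \<le> 0")
    case True then show ?thesis using IVT'[of D 0 0 "pi/2"] anti cont by simp
  next case False then show ?thesis using IVT2'[of D "pi/2" 0 0] anti cont by simp
  qed
  then obtain c where c: "D c = 0" by blast
  define A B where "A = (f c - f (c + pi)) / 2" and "B = (f (c + pi / 2) - f (c + 3 * pi / 2)) / 2"
  define c0 where "c0 = (f c + f (c + pi)) / 2"
  have c0: "c0 = (f (c + pi / 2) + f (c + 3 * pi / 2)) / 2" using c unfolding D_def c0_def by argo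
  have comb: "(A * cos c - B * sin c) * cos x + (A * sin c + B * cos c) * sin x
    = A * cos (x - c) + B * sin (x - c)" for x
    by (simp add: cos_diff sin_diff algebra_simps)
  have "f x = c0 + (A * cos c - B * sin c) * cos x + (A * sin c + B * cos c) * sin x"
    if "x \<in> {c, c + pi / 2, c + pi, c + 3 * pi / 2}" for x
  proof -
    have "f x = c0 + (A * cos (x - c) + B * sin (x - c))"
      using that
    proof (elim insertE emptyE)
      assume x: "x = c + 3 * pi / 2"
      have "cos (3 * pi / 2) = 0" "sin (3 * pi / 2) = -1"
        using cos_3over2_pi sin_3over2_pi by (simp_all add: mult.commute)
      then have "A * cos (x - c) = 0" "B * sin (x - c) = - B" unfolding x by simp_all
      then show ?thesis unfolding x c0 B_def by argo
    next
      assume x: "x = c + pi / 2"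
      have "A * cos (x - c) = 0" "B * sin (x - c) = B" unfolding x by simp_all
      then show ?thesis unfolding x c0 B_def by argo
    next
      assume x: "x = c + pi"
      have "A * cos (x - c) = - A" "B * sin (x - c) = 0" unfolding x by simp_all
      then show ?thesis unfolding x c0_def A_def by argo
    next
      assume x: "x = c"
      have "A * cos (x - c) = A" "B * sin (x - c) = 0" unfolding x by simp_all
      then show ?thesis unfolding x c0_def A_def by argo
    qed
    then show ?thesis using comb[of x] by linarith
  qed
  then show ?thesis by (intro that[of c]) blast
qed

text \<open>For the modes \<open>k\<close> this says \<open>k\<^sup>2 \<ge> 4\<close> for \<open>k \<ge> 2\<close>, with equality \<open>1 = 4 - 3\<close> in mode \<open>1\<close>. Subtracting from
\<open>f\<close> an interpolant \<open>c\<^sub>0 + c\<^sub>1 cos + c\<^sub>2 sin\<close> at four equidistant points gives a function to which the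
Dirichlet bound applies on each quarter. In the difference of the two sides, \<open>c\<^sub>0\<close> enters with a
favourable sign, and \<open>c\<^sub>1, c\<^sub>2\<close> enter through complete squares that vanish at the Fourier coefficients.\<close>

lemma second_angular_gap:
  fixes f f' :: "real \<Rightarrow> real"
  assumes f: "\<And>x. (f has_real_derivative f' x) (at x)" and f': "continuous_on UNIV f'"
    and per: "\<And>x. f (x + 2 * pi) = f x"
    and mean: "integral {-pi..pi} f = 0"
  defines "\<alpha> \<equiv> integral {-pi..pi} (\<lambda>x. f x * cos x)" and "\<beta> \<equiv> integral {-pi..pi} (\<lambda>x. f x * sin x)"
  shows "4 * integral {-pi..pi} (\<lambda>x. (f x)\<^sup>2) - 3 / pi * (\<alpha>\<^sup>2 + \<beta>\<^sup>2) \<le> integral {-pi..pi} (\<lambda>x. (f' x)\<^sup>2)"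
proof -
  let ?I = "{-pi..pi}"
  have contf: "continuous_on S f" for S
    using f by (meson DERIV_isCont continuous_at_imp_continuous_on)
  have contf': "continuous_on S f'" for S
    using f' continuous_on_subset by blast
  obtain c c0 c1 c2 where c: "\<forall>x \<in> {c, c + pi / 2, c + pi, c + 3 * pi / 2}. f x = c0 + c1 * cos x + c2 * sin x"
    using exists_trig_interpolant[OF contf per] by blast
  define G where "G x = f x - (c0 + c1 * cos x + c2 * sin x)" for x
  define g where "g x = f' x - (c2 * cos x - c1 * sin x)" for x
  have key: "4 * integral ?I (\<lambda>x. (G x)\<^sup>2) \<le> integral ?I (\<lambda>x. (g x)\<^sup>2)"
  proof (rule wirtinger_four_zeros)
    show "(G has_real_derivative g x) (at x)" for x
      unfolding G_def g_def by (auto intro!: derivative_eq_intros f)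
    show "continuous_on UNIV g" unfolding g_def by (intro continuous_intros contf')
  qed (use c in \<open>auto simp: G_def per\<close>)
  have I: "((\<lambda>x. (f x)\<^sup>2) has_integral integral ?I (\<lambda>x. (f x)\<^sup>2)) ?I"
    "((\<lambda>x. (f' x)\<^sup>2) has_integral integral ?I (\<lambda>x. (f' x)\<^sup>2)) ?I"
    "((\<lambda>x. f x * cos x) has_integral \<alpha>) ?I"
    "((\<lambda>x. f x * sin x) has_integral \<beta>) ?I"
    unfolding \<alpha>_def \<beta>_def
    by (intro integrable_integral integrable_continuous_real continuous_intros contf contf')+
  have If: "(f has_integral 0) ?I"
    using mean by (metis contf integrable_continuous_real integrable_integral)
  note ftc = has_integral_real_derivative[of "-pi" pi, simplified]
  have fpi: "f (- pi) = f pi" using per[of "-pi"] by simp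
  note d = DERIV_trig_square_primitives
  have T: "((\<lambda>x. (c0 + c1 * cos x + c2 * sin x)\<^sup>2) has_integral (2 * pi * c0\<^sup>2 + pi * (c1\<^sup>2 + c2\<^sup>2))) ?I"
  proof -
    define W where "W x = c0\<^sup>2 * x + c1\<^sup>2 * ((x + sin x * cos x) / 2) + c2\<^sup>2 * ((x - sin x * cos x) / 2)
       + 2 * c0 * c1 * sin x - 2 * c0 * c2 * cos x + c1 * c2 * (sin x)\<^sup>2" for x
    have "(W has_real_derivative (c0 + c1 * cos x + c2 * sin x)\<^sup>2) (at x)" for x
      unfolding W_def
      by (rule DERIV_cong, (rule d DERIV_add DERIV_diff DERIV_cmult DERIV_power DERIV_sin DERIV_cos DERIV_ident)+)
        (simp add: power2_eq_square algebra_simps)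
    from ftc[OF this] show ?thesis by (simp add: W_def algebra_simps)
  qed
  have T': "((\<lambda>x. (c2 * cos x - c1 * sin x)\<^sup>2) has_integral (pi * (c1\<^sup>2 + c2\<^sup>2))) ?I"
  proof -
    define W where "W x = c2\<^sup>2 * ((x + sin x * cos x) / 2) + c1\<^sup>2 * ((x - sin x * cos x) / 2)
       - c1 * c2 * (sin x)\<^sup>2" for x
    have "(W has_real_derivative (c2 * cos x - c1 * sin x)\<^sup>2) (at x)" for x
      unfolding W_def
      by (rule DERIV_cong, (rule d DERIV_add DERIV_diff DERIV_cmult DERIV_power DERIV_sin DERIV_cos DERIV_ident)+)
        (simp add: power2_eq_square algebra_simps)
    from ftc[OF this] show ?thesis by (simp add: W_def algebra_simps)
  qed
  have cross: "((\<lambda>x. f' x * (c2 * cos x - c1 * sin x)) has_integral (c1 * \<alpha> + c2 * \<beta>)) ?I"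
  proof -
    define W where "W x = f x * (c2 * cos x - c1 * sin x)" for x
    have "(W has_real_derivative f' x * (c2 * cos x - c1 * sin x) - f x * (c2 * sin x + c1 * cos x)) (at x)" for x
      unfolding W_def
      by (rule DERIV_cong, (rule DERIV_mult f DERIV_diff DERIV_cmult DERIV_sin DERIV_cos)+)
        (simp add: algebra_simps)
    from ftc[OF this]
    have "((\<lambda>x. f' x * (c2 * cos x - c1 * sin x) - f x * (c2 * sin x + c1 * cos x)) has_integral 0) ?I"
      by (simp add: W_def fpi)
    from has_integral_add[OF this has_integral_add[OF has_integral_mult_right[OF I(3), of c1] has_integral_mult_right[OF I(4), of c2]]]
    show ?thesis by (simp add: algebra_simps)
  qed
  have "((\<lambda>x. (G x)\<^sup>2) has_integral (integral ?I (\<lambda>x. (f x)\<^sup>2) - 2 * (c0 * 0 + c1 * \<alpha> + c2 * \<beta>)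
      + (2 * pi * c0\<^sup>2 + pi * (c1\<^sup>2 + c2\<^sup>2)))) ?I"
    by (rule has_integral_eq[OF _ has_integral_add[OF has_integral_diff[OF I(1) has_integral_mult_right[OF
        has_integral_add[OF has_integral_add[OF has_integral_mult_right[OF If] has_integral_mult_right[OF I(3)]]
          has_integral_mult_right[OF I(4)]]]] T]])
      (simp add: G_def power2_eq_square algebra_simps)
  then have G2: "integral ?I (\<lambda>x. (G x)\<^sup>2) = integral ?I (\<lambda>x. (f x)\<^sup>2) - 2 * (c1 * \<alpha> + c2 * \<beta>)
      + (2 * pi * c0\<^sup>2 + pi * (c1\<^sup>2 + c2\<^sup>2))"
    by (simp add: integral_unique)
  have "((\<lambda>x. (g x)\<^sup>2) has_integral (integral ?I (\<lambda>x. (f' x)\<^sup>2) - 2 * (c1 * \<alpha> + c2 * \<beta>)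
      + pi * (c1\<^sup>2 + c2\<^sup>2))) ?I"
    by (rule has_integral_eq[OF _ has_integral_add[OF has_integral_diff[OF I(2) 
       has_integral_mult_right[OF cross]] T']])
      (simp add: g_def power2_eq_square algebra_simps)
  then have g2: "integral ?I (\<lambda>x. (g x)\<^sup>2) = integral ?I (\<lambda>x. (f' x)\<^sup>2) - 2 * (c1 * \<alpha> + c2 * \<beta>)
      + pi * (c1\<^sup>2 + c2\<^sup>2)"
    by (simp add: integral_unique)
  have "4 * F - (p + q) \<le> F'" if "0 \<le> 3 * u - 6 * x + p" "0 \<le> 3 * v - 6 * y + q" "0 \<le> w"
    "4 * (F - 2 * (x + y) + (2 * w + (u + v))) \<le> F' - 2 * (x + y) + (u + v)" for F F' p q u v w x y :: real
    using that by argo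
  note lin = this[of "pi * c1\<^sup>2" "c1 * \<alpha>" "3 / pi * \<alpha>\<^sup>2" "pi * c2\<^sup>2" "c2 * \<beta>" "3 / pi * \<beta>\<^sup>2" "pi * c0\<^sup>2"]
  have sq: "0 \<le> 3 * (pi * c\<^sup>2) - 6 * (c * x) + 3 / pi * x\<^sup>2" for c x
  proof -
    have "3 * (pi * c\<^sup>2) - 6 * (c * x) + 3 / pi * x\<^sup>2 = 3 * pi * (c - x / pi)\<^sup>2"
      by (simp add: power2_eq_square field_simps)
    then show ?thesis by simp
  qed
  show ?thesis
    unfolding distrib_left[of "3 / pi"]
  proof (rule lin[OF sq sq])
    show "4 * (integral ?I (\<lambda>x. (f x)\<^sup>2) - 2 * (c1 * \<alpha> + c2 * \<beta>) + (2 * (pi * c0\<^sup>2) + (pi * c1\<^sup>2 + pi * c2\<^sup>2)))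
      \<le> integral ?I (\<lambda>x. (f' x)\<^sup>2) - 2 * (c1 * \<alpha> + c2 * \<beta>) + (pi * c1\<^sup>2 + pi * c2\<^sup>2)"
      using key unfolding G2 g2 by (simp only: distrib_left mult.assoc)
  qed simp
qed

lemma trig_bessel:
  fixes g :: "real \<Rightarrow> real"
  assumes g: "continuous_on {-pi..pi} g"
  shows "1 / pi * ((integral {-pi..pi} (\<lambda>x. g x * cos x))\<^sup>2 + (integral {-pi..pi} (\<lambda>x. g x * sin x))\<^sup>2)
    \<le> integral {-pi..pi} (\<lambda>x. (g x)\<^sup>2)"
proof -
  let ?I = "{-pi..pi}"
  define \<alpha> \<beta> where "\<alpha> = integral ?I (\<lambda>x. g x * cos x)" and "\<beta> = integral ?I (\<lambda>x. g x * sin x)"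
  have I: "((\<lambda>x. (g x)\<^sup>2) has_integral integral ?I (\<lambda>x. (g x)\<^sup>2)) ?I"
    "((\<lambda>x. g x * cos x) has_integral \<alpha>) ?I"
    "((\<lambda>x. g x * sin x) has_integral \<beta>) ?I"
    unfolding \<alpha>_def \<beta>_def
    by (intro integrable_integral integrable_continuous_real continuous_intros g)+
  define W where "W x = \<alpha>\<^sup>2 * ((x + sin x * cos x) / 2) + \<beta>\<^sup>2 * ((x - sin x * cos x) / 2)
       + \<alpha> * \<beta> * (sin x)\<^sup>2" for x
  note d = DERIV_trig_square_primitives
  have "(W has_real_derivative (\<alpha> * cos x + \<beta> * sin x)\<^sup>2) (at x)" for x
    unfolding W_def
    by (rule DERIV_cong, (rule d DERIV_add DERIV_diff DERIV_cmult DERIV_power DERIV_sin DERIV_cos DERIV_ident)+)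
      (simp add: power2_eq_square algebra_simps)
  then have "((\<lambda>x. (\<alpha> * cos x + \<beta> * sin x)\<^sup>2) has_integral (W pi - W (-pi))) ?I"
    by (intro has_integral_real_derivative) simp_all
  then have T: "((\<lambda>x. (\<alpha> * cos x + \<beta> * sin x)\<^sup>2) has_integral (pi * (\<alpha>\<^sup>2 + \<beta>\<^sup>2))) ?I"
    by (simp add: W_def algebra_simps)
  have "((\<lambda>x. (g x)\<^sup>2 - 2 / pi * (\<alpha> * (g x * cos x) + \<beta> * (g x * sin x)) + 1 / pi\<^sup>2 * (\<alpha> * cos x + \<beta> * sin x)\<^sup>2)
    has_integral (integral ?I (\<lambda>x. (g x)\<^sup>2) - 2 / pi * (\<alpha> * \<alpha> + \<beta> * \<beta>) + 1 / pi\<^sup>2 * (pi * (\<alpha>\<^sup>2 + \<beta>\<^sup>2)))) ?I"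
    by (intro has_integral_add has_integral_diff has_integral_mult_right I T)
  moreover have "(g x)\<^sup>2 - 2 / pi * (\<alpha> * (g x * cos x) + \<beta> * (g x * sin x)) + 1 / pi\<^sup>2 * (\<alpha> * cos x + \<beta> * sin x)\<^sup>2
      = (g x - 1 / pi * (\<alpha> * cos x + \<beta> * sin x))\<^sup>2" for x
    by (simp add: power2_eq_square field_simps)
  ultimately have "0 \<le> integral ?I (\<lambda>x. (g x)\<^sup>2) - 2 / pi * (\<alpha> * \<alpha> + \<beta> * \<beta>) + 1 / pi\<^sup>2 * (pi * (\<alpha>\<^sup>2 + \<beta>\<^sup>2))"
    by (metis (no_types, lifting) has_integral_nonneg zero_le_power2)
  also have "\<dots> = integral ?I (\<lambda>x. (g x)\<^sup>2) - 1 / pi * (\<alpha>\<^sup>2 + \<beta>\<^sup>2)"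
    by (simp add: power2_eq_square field_simps)
  finally show ?thesis by (simp add: \<alpha>_def \<beta>_def)
qed

section \<open>The inequality on one circle\<close>

lemma DERIV_integral_param:
  fixes g gt :: "real \<Rightarrow> real \<Rightarrow> real"
  assumes g: "\<And>t x. ((\<lambda>t. g t x) has_real_derivative gt t x) (at t)"
    and gt: "continuous_on UNIV (\<lambda>p. gt (fst p) (snd p))" and gx: "\<And>t. continuous_on UNIV (g t)"
  shows "((\<lambda>t. integral {a..b} (g t)) has_real_derivative integral {a..b} (gt t)) (at t)"
proof -
  have "g s integrable_on {a..b}" for s
    by (intro integrable_continuous_real continuous_on_subset[OF gx] subset_UNIV)
  moreover have "continuous_on (UNIV \<times> cbox a b) (\<lambda>(t, x). gt t x)"
    unfolding split_beta' by (rule continuous_on_subset[OF gt]) simp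
  ultimately have "((\<lambda>t. integral (cbox a b) (g t)) has_real_derivative integral (cbox a b) (gt t)) (at t within UNIV)"
    by (intro leibniz_rule_field_derivative) (simp_all add: g)
  then show ?thesis by (simp only: cbox_interval)
qed

lemma integral_derivative_periodic:
  fixes g :: "real \<Rightarrow> real"
  assumes "\<And>\<theta>. (g has_real_derivative g' \<theta>) (at \<theta>)" "\<And>\<theta>. g (\<theta> + 2 * pi) = g \<theta>"
  shows "(g' has_integral 0) {-pi..pi}"
  using has_integral_real_derivative[of "-pi" pi g g'] assms(1) assms(2)[of "-pi"] by simp

text \<open>The quotient of the two integrals in mode \<open>1\<close> minus the one in mode \<open>0\<close>, both at frequency
\<open>\<tau> = 0\<close>, replaced by \<open>0\<close> if mode \<open>0\<close> is the lower one.\<close>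

definition excess :: "real \<Rightarrow> real" where
  "excess \<gamma> = min 0 ((1 + (1 - \<gamma>)\<^sup>2 - 4 * (1 - \<gamma>)) / (1 + (1 - \<gamma>)\<^sup>2))"

text \<open>The image of a solenoidal field in log-polar coordinates: \<open>f\<close> and \<open>h\<close> stand for the components of
\<open>e\<^bsup>\<gamma>t\<^esup> u\<close>, and \<open>vanish\<close> reflects that \<open>u\<close> has bounded support. The other end
\<open>t \<rightarrow> -\<infinity>\<close> is the origin.\<close>

locale solenoidal_polar_field =
  fixes \<gamma> :: real and f f_t f_\<theta> h h_t h_\<theta> :: "real \<Rightarrow> real \<Rightarrow> real"
  assumes f_t: "\<And>t \<theta>. ((\<lambda>t. f t \<theta>) has_real_derivative f_t t \<theta>) (at t)"
    and f_\<theta>: "\<And>t \<theta>. (f t has_real_derivative f_\<theta> t \<theta>) (at \<theta>)"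
    and h_t: "\<And>t \<theta>. ((\<lambda>t. h t \<theta>) has_real_derivative h_t t \<theta>) (at t)"
    and h_\<theta>: "\<And>t \<theta>. (h t has_real_derivative h_\<theta> t \<theta>) (at \<theta>)"
    and cont: "continuous_on UNIV (\<lambda>p. f (fst p) (snd p))" "continuous_on UNIV (\<lambda>p. h (fst p) (snd p))"
      "continuous_on UNIV (\<lambda>p. f_t (fst p) (snd p))" "continuous_on UNIV (\<lambda>p. h_t (fst p) (snd p))"
      "continuous_on UNIV (\<lambda>p. f_\<theta> (fst p) (snd p))" "continuous_on UNIV (\<lambda>p. h_\<theta> (fst p) (snd p))"
    and periodic: "\<And>t \<theta>. f t (\<theta> + 2 * pi) = f t \<theta>" "\<And>t \<theta>. h t (\<theta> + 2 * pi) = h t \<theta>"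
    and divfree: "\<And>t \<theta>. h_\<theta> t \<theta> = - (f_t t \<theta> + (1 - \<gamma>) * f t \<theta>)"
    and vanish: "\<exists>T. \<forall>t\<ge>T. \<forall>\<theta>. f t \<theta> = 0 \<and> h t \<theta> = 0"
begin

definition mass :: "real \<Rightarrow> real" where
  "mass t = integral {-pi..pi} (\<lambda>\<theta>. (f t \<theta>)\<^sup>2 + (h t \<theta>)\<^sup>2)"

definition energy_density :: "real \<Rightarrow> real \<Rightarrow> real" where
  "energy_density t \<theta> = (f_t t \<theta> - \<gamma> * f t \<theta>)\<^sup>2 + (h_t t \<theta> - \<gamma> * h t \<theta>)\<^sup>2
     + (f_\<theta> t \<theta> - h t \<theta>)\<^sup>2 + (h_\<theta> t \<theta> + f t \<theta>)\<^sup>2"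

definition energy :: "real \<Rightarrow> real" where
  "energy t = integral {-pi..pi} (energy_density t)"

lemma slice_cont:
  "continuous_on S (f t)" "continuous_on S (h t)" "continuous_on S (f_t t)" "continuous_on S (h_t t)"
  "continuous_on S (f_\<theta> t)" "continuous_on S (h_\<theta> t)"
proof -
  have "continuous_on S (\<lambda>\<theta>. (t, \<theta>))" by (intro continuous_intros)
  note cont[THEN continuous_on_compose2, OF this subset_UNIV]
  then show "continuous_on S (f t)" "continuous_on S (h t)" "continuous_on S (f_t t)" "continuous_on S (h_t t)"
    "continuous_on S (f_\<theta> t)" "continuous_on S (h_\<theta> t)"
    by simp_all
qed

lemma slice_int:
  "((\<lambda>\<theta>. (f t \<theta>)\<^sup>2) has_integral integral {-pi..pi} (\<lambda>\<theta>. (f t \<theta>)\<^sup>2)) {-pi..pi}"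
  "((\<lambda>\<theta>. (h t \<theta>)\<^sup>2) has_integral integral {-pi..pi} (\<lambda>\<theta>. (h t \<theta>)\<^sup>2)) {-pi..pi}"
  "((\<lambda>\<theta>. (f_\<theta> t \<theta>)\<^sup>2) has_integral integral {-pi..pi} (\<lambda>\<theta>. (f_\<theta> t \<theta>)\<^sup>2)) {-pi..pi}"
  "((\<lambda>\<theta>. f t \<theta> * f_t t \<theta>) has_integral integral {-pi..pi} (\<lambda>\<theta>. f t \<theta> * f_t t \<theta>)) {-pi..pi}"
  "((\<lambda>\<theta>. h t \<theta> * h_t t \<theta>) has_integral integral {-pi..pi} (\<lambda>\<theta>. h t \<theta> * h_t t \<theta>)) {-pi..pi}"
  "(energy_density t has_integral energy t) {-pi..pi}"
  unfolding energy_def energy_density_def[abs_def]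
  by (intro integrable_integral integrable_continuous_real continuous_intros slice_cont)+

lemma mass_split: "mass t = integral {-pi..pi} (\<lambda>\<theta>. (f t \<theta>)\<^sup>2) + integral {-pi..pi} (\<lambda>\<theta>. (h t \<theta>)\<^sup>2)"
  unfolding mass_def by (intro integral_unique has_integral_add slice_int)

lemma mass_nonneg: "0 \<le> mass t"
  unfolding mass_def by (intro integral_nonneg integrable_continuous_real continuous_intros slice_cont) auto

lemma energy_density_nonneg: "0 \<le> energy_density t \<theta>"
  by (simp add: energy_density_def)

lemma energy_nonneg: "0 \<le> energy t"
  by (rule has_integral_nonneg[OF slice_int(6)]) (rule energy_density_nonneg)

lemma DERIV_square_mass:
  "((\<lambda>t. integral {-pi..pi} (\<lambda>\<theta>. (f t \<theta>)\<^sup>2)) has_real_derivative 2 * integral {-pi..pi} (\<lambda>\<theta>. f t \<theta> * f_t t \<theta>)) (at t)"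
  "((\<lambda>t. integral {-pi..pi} (\<lambda>\<theta>. (h t \<theta>)\<^sup>2)) has_real_derivative 2 * integral {-pi..pi} (\<lambda>\<theta>. h t \<theta> * h_t t \<theta>)) (at t)"
proof -
  have "((\<lambda>t. integral {-pi..pi} (\<lambda>\<theta>. (f t \<theta>)\<^sup>2)) has_real_derivative integral {-pi..pi} (\<lambda>\<theta>. 2 * (f t \<theta> * f_t t \<theta>))) (at t)"
    by (rule DERIV_integral_param, rule DERIV_cong, rule DERIV_power, rule f_t, simp)
      (intro continuous_intros cont slice_cont)+
  then show "((\<lambda>t. integral {-pi..pi} (\<lambda>\<theta>. (f t \<theta>)\<^sup>2)) has_real_derivative 2 * integral {-pi..pi} (\<lambda>\<theta>. f t \<theta> * f_t t \<theta>)) (at t)"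
    by simp
  have "((\<lambda>t. integral {-pi..pi} (\<lambda>\<theta>. (h t \<theta>)\<^sup>2)) has_real_derivative integral {-pi..pi} (\<lambda>\<theta>. 2 * (h t \<theta> * h_t t \<theta>))) (at t)"
    by (rule DERIV_integral_param, rule DERIV_cong, rule DERIV_power, rule h_t, simp)
      (intro continuous_intros cont slice_cont)+
  then show "((\<lambda>t. integral {-pi..pi} (\<lambda>\<theta>. (h t \<theta>)\<^sup>2)) has_real_derivative 2 * integral {-pi..pi} (\<lambda>\<theta>. h t \<theta> * h_t t \<theta>)) (at t)"
    by simp
qed

lemma mass_continuous: "continuous_on S mass"
proof (rule DERIV_continuous_on)
  show "(mass has_field_derivative (2 * integral {-pi..pi} (\<lambda>\<theta>. f t \<theta> * f_t t \<theta>)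
     + 2 * integral {-pi..pi} (\<lambda>\<theta>. h t \<theta> * h_t t \<theta>))) (at t within S)" for t
    unfolding mass_split[abs_def]
    by (rule has_field_derivative_at_within) (intro DERIV_add DERIV_square_mass)
qed

lemma energy_continuous: "continuous_on S energy"
proof -
  have "continuous_on UNIV (\<lambda>t. integral (cbox (-pi) pi) (energy_density t))"
    by (rule integral_continuous_on_param)
      (auto simp: split_beta' energy_density_def[abs_def] intro!: continuous_intros continuous_on_subset[OF cont(1)] 
        continuous_on_subset[OF cont(2)] continuous_on_subset[OF cont(3)] continuous_on_subset[OF cont(4)]
        continuous_on_subset[OF cont(5)] continuous_on_subset[OF cont(6)])
  then show ?thesis
    by (auto simp: energy_def[abs_def] cbox_interval intro: continuous_on_subset)
qed

text \<open>No flux through circles: integrating the divergence equation over the circle shows that the mean of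
\<open>f\<close> is a multiple of \<open>e\<^bsup>-(1-\<gamma>)t\<^esup>\<close>, and it vanishes for large \<open>t\<close>.\<close>

lemma radial_mean_zero: "integral {-pi..pi} (f t) = 0"
proof -
  define F where "F t = integral {-pi..pi} (f t)" for t
  have int: "(f t has_integral F t) {-pi..pi}" "(f_t t has_integral integral {-pi..pi} (f_t t)) {-pi..pi}" for t
    unfolding F_def by (intro integrable_integral integrable_continuous_real slice_cont)+
  have F': "(F has_real_derivative - (1 - \<gamma>) * F t) (at t)" for t
  proof -
    have "(h_\<theta> t has_integral 0) {-pi..pi}"
      by (rule integral_derivative_periodic[OF h_\<theta> periodic(2)])
    moreover have "(h_\<theta> t has_integral - (integral {-pi..pi} (f_t t) + (1 - \<gamma>) * F t)) {-pi..pi}"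
      unfolding divfree[abs_def] by (intro has_integral_neg has_integral_add has_integral_mult_right int)
    ultimately have "0 = - (integral {-pi..pi} (f_t t) + (1 - \<gamma>) * F t)"
      by (rule has_integral_unique)
    then have eq: "integral {-pi..pi} (f_t t) = - (1 - \<gamma>) * F t" by argo
    have "(F has_real_derivative integral {-pi..pi} (f_t t)) (at t)"
      unfolding F_def by (rule DERIV_integral_param[OF f_t cont(3) slice_cont(1)])
    then show ?thesis by (simp only: eq)
  qed
  have "((\<lambda>t. exp ((1 - \<gamma>) * t) * F t) has_real_derivative 0) (at t)" for t
    by (rule DERIV_cong, rule DERIV_mult, rule DERIV_chain2[OF DERIV_exp], rule DERIV_cmult, rule DERIV_ident, rule F')
      (simp add: algebra_simps)
  then have const: "exp ((1 - \<gamma>) * s) * F s = exp ((1 - \<gamma>) * t) * F t" for s t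
    by (rule DERIV_isconst_all[rule_format]) 
  obtain T where "\<forall>\<theta>. f T \<theta> = 0" using vanish by blast
  then have "f T = (\<lambda>_. 0)" by auto
  then have "F T = 0" by (simp add: F_def)
  with const[of t T] show ?thesis by (simp add: F_def)
qed

definition cos_coeff :: "real \<Rightarrow> real" where "cos_coeff t = integral {-pi..pi} (\<lambda>\<theta>. f t \<theta> * cos \<theta>)"
definition sin_coeff :: "real \<Rightarrow> real" where "sin_coeff t = integral {-pi..pi} (\<lambda>\<theta>. f t \<theta> * sin \<theta>)"
definition cos_coeff' :: "real \<Rightarrow> real" where "cos_coeff' t = integral {-pi..pi} (\<lambda>\<theta>. f_t t \<theta> * cos \<theta>)"
definition sin_coeff' :: "real \<Rightarrow> real" where "sin_coeff' t = integral {-pi..pi} (\<lambda>\<theta>. f_t t \<theta> * sin \<theta>)"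

lemma DERIV_coeff:
  "(cos_coeff has_real_derivative cos_coeff' t) (at t)"
  "(sin_coeff has_real_derivative sin_coeff' t) (at t)"
proof -
  have "((\<lambda>t. f t \<theta> * c) has_real_derivative f_t t \<theta> * c) (at t)" for c t \<theta>
    by (rule DERIV_cmult_right[OF f_t])
  note d = DERIV_integral_param[OF this]
  show "(cos_coeff has_real_derivative cos_coeff' t) (at t)"
    unfolding cos_coeff_def[abs_def] cos_coeff'_def
    by (rule d) (intro continuous_intros cont slice_cont)+
  show "(sin_coeff has_real_derivative sin_coeff' t) (at t)"
    unfolding sin_coeff_def[abs_def] sin_coeff'_def
    by (rule d) (intro continuous_intros cont slice_cont)+
qed

text \<open>By the divergence equation, the first Fourier coefficients of \<open>h\<close> are those of \<open>f\<^sub>t + (1-\<gamma>) f\<close>, up to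
sign and order; so Bessel's inequality bounds the angular part from below by the radial one. The
squares of the coefficients of \<open>f\<^sub>t\<close> are dropped.\<close>

lemma angular_bound:
  "1 / pi * ((1 - \<gamma>)\<^sup>2 * ((cos_coeff t)\<^sup>2 + (sin_coeff t)\<^sup>2)
      + 2 * (1 - \<gamma>) * (cos_coeff t * cos_coeff' t + sin_coeff t * sin_coeff' t))
    \<le> integral {-pi..pi} (\<lambda>\<theta>. (h t \<theta>)\<^sup>2)"
proof -
  let ?I = "{-pi..pi}"
  have I: "((\<lambda>\<theta>. f t \<theta> * cos \<theta>) has_integral cos_coeff t) ?I" "((\<lambda>\<theta>. f t \<theta> * sin \<theta>) has_integral sin_coeff t) ?I"
    "((\<lambda>\<theta>. f_t t \<theta> * cos \<theta>) has_integral cos_coeff' t) ?I" "((\<lambda>\<theta>. f_t t \<theta> * sin \<theta>) has_integral sin_coeff' t) ?I"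
    unfolding cos_coeff_def sin_coeff_def cos_coeff'_def sin_coeff'_def
    by (intro integrable_integral integrable_continuous_real continuous_intros slice_cont)+
  have J: "((\<lambda>\<theta>. h t \<theta> * cos \<theta>) has_integral integral ?I (\<lambda>\<theta>. h t \<theta> * cos \<theta>)) ?I"
    "((\<lambda>\<theta>. h t \<theta> * sin \<theta>) has_integral integral ?I (\<lambda>\<theta>. h t \<theta> * sin \<theta>)) ?I"
    by (intro integrable_integral integrable_continuous_real continuous_intros slice_cont)+
  have "((\<lambda>\<theta>. h_\<theta> t \<theta> * cos \<theta> + h t \<theta> * (- sin \<theta>)) has_integral 0) ?I"
  proof (rule integral_derivative_periodic)
    show "((\<lambda>\<theta>. h t \<theta> * cos \<theta>) has_real_derivative h_\<theta> t \<theta> * cos \<theta> + h t \<theta> * (- sin \<theta>)) (at \<theta>)" for \<theta>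
      by (rule DERIV_cong, rule DERIV_mult, rule h_\<theta>, rule DERIV_cos) simp
  qed (simp only: periodic sin_periodic cos_periodic)
  then have "((\<lambda>\<theta>. h t \<theta> * sin \<theta> + (f_t t \<theta> * cos \<theta> + (1 - \<gamma>) * (f t \<theta> * cos \<theta>))) has_integral - 0) ?I"
    by (rule has_integral_eq[rotated, OF has_integral_neg]) (simp add: divfree algebra_simps)
  from has_integral_unique[OF this has_integral_add[OF J(2) has_integral_add[OF I(3) has_integral_mult_right[OF I(1)]]]]
  have s: "integral ?I (\<lambda>\<theta>. h t \<theta> * sin \<theta>) = - (cos_coeff' t + (1 - \<gamma>) * cos_coeff t)" by simp
  have "((\<lambda>\<theta>. h_\<theta> t \<theta> * sin \<theta> + h t \<theta> * cos \<theta>) has_integral 0) ?I"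
  proof (rule integral_derivative_periodic)
    show "((\<lambda>\<theta>. h t \<theta> * sin \<theta>) has_real_derivative h_\<theta> t \<theta> * sin \<theta> + h t \<theta> * cos \<theta>) (at \<theta>)" for \<theta>
      by (rule DERIV_cong, rule DERIV_mult, rule h_\<theta>, rule DERIV_sin) simp
  qed (simp only: periodic sin_periodic cos_periodic)
  then have "((\<lambda>\<theta>. h t \<theta> * cos \<theta> - (f_t t \<theta> * sin \<theta> + (1 - \<gamma>) * (f t \<theta> * sin \<theta>))) has_integral 0) ?I"
    by (rule has_integral_eq[rotated]) (simp add: divfree algebra_simps)
  from has_integral_unique[OF this has_integral_diff[OF J(1) has_integral_add[OF I(4) has_integral_mult_right[OF I(2)]]]]
  have c: "integral ?I (\<lambda>\<theta>. h t \<theta> * cos \<theta>) = sin_coeff' t + (1 - \<gamma>) * sin_coeff t" by simp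
  have "1 / pi * ((1 - \<gamma>)\<^sup>2 * ((cos_coeff t)\<^sup>2 + (sin_coeff t)\<^sup>2)
      + 2 * (1 - \<gamma>) * (cos_coeff t * cos_coeff' t + sin_coeff t * sin_coeff' t))
    \<le> 1 / pi * ((sin_coeff' t + (1 - \<gamma>) * sin_coeff t)\<^sup>2 + (- (cos_coeff' t + (1 - \<gamma>) * cos_coeff t))\<^sup>2)"
  proof (rule mult_left_mono)
    have "(1 - \<gamma>)\<^sup>2 * ((cos_coeff t)\<^sup>2 + (sin_coeff t)\<^sup>2)
      + 2 * (1 - \<gamma>) * (cos_coeff t * cos_coeff' t + sin_coeff t * sin_coeff' t) + ((sin_coeff' t)\<^sup>2 + (cos_coeff' t)\<^sup>2)
      = (sin_coeff' t + (1 - \<gamma>) * sin_coeff t)\<^sup>2 + (- (cos_coeff' t + (1 - \<gamma>) * cos_coeff t))\<^sup>2"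
      by (simp add: power2_eq_square algebra_simps)
    moreover have "0 \<le> (sin_coeff' t)\<^sup>2 + (cos_coeff' t)\<^sup>2" by simp
    ultimately show "(1 - \<gamma>)\<^sup>2 * ((cos_coeff t)\<^sup>2 + (sin_coeff t)\<^sup>2)
      + 2 * (1 - \<gamma>) * (cos_coeff t * cos_coeff' t + sin_coeff t * sin_coeff' t)
      \<le> (sin_coeff' t + (1 - \<gamma>) * sin_coeff t)\<^sup>2 + (- (cos_coeff' t + (1 - \<gamma>) * cos_coeff t))\<^sup>2"
      by linarith
  qed simp
  also have "\<dots> \<le> integral ?I (\<lambda>\<theta>. (h t \<theta>)\<^sup>2)"
    using trig_bessel[OF slice_cont(2)[of _ t]] unfolding s c .
  finally show ?thesis .
qed

text \<open>Its derivative collects the terms of the energy on a circle that are total derivatives in \<open>t\<close>: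
\<open>f f\<^sub>t\<close>, \<open>h h\<^sub>t\<close>, and the derivative that comes from \<open>angular_bound\<close> with weight
\<open>- excess \<gamma>\<close>.\<close>

definition boundary :: "real \<Rightarrow> real" where
  "boundary t = (- 1 - 2 * \<gamma>) * integral {-pi..pi} (\<lambda>\<theta>. (f t \<theta>)\<^sup>2) - \<gamma> * integral {-pi..pi} (\<lambda>\<theta>. (h t \<theta>)\<^sup>2)
      - excess \<gamma> * (1 - \<gamma>) / pi * ((cos_coeff t)\<^sup>2 + (sin_coeff t)\<^sup>2)"

definition boundary' :: "real \<Rightarrow> real" where
  "boundary' t = (- 1 - 2 * \<gamma>) * (2 * integral {-pi..pi} (\<lambda>\<theta>. f t \<theta> * f_t t \<theta>))
      - \<gamma> * (2 * integral {-pi..pi} (\<lambda>\<theta>. h t \<theta> * h_t t \<theta>))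
      - excess \<gamma> * (1 - \<gamma>) / pi * (2 * (cos_coeff t * cos_coeff' t + sin_coeff t * sin_coeff' t))"

lemma DERIV_boundary: "(boundary has_real_derivative boundary' t) (at t)"
  unfolding boundary_def[abs_def] boundary'_def
  by (rule DERIV_cong, (rule DERIV_diff DERIV_cmult DERIV_square_mass DERIV_add DERIV_power DERIV_coeff)+)
     (simp add: algebra_simps)

text \<open>The mixed term \<open>4 f h\<^sub>\<theta>\<close> of the energy, which comes from \<open>(f\<^sub>\<theta> - h)\<^sup>2 + (h\<^sub>\<theta> + f)\<^sup>2\<close> up to a
\<open>\<theta>\<close>-derivative, is turned by the divergence equation into \<open>- 4 f f\<^sub>t - 4 (1-\<gamma>) f\<^sup>2\<close>. Apart from
derivatives in \<open>t\<close>, this is the only term through which the energy can fall below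
\<open>(\<gamma>\<^sup>2 + 1) * mass t\<close>. The squares \<open>2 f\<^sub>t\<^sup>2 + h\<^sub>t\<^sup>2\<close>, small for fields that vary slowly in \<open>t\<close>, are
dropped.\<close>

lemma slice_energy_lower:
  "integral {-pi..pi} (\<lambda>\<theta>. (f_\<theta> t \<theta>)\<^sup>2) + (\<gamma>\<^sup>2 + 1) * mass t
     + ((1 - \<gamma>)\<^sup>2 - 4 * (1 - \<gamma>)) * integral {-pi..pi} (\<lambda>\<theta>. (f t \<theta>)\<^sup>2)
     + (- 1 - 2 * \<gamma>) * (2 * integral {-pi..pi} (\<lambda>\<theta>. f t \<theta> * f_t t \<theta>))
     - \<gamma> * (2 * integral {-pi..pi} (\<lambda>\<theta>. h t \<theta> * h_t t \<theta>)) \<le> energy t"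
proof -
  have 1: "((\<lambda>\<theta>. (f_\<theta> t \<theta>)\<^sup>2 + (\<gamma>\<^sup>2 + 1) * ((f t \<theta>)\<^sup>2 + (h t \<theta>)\<^sup>2) + ((1 - \<gamma>)\<^sup>2 - 4 * (1 - \<gamma>)) * (f t \<theta>)\<^sup>2
      + (- 1 - 2 * \<gamma>) * (2 * (f t \<theta> * f_t t \<theta>)) - \<gamma> * (2 * (h t \<theta> * h_t t \<theta>)) - 2 * (f_\<theta> t \<theta> * h t \<theta> + h_\<theta> t \<theta> * f t \<theta>)) has_integral
    (integral {-pi..pi} (\<lambda>\<theta>. (f_\<theta> t \<theta>)\<^sup>2) + (\<gamma>\<^sup>2 + 1) * mass t
     + ((1 - \<gamma>)\<^sup>2 - 4 * (1 - \<gamma>)) * integral {-pi..pi} (\<lambda>\<theta>. (f t \<theta>)\<^sup>2)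
     + (- 1 - 2 * \<gamma>) * (2 * integral {-pi..pi} (\<lambda>\<theta>. f t \<theta> * f_t t \<theta>))
     - \<gamma> * (2 * integral {-pi..pi} (\<lambda>\<theta>. h t \<theta> * h_t t \<theta>)) - 2 * 0)) {-pi..pi}"
    unfolding mass_split
    by (intro has_integral_add has_integral_diff has_integral_mult_right slice_int
         integral_derivative_periodic[OF DERIV_mult[OF f_\<theta> h_\<theta>]]) (simp only: periodic)
  have "integral {-pi..pi} (\<lambda>\<theta>. (f_\<theta> t \<theta>)\<^sup>2) + (\<gamma>\<^sup>2 + 1) * mass t
     + ((1 - \<gamma>)\<^sup>2 - 4 * (1 - \<gamma>)) * integral {-pi..pi} (\<lambda>\<theta>. (f t \<theta>)\<^sup>2)
     + (- 1 - 2 * \<gamma>) * (2 * integral {-pi..pi} (\<lambda>\<theta>. f t \<theta> * f_t t \<theta>))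
     - \<gamma> * (2 * integral {-pi..pi} (\<lambda>\<theta>. h t \<theta> * h_t t \<theta>)) - 2 * 0 \<le> energy t"
  proof (rule has_integral_le[OF 1 slice_int(6)])
    fix \<theta>
    have "energy_density t \<theta> = (f_\<theta> t \<theta>)\<^sup>2 + (\<gamma>\<^sup>2 + 1) * ((f t \<theta>)\<^sup>2 + (h t \<theta>)\<^sup>2) + ((1 - \<gamma>)\<^sup>2 - 4 * (1 - \<gamma>)) * (f t \<theta>)\<^sup>2
      + (- 1 - 2 * \<gamma>) * (2 * (f t \<theta> * f_t t \<theta>)) - \<gamma> * (2 * (h t \<theta> * h_t t \<theta>)) - 2 * (f_\<theta> t \<theta> * h t \<theta> + h_\<theta> t \<theta> * f t \<theta>)
      + (2 * (f_t t \<theta>)\<^sup>2 + (h_t t \<theta>)\<^sup>2)"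
      unfolding energy_density_def divfree by (simp add: power2_eq_square algebra_simps)
    moreover have "0 \<le> 2 * (f_t t \<theta>)\<^sup>2 + (h_t t \<theta>)\<^sup>2" by simp
    ultimately show "(f_\<theta> t \<theta>)\<^sup>2 + (\<gamma>\<^sup>2 + 1) * ((f t \<theta>)\<^sup>2 + (h t \<theta>)\<^sup>2) + ((1 - \<gamma>)\<^sup>2 - 4 * (1 - \<gamma>)) * (f t \<theta>)\<^sup>2
      + (- 1 - 2 * \<gamma>) * (2 * (f t \<theta> * f_t t \<theta>)) - \<gamma> * (2 * (h t \<theta> * h_t t \<theta>)) - 2 * (f_\<theta> t \<theta> * h t \<theta> + h_\<theta> t \<theta> * f t \<theta>) \<le> energy_density t \<theta>"
      by linarith
  qed
  then show ?thesis by simp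
qed

text \<open>With \<open>B = \<integral>f\<^sup>2\<close>, \<open>H = \<integral>h\<^sup>2\<close>, the mode-\<open>1\<close> part \<open>A \<le> B\<close> of \<open>B\<close> and \<open>m = excess \<gamma> \<le> 0\<close>, the lower
bounds for \<open>\<integral>f\<^sub>\<theta>\<^sup>2\<close> and \<open>H\<close> reduce the claim to
\<open>0 \<le> ((2 - a)\<^sup>2 - m) (B - A) + (1 + a\<^sup>2 - 4 a - m (1 + a\<^sup>2)) A\<close>. The second coefficient is nonnegative by the
choice of \<open>m\<close>, and it is zero if \<open>m < 0\<close>, so that nothing is lost in mode \<open>1\<close>.\<close>

lemma slice_inequality: "(\<gamma>\<^sup>2 + 1 + excess \<gamma>) * mass t + boundary' t \<le> energy t"
proof -
  define a where "a = 1 - \<gamma>"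
  define B where "B = integral {-pi..pi} (\<lambda>\<theta>. (f t \<theta>)\<^sup>2)"
  define H where "H = integral {-pi..pi} (\<lambda>\<theta>. (h t \<theta>)\<^sup>2)"
  define A where "A = 1 / pi * ((cos_coeff t)\<^sup>2 + (sin_coeff t)\<^sup>2)"
  define D where "D = 1 / pi * (2 * (cos_coeff t * cos_coeff' t + sin_coeff t * sin_coeff' t))"
  define m where "m = excess \<gamma>"
  have A: "0 \<le> A" "A \<le> B"
    using trig_bessel[OF slice_cont(1)[of _ t]] by (auto simp: A_def B_def cos_coeff_def sin_coeff_def)
  have gap: "4 * B - 3 * A \<le> integral {-pi..pi} (\<lambda>\<theta>. (f_\<theta> t \<theta>)\<^sup>2)"
    using second_angular_gap[OF f_\<theta> slice_cont(5) periodic(1) radial_mean_zero, of t]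
    by (simp add: A_def B_def cos_coeff_def sin_coeff_def)
  have H: "a\<^sup>2 * A + a * D \<le> H"
  proof -
    have "1 / pi * (x * y + 2 * z * w) = x * (1 / pi * y) + z * (1 / pi * (2 * w))" for x y z w :: real
      by (simp add: algebra_simps)
    from angular_bound[of t, unfolded this] show ?thesis unfolding A_def D_def H_def a_def .
  qed
  have m: "m \<le> 0" "m * (1 + a\<^sup>2) \<le> 1 + a\<^sup>2 - 4 * a"
  proof -
    have pos: "0 < 1 + a\<^sup>2" by (simp add: add_pos_nonneg)
    show "m \<le> 0" by (simp add: m_def excess_def)
    have "m * (1 + a\<^sup>2) \<le> (1 + a\<^sup>2 - 4 * a) / (1 + a\<^sup>2) * (1 + a\<^sup>2)"
      using pos by (intro mult_right_mono) (auto simp: m_def excess_def a_def)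
    then show "m * (1 + a\<^sup>2) \<le> 1 + a\<^sup>2 - 4 * a" using pos by simp
  qed
  have "m \<le> (2 - a)\<^sup>2" using m(1) by (rule order_trans) simp
  then have "0 \<le> ((2 - a)\<^sup>2 - m) * (B - A)" using A by (intro mult_nonneg_nonneg) auto
  moreover have "0 \<le> A * (1 + a\<^sup>2 - 4 * a - m * (1 + a\<^sup>2))" using A m by (intro mult_nonneg_nonneg) auto
  moreover have "((2 - a)\<^sup>2 - m) * (B - A) + A * (1 + a\<^sup>2 - 4 * a - m * (1 + a\<^sup>2))
      = 4 * B - 3 * A + (a\<^sup>2 - 4 * a) * B - m * B - m * (a\<^sup>2 * A)"
    by (simp add: power2_eq_square algebra_simps)
  moreover have "(- m) * (a\<^sup>2 * A + a * D) \<le> (- m) * H" using m H by (intro mult_left_mono) auto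
  moreover have "(- m) * (a\<^sup>2 * A + a * D) = - m * (a\<^sup>2 * A) - m * a * D" by (simp add: algebra_simps)
  ultimately have "m * B + m * H - m * a * D \<le> 4 * B - 3 * A + (a\<^sup>2 - 4 * a) * B" by argo
  moreover have "boundary' t = (- 1 - 2 * \<gamma>) * (2 * integral {-pi..pi} (\<lambda>\<theta>. f t \<theta> * f_t t \<theta>))
      - \<gamma> * (2 * integral {-pi..pi} (\<lambda>\<theta>. h t \<theta> * h_t t \<theta>)) - m * a * D"
    by (simp add: boundary'_def D_def m_def a_def)
  moreover have "(\<gamma>\<^sup>2 + 1 + m) * mass t = (\<gamma>\<^sup>2 + 1) * mass t + m * B + m * H"
    by (simp add: mass_split B_def H_def algebra_simps)
  ultimately show ?thesis
    using slice_energy_lower[of t] gap unfolding m_def[symmetric] a_def[symmetric] B_def[symmetric] by argo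
qed

lemma boundary_bound: "\<bar>boundary t\<bar> \<le> (\<bar>- 1 - 2 * \<gamma>\<bar> + \<bar>\<gamma>\<bar> + \<bar>excess \<gamma> * (1 - \<gamma>)\<bar>) * mass t"
proof -
  define B where "B = integral {-pi..pi} (\<lambda>\<theta>. (f t \<theta>)\<^sup>2)"
  define H where "H = integral {-pi..pi} (\<lambda>\<theta>. (h t \<theta>)\<^sup>2)"
  define A where "A = 1 / pi * ((cos_coeff t)\<^sup>2 + (sin_coeff t)\<^sup>2)"
  have A: "0 \<le> A" "A \<le> B"
    using trig_bessel[OF slice_cont(1)[of _ t]] by (auto simp: A_def B_def cos_coeff_def sin_coeff_def)
  have H: "0 \<le> H" unfolding H_def by (rule has_integral_nonneg[OF slice_int(2)]) simp
  have M: "mass t = B + H" by (simp add: mass_split B_def H_def)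
  have "\<bar>boundary t\<bar> = \<bar>(- 1 - 2 * \<gamma>) * B - \<gamma> * H - (excess \<gamma> * (1 - \<gamma>)) * A\<bar>"
    by (simp add: boundary_def A_def B_def H_def)
  also have "\<dots> \<le> \<bar>(- 1 - 2 * \<gamma>) * B\<bar> + \<bar>\<gamma> * H\<bar> + \<bar>(excess \<gamma> * (1 - \<gamma>)) * A\<bar>" by linarith
  also have "\<dots> = \<bar>- 1 - 2 * \<gamma>\<bar> * B + \<bar>\<gamma>\<bar> * H + \<bar>excess \<gamma> * (1 - \<gamma>)\<bar> * A"
    using A H by (simp add: abs_mult)
  also have "\<dots> \<le> \<bar>- 1 - 2 * \<gamma>\<bar> * mass t + \<bar>\<gamma>\<bar> * mass t + \<bar>excess \<gamma> * (1 - \<gamma>)\<bar> * mass t"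
    using A H M by (intro add_mono mult_left_mono) auto
  finally show ?thesis by (simp add: algebra_simps)
qed

end

section \<open>Integration over all circles\<close>

lemma nn_integral_Icc:
  fixes g :: "real \<Rightarrow> real"
  assumes "continuous_on UNIV g" "\<And>t. 0 \<le> g t"
  shows "(\<integral>\<^sup>+t. ennreal (g t) * indicator {a..b} t \<partial>lborel) = ennreal (integral {a..b} g)"
proof (rule nn_integral_has_integral_lebesgue')
  show "(g has_integral integral {a..b} g) {a..b}"
    by (rule integrable_integral, rule integrable_continuous_real, rule continuous_on_subset[OF assms(1)]) simp
qed (rule assms)

context solenoidal_polar_field
begin

text \<open>The boundary term at the outer end vanishes with the field; the one at \<open>s\<close> has no definite sign and is
estimated by the mass of that circle.\<close>

lemma truncated_hardy:
  assumes "s \<le> T" and T: "\<And>\<theta>. f T \<theta> = 0" "\<And>\<theta>. h T \<theta> = 0"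
  shows "(\<gamma>\<^sup>2 + 1 + excess \<gamma>) * integral {s..T} mass
    \<le> integral {s..T} energy + (\<bar>- 1 - 2 * \<gamma>\<bar> + \<bar>\<gamma>\<bar> + \<bar>excess \<gamma> * (1 - \<gamma>)\<bar>) * mass s"
proof -
  have I: "(mass has_integral integral {s..T} mass) {s..T}" "(energy has_integral integral {s..T} energy) {s..T}"
    by (rule integrable_integral, rule integrable_continuous_real, rule mass_continuous energy_continuous)+
  have "(boundary' has_integral (boundary T - boundary s)) {s..T}"
    by (rule has_integral_real_derivative[OF \<open>s \<le> T\<close> DERIV_boundary])
  from has_integral_le[OF has_integral_add[OF has_integral_mult_right[OF I(1)] this] I(2) slice_inequality]
  have "(\<gamma>\<^sup>2 + 1 + excess \<gamma>) * integral {s..T} mass + (boundary T - boundary s) \<le> integral {s..T} energy" .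
  moreover have "mass T = 0" by (simp add: mass_def T)
  then have "boundary T = 0" using boundary_bound[of T] by simp
  ultimately show ?thesis using boundary_bound[of s] by argo
qed

lemma hardy_if_decay:
  assumes decay: "(mass \<longlongrightarrow> 0) at_bot"
  shows "ennreal (\<gamma>\<^sup>2 + 1 + excess \<gamma>) * (\<integral>\<^sup>+t. ennreal (mass t) \<partial>lborel) \<le> (\<integral>\<^sup>+t. ennreal (energy t) \<partial>lborel)"
proof -
  define K where "K = \<bar>- 1 - 2 * \<gamma>\<bar> + \<bar>\<gamma>\<bar> + \<bar>excess \<gamma> * (1 - \<gamma>)\<bar>"
  have "K \<ge> 0" by (simp add: K_def)
  obtain T where T: "\<And>t \<theta>. t \<ge> T \<Longrightarrow> f t \<theta> = 0" "\<And>t \<theta>. t \<ge> T \<Longrightarrow> h t \<theta> = 0" using vanish by metis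
  define X where "X n = (\<integral>\<^sup>+t. ennreal (mass t) * indicator {T - real n..T} t \<partial>lborel)" for n
  have X: "X n = ennreal (integral {T - real n..T} mass)" for n
    unfolding X_def by (rule nn_integral_Icc[OF mass_continuous mass_nonneg])
  have "incseq X"
    unfolding X_def by (intro incseq_SucI nn_integral_mono) (auto simp: indicator_def)
  have total: "(\<integral>\<^sup>+t. ennreal (mass t) \<partial>lborel) = (SUP n. X n)"
  proof -
    have "(SUP n. ennreal (mass t) * indicator {T - real n..T} t) = ennreal (mass t)" for t
    proof (cases "t \<le> T")
      case False
      then have "mass t = 0" by (simp add: mass_def T)
      then show ?thesis by simp
    next
      case True
      obtain n where "T - t \<le> real n" using real_arch_simple by blast
      with True have n: "ennreal (mass t) * indicator {T - real n..T} t = ennreal (mass t)" by simp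
      show ?thesis
      proof (rule antisym)
        show "(SUP n. ennreal (mass t) * indicator {T - real n..T} t) \<le> ennreal (mass t)"
          by (intro SUP_least) (auto simp: indicator_def)
        show "ennreal (mass t) \<le> (SUP n. ennreal (mass t) * indicator {T - real n..T} t)"
          by (subst n[symmetric], rule SUP_upper) simp
      qed
    qed
    then have "(\<integral>\<^sup>+t. ennreal (mass t) \<partial>lborel)
        = (\<integral>\<^sup>+t. (SUP n. ennreal (mass t) * indicator {T - real n..T} t) \<partial>lborel)" by simp
    also have "\<dots> = (SUP n. X n)"
      unfolding X_def
      using borel_measurable_continuous_onI[OF mass_continuous]
      by (intro nn_integral_monotone_convergence_SUP)
        (auto simp: incseq_def le_fun_def indicator_def)
    finally show ?thesis .
  qed
  have step: "ennreal (\<gamma>\<^sup>2 + 1 + excess \<gamma>) * X m \<le> (\<integral>\<^sup>+t. ennreal (energy t) \<partial>lborel) + ennreal (K * mass (T - real m))" for m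
  proof -
    have "ennreal (\<gamma>\<^sup>2 + 1 + excess \<gamma>) * X m = ennreal ((\<gamma>\<^sup>2 + 1 + excess \<gamma>) * integral {T - real m..T} mass)"
      unfolding X by (rule ennreal_mult''[symmetric])
        (intro integral_nonneg integrable_continuous_real mass_continuous mass_nonneg)
    also have "\<dots> \<le> ennreal (integral {T - real m..T} energy + K * mass (T - real m))"
      unfolding K_def by (intro ennreal_leI truncated_hardy T) auto
    also have "\<dots> = ennreal (integral {T - real m..T} energy) + ennreal (K * mass (T - real m))"
      by (intro ennreal_plus mult_nonneg_nonneg \<open>K \<ge> 0\<close> mass_nonneg 
         integral_nonneg integrable_continuous_real energy_continuous energy_nonneg)
    also have "ennreal (integral {T - real m..T} energy) \<le> (\<integral>\<^sup>+t. ennreal (energy t) \<partial>lborel)"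
      unfolding nn_integral_Icc[OF energy_continuous energy_nonneg, symmetric]
      by (intro nn_integral_mono) (auto simp: indicator_def)
    finally show ?thesis by (simp add: add_right_mono)
  qed
  have "ennreal (\<gamma>\<^sup>2 + 1 + excess \<gamma>) * X n \<le> (\<integral>\<^sup>+t. ennreal (energy t) \<partial>lborel)" for n
  proof (rule LIMSEQ_le_const)
    have "filterlim (\<lambda>m. T - real m) at_bot sequentially"
      unfolding filterlim_at_bot
    proof
      fix Z
      show "\<forall>\<^sub>F m in sequentially. T - real m \<le> Z"
        by (rule eventually_sequentiallyI[of "nat \<lceil>T - Z\<rceil>"]) linarith
    qed
    then have "(\<lambda>m. mass (T - real m)) \<longlonglongrightarrow> 0"
      by (rule filterlim_compose[OF decay])
    then have "(\<lambda>m. ennreal (K * mass (T - real m))) \<longlonglongrightarrow> ennreal (K * 0)"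
      by (intro tendsto_ennrealI tendsto_mult_left)
    then show "(\<lambda>m. (\<integral>\<^sup>+t. ennreal (energy t) \<partial>lborel) + ennreal (K * mass (T - real m)))
       \<longlonglongrightarrow> (\<integral>\<^sup>+t. ennreal (energy t) \<partial>lborel)"
      using tendsto_add[OF tendsto_const[of "\<integral>\<^sup>+t. ennreal (energy t) \<partial>lborel"]] by fastforce
    have "ennreal (\<gamma>\<^sup>2 + 1 + excess \<gamma>) * X n \<le> ennreal (\<gamma>\<^sup>2 + 1 + excess \<gamma>) * X m" if "n \<le> m" for m
      using \<open>incseq X\<close> that by (intro mult_left_mono) (auto simp: incseq_def)
    then show "\<exists>N. \<forall>m\<ge>N. ennreal (\<gamma>\<^sup>2 + 1 + excess \<gamma>) * X n \<le> (\<integral>\<^sup>+t. ennreal (energy t) \<partial>lborel) + ennreal (K * mass (T - real m))"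
      using step order_trans by blast
  qed
  then show ?thesis
    unfolding total SUP_mult_left_ennreal by (intro SUP_least)
qed

lemma DERIV_mass:
  "(mass has_real_derivative 2 * integral {-pi..pi} (\<lambda>\<theta>. f t \<theta> * f_t t \<theta>)
     + 2 * integral {-pi..pi} (\<lambda>\<theta>. h t \<theta> * h_t t \<theta>)) (at t)"
  unfolding mass_split[abs_def] by (intro DERIV_add DERIV_square_mass)

text \<open>The weight \<open>\<delta>\<close> in the arithmetic-geometric mean inequality is left free: it decides how much of the
exponential rate \<open>2 \<gamma>\<close> is given up.\<close>

lemma mass_derivative_bound:
  assumes "\<delta> > 0"
  shows "2 * integral {-pi..pi} (\<lambda>\<theta>. f t \<theta> * f_t t \<theta>) + 2 * integral {-pi..pi} (\<lambda>\<theta>. h t \<theta> * h_t t \<theta>)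
    \<le> (2 * \<gamma> + \<delta>) * mass t + energy t / \<delta>"
proof -
  let ?m = "2 * integral {-pi..pi} (\<lambda>\<theta>. f t \<theta> * f_t t \<theta>) + 2 * integral {-pi..pi} (\<lambda>\<theta>. h t \<theta> * h_t t \<theta>)"
  have 1: "((\<lambda>\<theta>. 2 * (f t \<theta> * f_t t \<theta>) + 2 * (h t \<theta> * h_t t \<theta>)) has_integral ?m) {-pi..pi}"
    by (intro has_integral_add has_integral_mult_right slice_int)
  have 2: "((\<lambda>\<theta>. (2 * \<gamma> + \<delta>) * ((f t \<theta>)\<^sup>2 + (h t \<theta>)\<^sup>2) + 1 / \<delta> * energy_density t \<theta>) has_integral
     ((2 * \<gamma> + \<delta>) * mass t + 1 / \<delta> * energy t)) {-pi..pi}"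
    unfolding mass_split by (intro has_integral_add has_integral_mult_right slice_int)
  have amgm: "2 * (x * y) \<le> (2 * \<gamma> + \<delta>) * x\<^sup>2 + 1 / \<delta> * (y - \<gamma> * x)\<^sup>2" for x y
  proof -
    have "(2 * \<gamma> + \<delta>) * x\<^sup>2 + 1 / \<delta> * (y - \<gamma> * x)\<^sup>2 - 2 * (x * y) = 1 / \<delta> * (\<delta> * x - (y - \<gamma> * x))\<^sup>2"
      using \<open>\<delta> > 0\<close> by (simp add: power2_eq_square field_simps)
    moreover have "0 \<le> 1 / \<delta> * (\<delta> * x - (y - \<gamma> * x))\<^sup>2" using \<open>\<delta> > 0\<close> by simp
    ultimately show ?thesis by linarith
  qed
  have "?m \<le> (2 * \<gamma> + \<delta>) * mass t + 1 / \<delta> * energy t"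
  proof (rule has_integral_le[OF 1 2])
    fix \<theta>
    have "1 / \<delta> * (f_t t \<theta> - \<gamma> * f t \<theta>)\<^sup>2 + 1 / \<delta> * (h_t t \<theta> - \<gamma> * h t \<theta>)\<^sup>2 \<le> 1 / \<delta> * energy_density t \<theta>"
      unfolding distrib_left[symmetric]
      using \<open>\<delta> > 0\<close> by (intro mult_left_mono) (simp_all add: energy_density_def)
    then show "2 * (f t \<theta> * f_t t \<theta>) + 2 * (h t \<theta> * h_t t \<theta>)
        \<le> (2 * \<gamma> + \<delta>) * ((f t \<theta>)\<^sup>2 + (h t \<theta>)\<^sup>2) + 1 / \<delta> * energy_density t \<theta>"
      unfolding distrib_left using amgm[of "f t \<theta>" "f_t t \<theta>"] amgm[of "h t \<theta>" "h_t t \<theta>"] by argo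
  qed
  then show ?thesis by simp
qed

text \<open>A Gronwall estimate, used for \<open>\<gamma> < 0\<close>: the mass of a circle is controlled by the energy between it
and a smaller circle, plus a multiple of the mass of the latter.\<close>

lemma mass_growth:
  assumes "\<delta> > 0" "2 * \<gamma> + \<delta> \<le> 0" "s \<le> t"
  shows "mass t \<le> exp ((2 * \<gamma> + \<delta>) * (t - s)) * mass s + integral {s..t} energy / \<delta>"
proof -
  define b where "b = - (2 * \<gamma> + \<delta>)"
  have "b \<ge> 0" using assms by (simp add: b_def)
  define m' where "m' x = 2 * integral {-pi..pi} (\<lambda>\<theta>. f x \<theta> * f_t x \<theta>)
     + 2 * integral {-pi..pi} (\<lambda>\<theta>. h x \<theta> * h_t x \<theta>)" for x
  have m': "\<And>x. (mass has_real_derivative m' x) (at x)" "\<And>x. m' x \<le> - b * mass x + energy x / \<delta>"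
    using DERIV_mass mass_derivative_bound[OF assms(1)] unfolding b_def minus_minus m'_def by auto
  have "((\<lambda>x. exp (b * x) * (m' x + b * mass x)) has_integral (exp (b * t) * mass t - exp (b * s) * mass s)) {s..t}"
  proof (rule has_integral_real_derivative[OF \<open>s \<le> t\<close>])
    show "((\<lambda>x. exp (b * x) * mass x) has_real_derivative exp (b * x) * (m' x + b * mass x)) (at x)" for x
      by (rule DERIV_cong, rule DERIV_mult, rule DERIV_chain2[OF DERIV_exp], rule DERIV_cmult, rule DERIV_ident, rule m')
        (simp add: algebra_simps)
  qed
  moreover have "((\<lambda>x. exp (b * t) / \<delta> * energy x) has_integral (exp (b * t) / \<delta> * integral {s..t} energy)) {s..t}"
    by (intro has_integral_mult_right integrable_integral integrable_continuous_real energy_continuous)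
  moreover have "exp (b * x) * (m' x + b * mass x) \<le> exp (b * t) / \<delta> * energy x" if "x \<in> {s..t}" for x
  proof -
    have "m' x + b * mass x \<le> energy x / \<delta>" using m'(2)[of x] by simp
    then have "exp (b * x) * (m' x + b * mass x) \<le> exp (b * x) * (energy x / \<delta>)"
      by (intro mult_left_mono) auto
    also have "\<dots> \<le> exp (b * t) * (energy x / \<delta>)"
      using that \<open>b \<ge> 0\<close> \<open>\<delta> > 0\<close> energy_nonneg by (intro mult_right_mono) (auto intro: mult_left_mono)
    finally show ?thesis by simp
  qed
  ultimately have "exp (b * t) * mass t - exp (b * s) * mass s \<le> exp (b * t) / \<delta> * integral {s..t} energy"
    by (rule has_integral_le)
  then have "exp (- b * t) * (exp (b * t) * mass t)
      \<le> exp (- b * t) * (exp (b * s) * mass s + exp (b * t) * (integral {s..t} energy / \<delta>))"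
    by (intro mult_left_mono) auto
  moreover have "exp (- b * t) * (exp (b * t) * X) = X" "exp (- b * t) * (exp (b * s) * X) = exp ((2 * \<gamma> + \<delta>) * (t - s)) * X" for X
    unfolding mult.assoc[symmetric] exp_add[symmetric] by (simp_all add: b_def algebra_simps)
  ultimately show ?thesis by (simp only: distrib_left)
qed

text \<open>The bound \<open>small\<close> holds for \<open>u\<close> vanishing at the origin and does not suffice for \<open>\<gamma> \<le> -1\<close>, where
its right hand side does not tend to zero. It does suffice to discard the inner mass in \<open>mass_growth\<close>, since
\<open>2 - \<delta> > 0\<close>; then \<open>mass t\<close> is at most a constant times the integral of the energy over
\<open>(-\<infinity>, t]\<close>, the tail of a convergent integral.\<close>

lemma decay_of_finite_energy:
  assumes "\<gamma> < 0" and fin: "(\<integral>\<^sup>+t. ennreal (energy t) \<partial>lborel) < \<infinity>"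
    and small: "\<And>t. t \<le> 0 \<Longrightarrow> mass t \<le> C * exp ((2 * \<gamma> + 2) * t)"
  shows "(mass \<longlongrightarrow> 0) at_bot"
proof -
  (* delta < 2 beats the inner mass, and 2 gamma + delta <= 0 is what mass_growth requires. *)
  define \<delta> where "\<delta> = min 1 (- \<gamma>)"
  have \<delta>: "\<delta> > 0" "\<delta> \<le> 1" "2 * \<gamma> + \<delta> \<le> 0" using \<open>\<gamma> < 0\<close> by (auto simp: \<delta>_def)
  obtain R where R: "(\<integral>\<^sup>+t. ennreal (energy t) \<partial>lborel) = ennreal R" "R \<ge> 0"
    using fin by (cases "\<integral>\<^sup>+t. ennreal (energy t) \<partial>lborel") auto
  define J where "J s = integral {s..0} energy" for s
  have Jbound: "J s \<le> R" for s
  proof -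
    have "ennreal (J s) \<le> ennreal R"
      unfolding J_def nn_integral_Icc[OF energy_continuous energy_nonneg, symmetric] R(1)[symmetric]
      by (intro nn_integral_mono) (auto simp: indicator_def)
    then show ?thesis using R(2) by simp
  qed
  have Jsplit: "J s = integral {s..t} energy + J t" if "s \<le> t" "t \<le> 0" for s t
    unfolding J_def using that
    by (intro Henstock_Kurzweil_Integration.integral_combine[symmetric] integrable_continuous_real energy_continuous)
  have bound: "mass t \<le> (S - J t) / \<delta>" if "t \<le> 0" and S: "\<And>s. J s \<le> S" for t S
  proof (rule tendsto_lowerbound)
    have "((\<lambda>s. exp ((2 * \<gamma> + \<delta>) * t) * \<bar>C\<bar> * exp ((2 - \<delta>) * s)) \<longlongrightarrow> exp ((2 * \<gamma> + \<delta>) * t) * \<bar>C\<bar> * 0) at_bot"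
    proof (intro tendsto_mult_left)
      have "filterlim (\<lambda>s. (2 - \<delta>) * s) at_bot at_bot"
        using \<delta>(2) by (intro filterlim_tendsto_pos_mult_at_bot[OF tendsto_const]) (auto simp: filterlim_ident)
      then show "((\<lambda>s. exp ((2 - \<delta>) * s)) \<longlongrightarrow> 0) at_bot"
        by (rule filterlim_compose[OF exp_at_bot])
    qed
    from tendsto_add[OF this tendsto_const[of "(S - J t) / \<delta>"]]
    show "((\<lambda>s. exp ((2 * \<gamma> + \<delta>) * t) * \<bar>C\<bar> * exp ((2 - \<delta>) * s) + (S - J t) / \<delta>) \<longlongrightarrow> (S - J t) / \<delta>) at_bot"
      by simp
    show "\<forall>\<^sub>F s in at_bot. mass t \<le> exp ((2 * \<gamma> + \<delta>) * t) * \<bar>C\<bar> * exp ((2 - \<delta>) * s) + (S - J t) / \<delta>"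
      using eventually_le_at_bot[of t]
    proof eventually_elim
      case (elim s)
      have "mass t \<le> exp ((2 * \<gamma> + \<delta>) * (t - s)) * mass s + integral {s..t} energy / \<delta>"
        by (rule mass_growth[OF \<delta>(1,3) elim])
      also have "integral {s..t} energy / \<delta> \<le> (S - J t) / \<delta>"
        using Jsplit[OF elim \<open>t \<le> 0\<close>] S[of s] \<delta>(1) by (intro divide_right_mono) auto
      also have "exp ((2 * \<gamma> + \<delta>) * (t - s)) * mass s \<le> exp ((2 * \<gamma> + \<delta>) * (t - s)) * (\<bar>C\<bar> * exp ((2 * \<gamma> + 2) * s))"
      proof (intro mult_left_mono)
        have "mass s \<le> C * exp ((2 * \<gamma> + 2) * s)" using small[of s] elim \<open>t \<le> 0\<close> by simp
        also have "\<dots> \<le> \<bar>C\<bar> * exp ((2 * \<gamma> + 2) * s)" by (intro mult_right_mono) auto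
        finally show "mass s \<le> \<bar>C\<bar> * exp ((2 * \<gamma> + 2) * s)" .
      qed simp
      also have "\<dots> = \<bar>C\<bar> * (exp ((2 * \<gamma> + \<delta>) * (t - s)) * exp ((2 * \<gamma> + 2) * s))" by simp
      also have "\<dots> = \<bar>C\<bar> * (exp ((2 * \<gamma> + \<delta>) * t) * exp ((2 - \<delta>) * s))"
        unfolding exp_add[symmetric] by (simp add: algebra_simps)
      finally show ?case by (simp add: mult.assoc mult.left_commute)
    qed
  qed simp
  show ?thesis
  proof (rule tendstoI)
    fix e :: real assume "e > 0"
    define S where "S = (SUP s. J s)"
    have bdd: "bdd_above (range J)" using Jbound by (intro bdd_aboveI[of _ R]) auto
    have S: "J s \<le> S" for s unfolding S_def by (rule cSUP_upper[OF _ bdd]) simp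
    have "S - \<delta> * e < S" using \<open>e > 0\<close> \<delta>(1) by simp
    then obtain s0 where s0: "S - \<delta> * e < J s0" unfolding S_def using less_cSUP_iff[OF _ bdd] by auto
    show "\<forall>\<^sub>F t in at_bot. dist (mass t) 0 < e"
      using eventually_le_at_bot[of "min s0 0"]
    proof eventually_elim
      case (elim t)
      have "J s0 \<le> J t"
      proof (cases "s0 \<le> 0")
        case True
        have "0 \<le> integral {t..s0} energy"
          by (intro integral_nonneg integrable_continuous_real energy_continuous energy_nonneg)
        then show ?thesis using Jsplit[of t s0] True elim by simp
      next
        case False
        have "0 \<le> J t" unfolding J_def
          by (intro integral_nonneg integrable_continuous_real energy_continuous energy_nonneg)
        with False show ?thesis by (simp add: J_def)
      qed
      with s0 have "(S - J t) < \<delta> * e" by simp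
      then have "(S - J t) / \<delta> < e" using \<delta>(1) by (simp add: field_simps)
      moreover have "mass t \<le> (S - J t) / \<delta>" using elim S by (intro bound) auto
      ultimately show ?case using mass_nonneg[of t] by (simp add: dist_real_def)
    qed
  qed
qed

end

section \<open>Integration in log-polar coordinates\<close>

lemma nn_integral_eq_iff_has_integral:
  fixes F :: "'a::euclidean_space \<Rightarrow> real"
  assumes F: "F \<in> borel_measurable borel" and nonneg: "\<And>x. 0 \<le> F x" and A: "A \<in> sets borel" and "0 \<le> b"
  shows "(\<integral>\<^sup>+x. ennreal (F x) * indicator A x \<partial>lborel) = ennreal b \<longleftrightarrow> (F has_integral b) A"
proof
  assume "(F has_integral b) A"
  then show "(\<integral>\<^sup>+x. ennreal (F x) * indicator A x \<partial>lborel) = ennreal b"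
    using nonneg by (intro nn_integral_has_integral_lebesgue') auto
next
  define H where "H x = F x * indicator A x" for x
  assume eq: "(\<integral>\<^sup>+x. ennreal (F x) * indicator A x \<partial>lborel) = ennreal b"
  have "(H has_integral b) UNIV"
  proof (rule nn_integral_has_integral)
    show "H \<in> borel_measurable borel" unfolding H_def using F A by measurable
    show "0 \<le> H x" for x using nonneg by (simp add: H_def)
    have "ennreal (H x) = ennreal (F x) * indicator A x" for x
      by (simp add: H_def indicator_def)
    with eq show "(\<integral>\<^sup>+x. ennreal (H x) \<partial>lborel) = ennreal b" by simp
  qed fact
  moreover have "H = (\<lambda>x. if x \<in> A then F x else 0)" by (auto simp: H_def indicator_def)
  ultimately show "(F has_integral b) A" by (simp only: has_integral_restrict_UNIV)
qed

text \<open>The change of variables formula for integrable functions extends to nonnegative functions with possibly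
infinite integrals, because it asserts that integrability on one side is equivalent to integrability on the
other.\<close>

lemma nn_integral_change_of_variables:
  fixes g :: "real^'n::{finite,wellorder} \<Rightarrow> real^'n::_" and F :: "real^'n::_ \<Rightarrow> real"
  assumes F: "F \<in> borel_measurable borel" "\<And>x. 0 \<le> F x"
    and J: "(\<lambda>x. \<bar>det (matrix (g' x))\<bar> * F (g x)) \<in> borel_measurable borel"
    and S: "S \<in> sets borel" "g ` S \<in> sets borel"
    and der: "\<And>x. x \<in> S \<Longrightarrow> (g has_derivative g' x) (at x within S)" and inj: "inj_on g S"
  shows "(\<integral>\<^sup>+x. ennreal (F x) * indicator (g ` S) x \<partial>lborel)
    = (\<integral>\<^sup>+x. ennreal (\<bar>det (matrix (g' x))\<bar> * F (g x)) * indicator S x \<partial>lborel)" (is "?L = ?R")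
proof -
  have "(\<lambda>x. \<bar>det (matrix (g' x))\<bar> *\<^sub>R (vec (F (g x)) :: real^1)) absolutely_integrable_on S \<and>
           integral S (\<lambda>x. \<bar>det (matrix (g' x))\<bar> *\<^sub>R (vec (F (g x)) :: real^1)) = vec b
     \<longleftrightarrow> (\<lambda>x. (vec (F x) :: real^1)) absolutely_integrable_on (g ` S) \<and> integral (g ` S) (\<lambda>x. (vec (F x) :: real^1)) = vec b" for b
    using S(1) der inj by (intro has_absolute_integral_change_of_variables) auto
  then have iff: "((\<lambda>x. \<bar>det (matrix (g' x))\<bar> * F (g x)) has_integral b) S \<longleftrightarrow> (F has_integral b) (g ` S)" for b
    using F(2)
    unfolding absolutely_integrable_on_1_iff integral_on_1_eq has_integral_iff
    by (simp add: absolutely_integrable_on_iff_nonneg)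
  have b: "?L = ennreal b \<longleftrightarrow> ?R = ennreal b" if "0 \<le> b" for b
    using iff[of b] nn_integral_eq_iff_has_integral[OF F S(2) that]
      nn_integral_eq_iff_has_integral[OF J _ S(1) that] F(2) by simp
  show ?thesis
  proof (cases "?L")
    case (real r)
    then show ?thesis using b[of r] by simp
  next
    case top
    then show ?thesis using b by (cases "?R") auto
  qed
qed

definition polar :: "real \<Rightarrow> real \<Rightarrow> real^2" where
  "polar t \<theta> = vector [exp t * cos \<theta>, exp t * sin \<theta>]"

lemma polar_nth [simp]: "polar t \<theta> $ 1 = exp t * cos \<theta>" "polar t \<theta> $ 2 = exp t * sin \<theta>"
  by (simp_all add: polar_def)

lemma vec2_eq_iff: "(x::real^2) = y \<longleftrightarrow> x $ 1 = y $ 1 \<and> x $ 2 = y $ 2"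
  by (simp add: vec_eq_iff forall_2)

lemma norm_vec2: "(norm (x::real^2))\<^sup>2 = (x $ 1)\<^sup>2 + (x $ 2)\<^sup>2"
  by (simp add: norm_vec_def L2_set_def sum_2 sum_nonneg)

lemma norm_polar [simp]: "norm (polar t \<theta>) = exp t"
proof -
  have "(norm (polar t \<theta>))\<^sup>2 = (exp t)\<^sup>2 * ((cos \<theta>)\<^sup>2 + (sin \<theta>)\<^sup>2)"
    by (simp only: norm_vec2 polar_nth power_mult_distrib distrib_left)
  then show ?thesis by simp
qed

lemma polar_inj:
  assumes "polar t \<theta> = polar t' \<theta>'" "\<theta> \<in> {-pi<..<pi}" "\<theta>' \<in> {-pi<..<pi}"
  shows "t = t' \<and> \<theta> = \<theta>'"
proof -
  have "exp t = exp t'" using assms(1) norm_polar by metis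
  then have t: "t = t'" by simp
  then have "sin \<theta> = sin \<theta>' \<and> cos \<theta> = cos \<theta>'"
    using assms(1) by (simp add: vec2_eq_iff)
  then obtain n :: int where n: "\<theta> = \<theta>' + 2 * pi * n" unfolding sin_cos_eq_iff by blast
  with assms have "\<bar>2 * pi * n\<bar> < 2 * pi" by auto
  then have "\<bar>real_of_int n\<bar> < 1" by (simp add: abs_mult)
  then have "n = 0" by linarith
  with n t show ?thesis by simp
qed

lemma polar_exists:
  fixes x :: "real^2"
  assumes "x $ 2 \<noteq> 0"
  obtains t \<theta> where "\<theta> \<in> {-pi<..<pi}" "x = polar t \<theta>"
proof
  define z where "z = Complex (x $ 1) (x $ 2)"
  have z: "z \<noteq> 0" "Im z \<noteq> 0" using assms by (auto simp: z_def complex_eq_iff)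
  have "Arg z \<noteq> pi" using z Arg_eq_pi by auto
  then show "Arg z \<in> {-pi<..<pi}" using Arg_bounded[of z] by auto
  have "rcis (cmod z) (Arg z) = z" by (rule rcis_cmod_Arg)
  then have "Re z = exp (ln (cmod z)) * cos (Arg z)" "Im z = exp (ln (cmod z)) * sin (Arg z)"
    using z(1) by (metis Re_rcis exp_ln zero_less_norm_iff, metis Im_rcis exp_ln z(1) zero_less_norm_iff)
  then show "x = polar (ln (cmod z)) (Arg z)" by (simp add: vec2_eq_iff z_def)
qed

lemma continuous_on_vector2:
  assumes "continuous_on S f" "continuous_on S g"
  shows "continuous_on S (\<lambda>x. vector [f x, g x] :: real^2)"
proof -
  have "vector [f x, g x] = f x *\<^sub>R (axis 1 1 :: real^2) + g x *\<^sub>R axis 2 1" for x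
    by (simp add: vec2_eq_iff axis_def)
  then show ?thesis by (simp add: assms continuous_intros)
qed

text \<open>Identifies plane Lebesgue measure on vectors with the product measure, to which Tonelli's theorem applies.\<close>

lemma lborel_vec2: "(lborel :: (real^2) measure) = distr (lborel \<Otimes>\<^sub>M lborel) borel (\<lambda>(x, y). vector [x, y])"
proof (rule lborel_eqI)
  have "continuous_on UNIV (\<lambda>p::real \<times> real. (vector [fst p, snd p] :: real^2))"
    by (intro continuous_on_vector2 continuous_intros)
  then have meas: "(\<lambda>(x, y). vector [x, y] :: real^2) \<in> borel_measurable (lborel \<Otimes>\<^sub>M lborel)"
    unfolding lborel_prod by (simp add: split_beta' borel_measurable_continuous_onI)
  fix l u :: "real^2"
  assume le: "\<And>b. b \<in> Basis \<Longrightarrow> l \<bullet> b \<le> u \<bullet> b"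
  have le': "l $ i \<le> u $ i" for i
    using le[of "axis i 1"] by (simp add: axis_in_Basis_iff inner_axis)
  have "(\<lambda>(x, y). vector [x, y] :: real^2) -` box l u = {l $ 1<..<u $ 1} \<times> {l $ 2<..<u $ 2}"
    by (auto simp: mem_box_cart forall_2)
  then have "emeasure (distr (lborel \<Otimes>\<^sub>M lborel) borel (\<lambda>(x, y). vector [x, y])) (box l u)
    = emeasure (lborel \<Otimes>\<^sub>M lborel) ({l $ 1<..<u $ 1} \<times> {l $ 2<..<u $ 2})"
    using meas by (subst emeasure_distr) (auto simp: space_pair_measure)
  also have "\<dots> = emeasure lborel {l $ 1<..<u $ 1} * emeasure lborel {l $ 2<..<u $ 2}"
    by (intro lborel.emeasure_pair_measure_Times) auto
  also have "\<dots> = ennreal ((u $ 1 - l $ 1) * (u $ 2 - l $ 2))"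
    using le' by (simp add: ennreal_mult)
  also have "(u $ 1 - l $ 1) * (u $ 2 - l $ 2) = (\<Prod>b\<in>Basis. (u - l) \<bullet> b)"
  proof -
    have basis: "(Basis :: (real^2) set) = {axis 1 1, axis 2 1}"
      by (auto simp: Basis_vec_def UNIV_2)
    have "axis 1 1 \<noteq> (axis 2 1 :: real^2)" by (simp add: axis_eq_axis)
    then have "(\<Prod>b\<in>Basis. (u - l) \<bullet> b) = ((u - l) \<bullet> axis 1 1) * ((u - l) \<bullet> axis 2 1)"
      unfolding basis by simp
    then show ?thesis by (simp add: inner_axis)
  qed
  finally show "emeasure (distr (lborel \<Otimes>\<^sub>M lborel) borel (\<lambda>(x, y). vector [x, y])) (box l u)
    = (\<Prod>b\<in>Basis. (u - l) \<bullet> b)" .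
qed simp

lemma polar_continuous [continuous_intros]:
  fixes f g :: "'a::t2_space \<Rightarrow> real"
  assumes "continuous_on S f" "continuous_on S g"
  shows "continuous_on S (\<lambda>x. polar (f x) (g x))"
  unfolding polar_def by (intro continuous_on_vector2 continuous_intros assms)

lemma nn_integral_polar:
  fixes F :: "real^2 \<Rightarrow> real"
  assumes F [measurable]: "F \<in> borel_measurable borel" and nonneg: "\<And>x. 0 \<le> F x"
  shows "(\<integral>\<^sup>+x. ennreal (F x) \<partial>lborel)
    = (\<integral>\<^sup>+t. (\<integral>\<^sup>+\<theta>. ennreal (exp (2 * t) * F (polar t \<theta>)) * indicator {-pi<..<pi} \<theta> \<partial>lborel) \<partial>lborel)"
proof -
  define g where "g s = polar (s $ 1) (s $ 2)" for s :: "real^2"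
  define g' where "g' s v = (vector [exp (s $ 1) * (cos (s $ 2) * v $ 1 - sin (s $ 2) * v $ 2),
      exp (s $ 1) * (sin (s $ 2) * v $ 1 + cos (s $ 2) * v $ 2)] :: real^2)" for s v :: "real^2"
  define S where "S = {s :: real^2. s $ 2 \<in> {-pi<..<pi}}"
  have contg: "continuous_on UNIV g" unfolding g_def by (intro continuous_intros)
  have [measurable]: "g \<in> borel_measurable borel" by (rule borel_measurable_continuous_onI[OF contg])
  have "open S"
    unfolding S_def greaterThanLessThan_iff by (intro open_Collect_conj open_Collect_less continuous_intros)
  have inj: "inj_on g S"
  proof (rule inj_onI)
    fix x y assume "x \<in> S" "y \<in> S" "g x = g y"
    then have "x $ 1 = y $ 1 \<and> x $ 2 = y $ 2"
      using polar_inj[of "x $ 1" "x $ 2" "y $ 1" "y $ 2"] by (simp add: g_def S_def)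
    then show "x = y" by (simp only: vec2_eq_iff)
  qed
  have "open (g ` S)"
    using contg by (intro invariance_of_domain[OF _ \<open>open S\<close> inj]) (auto intro: continuous_on_subset)
  have det: "\<bar>det (matrix (g' s))\<bar> = exp (2 * s $ 1)" for s
  proof -
    have "det (matrix (g' s)) = (exp (s $ 1))\<^sup>2 * (cos (s $ 2))\<^sup>2 + (exp (s $ 1))\<^sup>2 * (sin (s $ 2))\<^sup>2"
      unfolding det_2 by (simp add: matrix_def g'_def axis_def power2_eq_square algebra_simps)
    also have "\<dots> = (exp (s $ 1))\<^sup>2"
      unfolding distrib_left[symmetric] by simp
    finally show ?thesis by (simp add: exp_double)
  qed
  have der: "(g has_derivative g' s) (at s within S)" for s
  proof -
    have "((\<lambda>s. g s $ i) has_derivative (\<lambda>v. g' s v $ i)) (at s within S)" for i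
    proof (cases "i = 1")
      case True
      show ?thesis unfolding True g_def g'_def polar_nth vector_2
        by (auto intro!: derivative_eq_intros bounded_linear_imp_has_derivative[OF bounded_linear_vec_nth]
            simp: algebra_simps)
    next
      case False
      then have i: "i = 2" using exhaust_2[of i] by simp
      show ?thesis unfolding i g_def g'_def polar_nth vector_2
        by (auto intro!: derivative_eq_intros bounded_linear_imp_has_derivative[OF bounded_linear_vec_nth]
            simp: algebra_simps)
    qed
    then show ?thesis unfolding has_derivative_componentwise_within[of g]
      by (auto simp: Basis_vec_def inner_axis)
  qed
  (* The coordinates miss only the nonpositive horizontal half axis. *)
  have null: "AE x in lborel. x \<in> g ` S"
  proof -
    have "negligible {x :: real^2. x $ 2 = 0}" by (rule negligible_standard_hyperplane_cart)
    then have "AE x::real^2 in lebesgue. x $ 2 \<noteq> 0"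
      by (simp add: negligible_iff_null_sets AE_iff_null_sets null_sets_completion_iff) 
    then have "AE x::real^2 in lborel. x $ 2 \<noteq> 0" by (simp add: AE_completion_iff)
    then show ?thesis
    proof eventually_elim
      case (elim x)
      then obtain t \<theta> where "\<theta> \<in> {-pi<..<pi}" "x = polar t \<theta>" using polar_exists by blast
      then have "x = g (vector [t, \<theta>])" "vector [t, \<theta>] \<in> S" by (simp_all add: g_def S_def)
      then show ?case by blast
    qed
  qed
  have "(\<integral>\<^sup>+x. ennreal (F x) \<partial>lborel) = (\<integral>\<^sup>+x. ennreal (F x) * indicator (g ` S) x \<partial>lborel)"
    by (rule nn_integral_cong_AE) (use null in eventually_elim, simp)
  also have "\<dots> = (\<integral>\<^sup>+s. ennreal (\<bar>det (matrix (g' s))\<bar> * F (g s)) * indicator S s \<partial>lborel)"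
    using \<open>open S\<close> \<open>open (g ` S)\<close>
    by (intro nn_integral_change_of_variables F nonneg der inj) (simp_all add: det)
  also have "\<dots> = (\<integral>\<^sup>+p. (case p of (t, \<theta>) \<Rightarrow> ennreal (exp (2 * t) * F (polar t \<theta>)) * indicator {-pi<..<pi} \<theta>) \<partial>(lborel \<Otimes>\<^sub>M lborel))"
  proof -
    have meas: "(\<lambda>s. ennreal (exp (2 * s $ 1) * F (g s)) * indicator S s) \<in> borel_measurable borel"
    proof -
      have [measurable]: "S \<in> sets borel" using \<open>open S\<close> by simp
      show ?thesis by measurable
    qed
    have "continuous_on UNIV (\<lambda>p::real \<times> real. vector [fst p, snd p] :: real^2)"
      by (intro continuous_on_vector2 continuous_intros)
    then have "(\<lambda>(x, y). vector [x, y] :: real^2) \<in> borel_measurable (lborel \<Otimes>\<^sub>M lborel)"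
      unfolding lborel_prod by (simp add: split_beta' borel_measurable_continuous_onI)
    from nn_integral_distr[OF this, of "\<lambda>s. ennreal (exp (2 * s $ 1) * F (g s)) * indicator S s"]
    show ?thesis
      using meas unfolding lborel_vec2[symmetric] det
      by (simp add: split_beta' g_def S_def indicator_def cong: if_cong)
  qed
  also have "\<dots> = (\<integral>\<^sup>+t. (\<integral>\<^sup>+\<theta>. ennreal (exp (2 * t) * F (polar t \<theta>)) * indicator {-pi<..<pi} \<theta> \<partial>lborel) \<partial>lborel)"
  proof -
    have "continuous_on UNIV (\<lambda>p. polar (fst p) (snd p))" by (intro continuous_intros)
    then have [measurable]: "(\<lambda>p. polar (fst p) (snd p)) \<in> borel_measurable (lborel \<Otimes>\<^sub>M lborel)"
      unfolding lborel_prod by (simp add: borel_measurable_continuous_onI)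
    have "(\<lambda>p. ennreal (exp (2 * fst p) * F (polar (fst p) (snd p))) * indicator {-pi<..<pi} (snd p))
       \<in> borel_measurable (lborel \<Otimes>\<^sub>M lborel)"
      by measurable
    then show ?thesis
      by (subst lborel.nn_integral_fst[symmetric]) (simp_all add: split_beta')
  qed
  finally show ?thesis .
qed

section \<open>The inequality for admissible fields\<close>

lemma partial_eq_frechet_derivative:
  assumes "u differentiable (at x)"
  shows "partial i j u x = frechet_derivative u (at x) (axis i 1) $ j"
proof -
  have "(u has_derivative frechet_derivative u (at x)) (at x)"
    using assms by (simp only: frechet_derivative_works)
  then have "((\<lambda>y. u y $ j) has_derivative (\<lambda>v. frechet_derivative u (at x) v $ j)) (at x)"
    by (rule bounded_linear.has_derivative[OF bounded_linear_vec_nth])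
  from frechet_derivative_at[OF this] show ?thesis
    unfolding partial_def by metis
qed

lemma continuous_partial:
  assumes "Ck (Suc 0) u"
  shows "continuous_on S (partial i j u)"
proof -
  have "partial i j u = (\<lambda>x. frechet_derivative u (at x) (axis i 1) $ j)"
    using assms by (auto simp: partial_eq_frechet_derivative)
  moreover have "continuous_on S (\<lambda>x. frechet_derivative u (at x) (axis i 1))"
    using assms by (auto intro: continuous_on_subset)
  ultimately show ?thesis by (auto intro: continuous_intros)
qed

lemma DERIV_along_curve:
  fixes c :: "real \<Rightarrow> real^2"
  assumes u: "u differentiable (at (c t))"
    and c: "((\<lambda>s. c s $ 1) has_real_derivative c1) (at t)" "((\<lambda>s. c s $ 2) has_real_derivative c2) (at t)"
  shows "((\<lambda>s. u (c s) $ j) has_real_derivative (c1 * partial 1 j u (c t) + c2 * partial 2 j u (c t))) (at t)"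
proof -
  have cvec: "c s = c s $ 1 *\<^sub>R axis 1 1 + c s $ 2 *\<^sub>R axis 2 1" for s
    by (simp add: vec2_eq_iff axis_def)
  have "((\<lambda>s. c s $ 1 *\<^sub>R axis 1 1 + c s $ 2 *\<^sub>R (axis 2 1 :: real^2)) has_derivative
     (\<lambda>h. (h * c1) *\<^sub>R axis 1 1 + (h * c2) *\<^sub>R (axis 2 1 :: real^2))) (at t)"
    using c[unfolded has_field_derivative_def]
    by (auto intro!: derivative_eq_intros simp: mult.commute)
  then have "(c has_derivative (\<lambda>h. (h * c1) *\<^sub>R axis 1 1 + (h * c2) *\<^sub>R axis 2 1)) (at t)"
    by (simp only: cvec[symmetric])
  moreover have u': "(u has_derivative frechet_derivative u (at (c t))) (at (c t))"
    using u by (simp only: frechet_derivative_works)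
  ultimately have "((\<lambda>s. u (c s)) has_derivative
     (\<lambda>h. frechet_derivative u (at (c t)) ((h * c1) *\<^sub>R axis 1 1 + (h * c2) *\<^sub>R axis 2 1))) (at t)"
    using diff_chain_at[of c _ t u] by (simp add: o_def)
  then have "((\<lambda>s. u (c s) $ j) has_derivative
     (\<lambda>h. frechet_derivative u (at (c t)) ((h * c1) *\<^sub>R axis 1 1 + (h * c2) *\<^sub>R axis 2 1) $ j)) (at t)"
    by (rule bounded_linear.has_derivative[OF bounded_linear_vec_nth])
  moreover have "linear (frechet_derivative u (at (c t)))"
    using u' has_derivative_linear by blast
  then have "(\<lambda>h. frechet_derivative u (at (c t)) ((h * c1) *\<^sub>R axis 1 1 + (h * c2) *\<^sub>R axis 2 1) $ j)
     = (*) (c1 * partial 1 j u (c t) + c2 * partial 2 j u (c t))"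
    by (auto simp: linear_add linear_scale partial_eq_frechet_derivative[OF u] algebra_simps)
  ultimately show ?thesis by (simp add: has_field_derivative_def)
qed

text \<open>The derivatives of the Cartesian components of \<open>u\<close> with respect to \<open>t\<close> and \<open>\<theta>\<close>
(see \<open>DERIV_polar\<close>).\<close>

definition radial_rate :: "(real^2 \<Rightarrow> real^2) \<Rightarrow> 2 \<Rightarrow> real \<Rightarrow> real \<Rightarrow> real" where
  "radial_rate u j t \<theta> = exp t * (cos \<theta> * partial 1 j u (polar t \<theta>) + sin \<theta> * partial 2 j u (polar t \<theta>))"

definition angular_rate :: "(real^2 \<Rightarrow> real^2) \<Rightarrow> 2 \<Rightarrow> real \<Rightarrow> real \<Rightarrow> real" where
  "angular_rate u j t \<theta> = exp t * (cos \<theta> * partial 2 j u (polar t \<theta>) - sin \<theta> * partial 1 j u (polar t \<theta>))"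

lemma DERIV_polar:
  assumes "Ck (Suc 0) u"
  shows "((\<lambda>t. u (polar t \<theta>) $ j) has_real_derivative radial_rate u j t \<theta>) (at t)"
    "((\<lambda>\<theta>. u (polar t \<theta>) $ j) has_real_derivative angular_rate u j t \<theta>) (at \<theta>)"
proof -
  have u: "u differentiable (at x)" for x using assms by simp
  have "((\<lambda>t. u (polar t \<theta>) $ j) has_real_derivative
      (exp t * cos \<theta> * partial 1 j u (polar t \<theta>) + exp t * sin \<theta> * partial 2 j u (polar t \<theta>))) (at t)"
    by (rule DERIV_along_curve[OF u]) (auto intro!: derivative_eq_intros)
  then show "((\<lambda>t. u (polar t \<theta>) $ j) has_real_derivative radial_rate u j t \<theta>) (at t)"
    by (simp add: radial_rate_def algebra_simps)
  have "((\<lambda>\<theta>. u (polar t \<theta>) $ j) has_real_derivative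
      (- exp t * sin \<theta> * partial 1 j u (polar t \<theta>) + exp t * cos \<theta> * partial 2 j u (polar t \<theta>))) (at \<theta>)"
    by (rule DERIV_along_curve[OF u]) (auto intro!: derivative_eq_intros)
  then show "((\<lambda>\<theta>. u (polar t \<theta>) $ j) has_real_derivative angular_rate u j t \<theta>) (at \<theta>)"
    by (simp add: angular_rate_def algebra_simps)
qed

lemma rates_square:
  "(radial_rate u 1 t \<theta>)\<^sup>2 + (radial_rate u 2 t \<theta>)\<^sup>2 + (angular_rate u 1 t \<theta>)\<^sup>2 + (angular_rate u 2 t \<theta>)\<^sup>2
    = exp (2 * t) * grad_norm_sq u (polar t \<theta>)"
proof -
  have rot: "(e * (c * a + s * b))\<^sup>2 + (e * (c * b - s * a))\<^sup>2 = e\<^sup>2 * ((c\<^sup>2 + s\<^sup>2) * (a\<^sup>2 + b\<^sup>2))" for e c s a b :: real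
    by (simp add: power2_eq_square algebra_simps)
  have "(radial_rate u j t \<theta>)\<^sup>2 + (angular_rate u j t \<theta>)\<^sup>2
      = exp (2 * t) * ((partial 1 j u (polar t \<theta>))\<^sup>2 + (partial 2 j u (polar t \<theta>))\<^sup>2)" for j
    unfolding radial_rate_def angular_rate_def rot by (simp add: exp_double)
  from this[of 1] this[of 2] show ?thesis
    by (simp add: grad_norm_sq_def sum_2 distrib_left)
qed

lemma rates_divergence:
  assumes "divergence_free u"
  shows "radial_rate u 1 t \<theta> * cos \<theta> + radial_rate u 2 t \<theta> * sin \<theta>
     + (angular_rate u 2 t \<theta> * cos \<theta> - angular_rate u 1 t \<theta> * sin \<theta>) = 0"
proof -
  have "radial_rate u 1 t \<theta> * cos \<theta> + radial_rate u 2 t \<theta> * sin \<theta>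
     + (angular_rate u 2 t \<theta> * cos \<theta> - angular_rate u 1 t \<theta> * sin \<theta>)
     = exp t * ((cos \<theta>)\<^sup>2 + (sin \<theta>)\<^sup>2) * (partial 1 1 u (polar t \<theta>) + partial 2 2 u (polar t \<theta>))"
    unfolding radial_rate_def angular_rate_def power2_eq_square by algebra
  then show ?thesis using assms by (simp add: divergence_free_def sum_2)
qed

lemma continuous_rates [continuous_intros]:
  assumes "Ck (Suc 0) u" "continuous_on S f" "continuous_on S g"
  shows "continuous_on S (\<lambda>x::'a::t2_space. radial_rate u j (f x) (g x))"
    "continuous_on S (\<lambda>x::'a::t2_space. angular_rate u j (f x) (g x))"
proof -
  have "continuous_on S (\<lambda>x. partial i j u (polar (f x) (g x)))" for i
    by (rule continuous_on_compose2[OF continuous_partial[OF assms(1), of UNIV]])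
      (auto intro: continuous_intros assms)
  then show "continuous_on S (\<lambda>x::'a::t2_space. radial_rate u j (f x) (g x))"
    "continuous_on S (\<lambda>x::'a::t2_space. angular_rate u j (f x) (g x))"
    unfolding radial_rate_def angular_rate_def by (intro continuous_intros assms; assumption)+
qed

lemma continuous_on_C1:
  assumes "Ck (Suc 0) u"
  shows "continuous_on S u"
  using assms by (simp add: continuous_at_imp_continuous_on differentiable_imp_continuous_within)

lemma nn_integral_polar_slices:
  fixes F :: "real^2 \<Rightarrow> real"
  assumes "F \<in> borel_measurable borel" "\<And>x. 0 \<le> F x"
    and G: "\<And>t \<theta>. exp (2 * t) * F (polar t \<theta>) = G t \<theta>" and cont: "\<And>t. continuous_on UNIV (G t)"
  shows "(\<integral>\<^sup>+x. ennreal (F x) \<partial>lborel) = (\<integral>\<^sup>+t. ennreal (integral {-pi..pi} (G t)) \<partial>lborel)"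
proof -
  have "(\<integral>\<^sup>+\<theta>. ennreal (G t \<theta>) * indicator {-pi<..<pi} \<theta> \<partial>lborel) = ennreal (integral {-pi..pi} (G t))" for t
  proof (rule nn_integral_has_integral_lebesgue')
    have "(G t has_integral integral {-pi..pi} (G t)) {-pi..pi}"
      by (rule integrable_integral, rule integrable_continuous_real, rule continuous_on_subset[OF cont]) simp
    then show "(G t has_integral integral {-pi..pi} (G t)) {-pi<..<pi}"
      by (simp add: has_integral_Icc_iff_Ioo)
    show "0 \<le> G t \<theta>" for \<theta> using assms(2) by (simp flip: G)
  qed
  then show ?thesis unfolding nn_integral_polar[OF assms(1,2)] G by simp
qed

lemma hardy_lhs_polar:
  assumes "Ck (Suc 0) u"
  shows "hardy_lhs \<gamma> u = (\<integral>\<^sup>+t. ennreal (integral {-pi..pi}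
      (\<lambda>\<theta>. exp (2 * \<gamma> * t) * ((u (polar t \<theta>) $ 1)\<^sup>2 + (u (polar t \<theta>) $ 2)\<^sup>2))) \<partial>lborel)"
  unfolding hardy_lhs_def
proof (rule nn_integral_polar_slices)
  have "u \<in> borel_measurable borel" by (rule borel_measurable_continuous_onI[OF continuous_on_C1[OF assms]])
  then show "(\<lambda>x. norm x powr (2 * \<gamma> - 2) * (norm (u x))\<^sup>2) \<in> borel_measurable borel" by measurable
  show "exp (2 * t) * (norm (polar t \<theta>) powr (2 * \<gamma> - 2) * (norm (u (polar t \<theta>)))\<^sup>2)
     = exp (2 * \<gamma> * t) * ((u (polar t \<theta>) $ 1)\<^sup>2 + (u (polar t \<theta>) $ 2)\<^sup>2)" for t \<theta>
  proof -
    have "exp (2 * t) * exp t powr (2 * \<gamma> - 2) = exp (2 * \<gamma> * t)"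
      unfolding exp_powr_real exp_add[symmetric] by (simp add: algebra_simps)
    then show ?thesis unfolding norm_polar norm_vec2 mult.assoc[symmetric] by simp
  qed
  show "continuous_on UNIV (\<lambda>\<theta>. exp (2 * \<gamma> * t) * ((u (polar t \<theta>) $ 1)\<^sup>2 + (u (polar t \<theta>) $ 2)\<^sup>2))" for t
    by (intro continuous_intros continuous_on_compose2[OF continuous_on_C1[OF assms, of UNIV]]) auto
qed simp

lemma hardy_rhs_polar:
  assumes "Ck (Suc 0) u"
  shows "hardy_rhs \<gamma> u = (\<integral>\<^sup>+t. ennreal (integral {-pi..pi}
      (\<lambda>\<theta>. exp (2 * \<gamma> * t) * ((radial_rate u 1 t \<theta>)\<^sup>2 + (radial_rate u 2 t \<theta>)\<^sup>2
         + (angular_rate u 1 t \<theta>)\<^sup>2 + (angular_rate u 2 t \<theta>)\<^sup>2))) \<partial>lborel)"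
  unfolding hardy_rhs_def
proof (rule nn_integral_polar_slices)
  have [measurable]: "partial i j u \<in> borel_measurable borel" for i j
    by (rule borel_measurable_continuous_onI[OF continuous_partial[OF assms]])
  show "(\<lambda>x. norm x powr (2 * \<gamma>) * grad_norm_sq u x) \<in> borel_measurable borel"
    unfolding grad_norm_sq_def by measurable
  show "0 \<le> norm x powr (2 * \<gamma>) * grad_norm_sq u x" for x
    by (simp add: grad_norm_sq_def sum_nonneg)
  show "exp (2 * t) * (norm (polar t \<theta>) powr (2 * \<gamma>) * grad_norm_sq u (polar t \<theta>))
     = exp (2 * \<gamma> * t) * ((radial_rate u 1 t \<theta>)\<^sup>2 + (radial_rate u 2 t \<theta>)\<^sup>2
         + (angular_rate u 1 t \<theta>)\<^sup>2 + (angular_rate u 2 t \<theta>)\<^sup>2)" for t \<theta>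
    unfolding rates_square by (simp add: exp_powr_real mult_ac)
qed (intro continuous_intros assms)

lemma C1_if_smooth: "smooth_compact_support u \<Longrightarrow> Ck (Suc 0) u"
  by (simp only: smooth_compact_support_def)

lemma smooth_compact_support_bounds:
  assumes "smooth_compact_support u"
  obtains R K where "R > 0" "\<And>x. norm x \<ge> R \<Longrightarrow> u x = 0" "\<And>x. norm (u x) \<le> K"
proof -
  have cpt: "compact (closure {x. u x \<noteq> 0})" using assms by (simp add: smooth_compact_support_def)
  then obtain R where R: "\<And>x. x \<in> closure {x. u x \<noteq> 0} \<Longrightarrow> norm x \<le> R"
    using compact_imp_bounded bounded_iff by metis
  have "compact (u ` closure {x. u x \<noteq> 0})"
    by (rule compact_continuous_image[OF continuous_on_C1[OF C1_if_smooth[OF assms]] cpt])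
  then obtain K where K: "\<And>x. x \<in> closure {x. u x \<noteq> 0} \<Longrightarrow> norm (u x) \<le> K"
    using compact_imp_bounded bounded_iff by (metis imageI)
  have "x \<in> closure {x. u x \<noteq> 0}" if "u x \<noteq> 0" for x
    using that closure_subset[of "{x. u x \<noteq> 0}"] by auto
  then have R': "norm x \<le> R" and K': "norm (u x) \<le> K" if "u x \<noteq> 0" for x
    using that R K by blast+
  show ?thesis
  proof (rule that)
    show "\<bar>R\<bar> + 1 > 0" by simp
    show "u x = 0" if "norm x \<ge> \<bar>R\<bar> + 1" for x
      using that R'[of x] by (cases "u x = 0") auto
    show "norm (u x) \<le> \<bar>K\<bar>" for x
      using K'[of x] by (cases "u x = 0") auto
  qed
qed

text \<open>Near the origin this is differentiability; away from it boundedness suffices.\<close>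

lemma smooth_compact_support_linear_bound:
  assumes "smooth_compact_support u" "u 0 = 0"
  obtains L where "\<And>x. norm (u x) \<le> L * norm x"
proof -
  obtain R K where K: "\<And>x. norm (u x) \<le> K" using smooth_compact_support_bounds[OF assms(1)] by metis
  have "K \<ge> 0" using K[of 0] norm_ge_zero[of "u 0"] by linarith
  have "u differentiable (at 0)" using C1_if_smooth[OF assms(1)] by simp
  then obtain D where D: "(u has_derivative D) (at 0)" by (auto simp: differentiable_def)
  then obtain d where d: "d > 0" "\<And>y. norm y < d \<Longrightarrow> norm (u y - D y) \<le> norm y"
    unfolding has_derivative_at_alt using assms(2) by (metis diff_zero mult_1 zero_less_one)
  obtain B where B: "\<And>x. norm (D x) \<le> norm x * B"
    using has_derivative_bounded_linear[OF D] bounded_linear.bounded by blast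
  have "K / d \<ge> 0" using \<open>K \<ge> 0\<close> d(1) by simp
  then have coeff: "B + 1 \<le> \<bar>B\<bar> + 1 + K / d" using abs_ge_self[of B] by linarith
  have "norm (u x) \<le> (\<bar>B\<bar> + 1 + K / d) * norm x" for x
  proof (cases "norm x < d")
    case True
    have "norm (u x) \<le> norm (u x - D x) + norm (D x)" by (metis norm_triangle_sub add.commute)
    also have "\<dots> \<le> norm x + norm x * B" using d(2)[OF True] B by (intro add_mono)
    also have "\<dots> = (B + 1) * norm x" by (simp add: algebra_simps)
    also have "\<dots> \<le> (\<bar>B\<bar> + 1 + K / d) * norm x" using coeff by (intro mult_right_mono) auto
    finally show ?thesis .
  next
    case False
    have "norm (u x) \<le> K / d * d" using K d(1) by simp
    also have "\<dots> \<le> K / d * norm x" using False \<open>K \<ge> 0\<close> d(1) by (intro mult_left_mono) auto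
    also have "\<dots> \<le> (\<bar>B\<bar> + 1 + K / d) * norm x" by (intro mult_right_mono) auto
    finally show ?thesis .
  qed
  then show ?thesis using that by blast
qed

text \<open>Both branches of the constant come from one formula, since \<open>1 + (1-\<gamma>)\<^sup>2 - 4 (1-\<gamma>) = (\<gamma>+1)\<^sup>2 - 3\<close>
and \<open>(1 + (1-\<gamma>)\<^sup>2) (\<gamma>\<^sup>2 + 1) + (\<gamma>+1)\<^sup>2 - 3 = \<gamma>\<^sup>2 (3 + (1-\<gamma>)\<^sup>2)\<close>.\<close>

lemma hardy_const_eq:
  assumes "\<gamma> \<noteq> 0"
  shows "\<gamma>\<^sup>2 + 1 + excess \<gamma> > 0" "hardy_const \<gamma> = 1 / (\<gamma>\<^sup>2 + 1 + excess \<gamma>)"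
proof -
  define q where "q = 1 + (1 - \<gamma>)\<^sup>2"
  have q: "q > 0" by (simp add: q_def add_pos_nonneg)
  have quad: "1 + (1 - \<gamma>)\<^sup>2 - 4 * (1 - \<gamma>) = (\<gamma> + 1)\<^sup>2 - 3"
    by (simp add: power2_eq_square algebra_simps)
  have ex: "excess \<gamma> = min 0 (((\<gamma> + 1)\<^sup>2 - 3) / q)"
    unfolding excess_def quad unfolding q_def ..
  have mem: "\<gamma> \<in> {- sqrt 3 - 1 .. sqrt 3 - 1} \<longleftrightarrow> (\<gamma> + 1)\<^sup>2 \<le> 3"
  proof -
    have "(\<gamma> + 1)\<^sup>2 \<le> 3 \<longleftrightarrow> \<bar>\<gamma> + 1\<bar> \<le> sqrt 3"
      by (metis real_sqrt_abs real_sqrt_le_iff)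
    then show ?thesis by auto
  qed
  show "\<gamma>\<^sup>2 + 1 + excess \<gamma> > 0" "hardy_const \<gamma> = 1 / (\<gamma>\<^sup>2 + 1 + excess \<gamma>)"
  proof (atomize (full), cases "(\<gamma> + 1)\<^sup>2 \<le> 3")
    case True
    then have "excess \<gamma> = ((\<gamma> + 1)\<^sup>2 - 3) / q"
      unfolding ex using q by (intro min_absorb2) (simp add: divide_le_0_iff)
    then have "\<gamma>\<^sup>2 + 1 + excess \<gamma> = (q * (\<gamma>\<^sup>2 + 1) + (\<gamma> + 1)\<^sup>2 - 3) / q"
      using q by (simp add: field_simps)
    also have "q * (\<gamma>\<^sup>2 + 1) + (\<gamma> + 1)\<^sup>2 - 3 = \<gamma>\<^sup>2 * (3 + (1 - \<gamma>)\<^sup>2)"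
      by (simp add: q_def power2_eq_square algebra_simps)
    finally have eq: "\<gamma>\<^sup>2 + 1 + excess \<gamma> = \<gamma>\<^sup>2 * (3 + (1 - \<gamma>)\<^sup>2) / q" .
    have "3 + (1 - \<gamma>)\<^sup>2 > 0" by (simp add: add_pos_nonneg)
    then show "0 < \<gamma>\<^sup>2 + 1 + excess \<gamma> \<and> hardy_const \<gamma> = 1 / (\<gamma>\<^sup>2 + 1 + excess \<gamma>)"
      using True mem q assms unfolding eq by (simp add: hardy_const_def q_def)
  next
    case False
    then have "excess \<gamma> = 0"
      unfolding ex using q by (intro min_absorb1) (simp add: zero_le_divide_iff)
    then show "0 < \<gamma>\<^sup>2 + 1 + excess \<gamma> \<and> hardy_const \<gamma> = 1 / (\<gamma>\<^sup>2 + 1 + excess \<gamma>)"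
      using False mem by (auto simp: hardy_const_def add_nonneg_pos)
  qed
qed


text \<open>The functions \<open>f\<close>, \<open>h\<close> of \<open>solenoidal_polar_field\<close> and their four derivatives, written so that
each of the four terms of the energy density becomes \<open>e\<^bsup>\<gamma>t\<^esup>\<close> times a rotated pair of rates.\<close>

definition radial_comp :: "real \<Rightarrow> (real^2 \<Rightarrow> real^2) \<Rightarrow> real \<Rightarrow> real \<Rightarrow> real" where
  "radial_comp \<gamma> u t \<theta> = exp (\<gamma> * t) * (u (polar t \<theta>) $ 1 * cos \<theta> + u (polar t \<theta>) $ 2 * sin \<theta>)"

definition angular_comp :: "real \<Rightarrow> (real^2 \<Rightarrow> real^2) \<Rightarrow> real \<Rightarrow> real \<Rightarrow> real" where
  "angular_comp \<gamma> u t \<theta> = exp (\<gamma> * t) * (u (polar t \<theta>) $ 2 * cos \<theta> - u (polar t \<theta>) $ 1 * sin \<theta>)"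

definition radial_comp_t :: "real \<Rightarrow> (real^2 \<Rightarrow> real^2) \<Rightarrow> real \<Rightarrow> real \<Rightarrow> real" where
  "radial_comp_t \<gamma> u t \<theta> = exp (\<gamma> * t) * (radial_rate u 1 t \<theta> * cos \<theta> + radial_rate u 2 t \<theta> * sin \<theta>) + \<gamma> * radial_comp \<gamma> u t \<theta>"

definition angular_comp_t :: "real \<Rightarrow> (real^2 \<Rightarrow> real^2) \<Rightarrow> real \<Rightarrow> real \<Rightarrow> real" where
  "angular_comp_t \<gamma> u t \<theta> = exp (\<gamma> * t) * (radial_rate u 2 t \<theta> * cos \<theta> - radial_rate u 1 t \<theta> * sin \<theta>) + \<gamma> * angular_comp \<gamma> u t \<theta>"

definition radial_comp_\<theta> :: "real \<Rightarrow> (real^2 \<Rightarrow> real^2) \<Rightarrow> real \<Rightarrow> real \<Rightarrow> real" where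
  "radial_comp_\<theta> \<gamma> u t \<theta> = exp (\<gamma> * t) * (angular_rate u 1 t \<theta> * cos \<theta> + angular_rate u 2 t \<theta> * sin \<theta>) + angular_comp \<gamma> u t \<theta>"

definition angular_comp_\<theta> :: "real \<Rightarrow> (real^2 \<Rightarrow> real^2) \<Rightarrow> real \<Rightarrow> real \<Rightarrow> real" where
  "angular_comp_\<theta> \<gamma> u t \<theta> = exp (\<gamma> * t) * (angular_rate u 2 t \<theta> * cos \<theta> - angular_rate u 1 t \<theta> * sin \<theta>) - radial_comp \<gamma> u t \<theta>"

lemma solenoidal_polar_field_of_admissible:
  assumes u: "smooth_compact_support u" "divergence_free u"
  shows "solenoidal_polar_field \<gamma> (radial_comp \<gamma> u) (radial_comp_t \<gamma> u) (radial_comp_\<theta> \<gamma> u)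
     (angular_comp \<gamma> u) (angular_comp_t \<gamma> u) (angular_comp_\<theta> \<gamma> u)"
    and "(radial_comp \<gamma> u t \<theta>)\<^sup>2 + (angular_comp \<gamma> u t \<theta>)\<^sup>2 = exp (2 * \<gamma> * t) * ((u (polar t \<theta>) $ 1)\<^sup>2 + (u (polar t \<theta>) $ 2)\<^sup>2)"
    and "(radial_comp_t \<gamma> u t \<theta> - \<gamma> * radial_comp \<gamma> u t \<theta>)\<^sup>2 + (angular_comp_t \<gamma> u t \<theta> - \<gamma> * angular_comp \<gamma> u t \<theta>)\<^sup>2 + (radial_comp_\<theta> \<gamma> u t \<theta> - angular_comp \<gamma> u t \<theta>)\<^sup>2 + (angular_comp_\<theta> \<gamma> u t \<theta> + radial_comp \<gamma> u t \<theta>)\<^sup>2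
      = exp (2 * \<gamma> * t) * ((radial_rate u 1 t \<theta>)\<^sup>2 + (radial_rate u 2 t \<theta>)\<^sup>2
         + (angular_rate u 1 t \<theta>)\<^sup>2 + (angular_rate u 2 t \<theta>)\<^sup>2)"
proof -
  have C1: "Ck (Suc 0) u" by (rule C1_if_smooth[OF u(1)])
  note D = DERIV_polar[OF C1]
  have cont_u: "continuous_on UNIV (\<lambda>p. u (polar (fst p) (snd p)))"
    by (intro continuous_on_compose2[OF continuous_on_C1[OF C1, of UNIV]] continuous_intros) auto
  have per: "polar t (\<theta> + 2 * pi) = polar t \<theta>" for t \<theta>
    by (simp add: polar_def sin_periodic cos_periodic)
  obtain R where R: "R > 0" "\<And>x. norm x \<ge> R \<Longrightarrow> u x = 0"
    using smooth_compact_support_bounds[OF u(1)] by metis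
  have vanish: "u (polar t \<theta>) = 0" if "t \<ge> ln R" for t \<theta>
  proof -
    have "exp (ln R) \<le> exp t" using that by simp
    then show ?thesis using R by (intro R(2)) simp
  qed
  show "solenoidal_polar_field \<gamma> (radial_comp \<gamma> u) (radial_comp_t \<gamma> u) (radial_comp_\<theta> \<gamma> u)
     (angular_comp \<gamma> u) (angular_comp_t \<gamma> u) (angular_comp_\<theta> \<gamma> u)"
  proof
    show "((\<lambda>t. radial_comp \<gamma> u t \<theta>) has_real_derivative radial_comp_t \<gamma> u t \<theta>) (at t)" for t \<theta>
      unfolding radial_comp_t_def radial_comp_def
      by (auto intro!: derivative_eq_intros D simp: algebra_simps)
    show "((\<lambda>t. angular_comp \<gamma> u t \<theta>) has_real_derivative angular_comp_t \<gamma> u t \<theta>) (at t)" for t \<theta>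
      unfolding angular_comp_t_def angular_comp_def
      by (auto intro!: derivative_eq_intros D simp: algebra_simps)
    show "(radial_comp \<gamma> u t has_real_derivative radial_comp_\<theta> \<gamma> u t \<theta>) (at \<theta>)" for t \<theta>
      unfolding radial_comp_\<theta>_def radial_comp_def angular_comp_def
      by (auto intro!: derivative_eq_intros D simp: algebra_simps)
    show "(angular_comp \<gamma> u t has_real_derivative angular_comp_\<theta> \<gamma> u t \<theta>) (at \<theta>)" for t \<theta>
      unfolding angular_comp_\<theta>_def radial_comp_def angular_comp_def
      by (auto intro!: derivative_eq_intros D simp: algebra_simps)
    show "angular_comp_\<theta> \<gamma> u t \<theta> = - (radial_comp_t \<gamma> u t \<theta> + (1 - \<gamma>) * radial_comp \<gamma> u t \<theta>)" for t \<theta>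
    proof -
      have eq: "angular_rate u 2 t \<theta> * cos \<theta> - angular_rate u 1 t \<theta> * sin \<theta>
          = - (radial_rate u 1 t \<theta> * cos \<theta> + radial_rate u 2 t \<theta> * sin \<theta>)"
        using rates_divergence[OF u(2), of t \<theta>] by linarith
      show ?thesis unfolding angular_comp_\<theta>_def radial_comp_t_def eq by algebra
    qed
    show "\<exists>T. \<forall>t\<ge>T. \<forall>\<theta>. radial_comp \<gamma> u t \<theta> = 0 \<and> angular_comp \<gamma> u t \<theta> = 0"
      using vanish by (intro exI[of _ "ln R"]) (simp add: radial_comp_def angular_comp_def)
    show "radial_comp \<gamma> u t (\<theta> + 2 * pi) = radial_comp \<gamma> u t \<theta>" "angular_comp \<gamma> u t (\<theta> + 2 * pi) = angular_comp \<gamma> u t \<theta>" for t \<theta>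
      by (simp_all only: radial_comp_def angular_comp_def per sin_periodic cos_periodic)
  qed (unfold radial_comp_def angular_comp_def radial_comp_t_def angular_comp_t_def radial_comp_\<theta>_def angular_comp_\<theta>_def, (intro continuous_intros cont_u C1)+)
  have e: "exp (2 * \<gamma> * t) = (exp (\<gamma> * t))\<^sup>2" by (simp add: exp_double[symmetric] mult.assoc)
  have rot: "(e * (x * cos \<theta> + y * sin \<theta>))\<^sup>2 + (e * (y * cos \<theta> - x * sin \<theta>))\<^sup>2 = e\<^sup>2 * (x\<^sup>2 + y\<^sup>2)" for e x y
  proof -
    have "(e * (x * cos \<theta> + y * sin \<theta>))\<^sup>2 + (e * (y * cos \<theta> - x * sin \<theta>))\<^sup>2
      = e\<^sup>2 * (((sin \<theta>)\<^sup>2 + (cos \<theta>)\<^sup>2) * (x\<^sup>2 + y\<^sup>2))"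
      unfolding power2_eq_square by algebra
    then show ?thesis by simp
  qed
  show "(radial_comp \<gamma> u t \<theta>)\<^sup>2 + (angular_comp \<gamma> u t \<theta>)\<^sup>2 = exp (2 * \<gamma> * t) * ((u (polar t \<theta>) $ 1)\<^sup>2 + (u (polar t \<theta>) $ 2)\<^sup>2)"
    unfolding e radial_comp_def angular_comp_def by (rule rot)
  have "radial_comp_t \<gamma> u t \<theta> - \<gamma> * radial_comp \<gamma> u t \<theta> = exp (\<gamma> * t) * (radial_rate u 1 t \<theta> * cos \<theta> + radial_rate u 2 t \<theta> * sin \<theta>)"
    "angular_comp_t \<gamma> u t \<theta> - \<gamma> * angular_comp \<gamma> u t \<theta> = exp (\<gamma> * t) * (radial_rate u 2 t \<theta> * cos \<theta> - radial_rate u 1 t \<theta> * sin \<theta>)"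
    "radial_comp_\<theta> \<gamma> u t \<theta> - angular_comp \<gamma> u t \<theta> = exp (\<gamma> * t) * (angular_rate u 1 t \<theta> * cos \<theta> + angular_rate u 2 t \<theta> * sin \<theta>)"
    "angular_comp_\<theta> \<gamma> u t \<theta> + radial_comp \<gamma> u t \<theta> = exp (\<gamma> * t) * (angular_rate u 2 t \<theta> * cos \<theta> - angular_rate u 1 t \<theta> * sin \<theta>)"
    by (simp_all add: radial_comp_t_def angular_comp_t_def radial_comp_\<theta>_def angular_comp_\<theta>_def)
  note comps = this
  show "(radial_comp_t \<gamma> u t \<theta> - \<gamma> * radial_comp \<gamma> u t \<theta>)\<^sup>2 + (angular_comp_t \<gamma> u t \<theta> - \<gamma> * angular_comp \<gamma> u t \<theta>)\<^sup>2 + (radial_comp_\<theta> \<gamma> u t \<theta> - angular_comp \<gamma> u t \<theta>)\<^sup>2 + (angular_comp_\<theta> \<gamma> u t \<theta> + radial_comp \<gamma> u t \<theta>)\<^sup>2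
      = exp (2 * \<gamma> * t) * ((radial_rate u 1 t \<theta>)\<^sup>2 + (radial_rate u 2 t \<theta>)\<^sup>2
         + (angular_rate u 1 t \<theta>)\<^sup>2 + (angular_rate u 2 t \<theta>)\<^sup>2)"
    unfolding e comps rot unfolding add.assoc rot
    by (simp only: distrib_left add.assoc)
qed

theorem hardy_inequality:
  assumes "\<gamma> \<noteq> 0" and u: "u \<in> admissible \<gamma>"
  shows "hardy_lhs \<gamma> u \<le> ennreal (hardy_const \<gamma>) * hardy_rhs \<gamma> u"
proof (cases "hardy_rhs \<gamma> u = \<infinity>")
  case True
  have "hardy_const \<gamma> > 0" using hardy_const_eq[OF assms(1)] by simp
  with True show ?thesis by (simp add: ennreal_mult_top)
next
  case False
  from u have sm: "smooth_compact_support u" and df: "divergence_free u" and u0: "\<gamma> < 0 \<Longrightarrow> u 0 = 0"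
    by (auto simp: admissible_def)
  note C1 = C1_if_smooth[OF sm]
  note F = solenoidal_polar_field_of_admissible[OF sm df, of \<gamma>]
  interpret solenoidal_polar_field \<gamma> "radial_comp \<gamma> u" "radial_comp_t \<gamma> u" "radial_comp_\<theta> \<gamma> u"
     "angular_comp \<gamma> u" "angular_comp_t \<gamma> u" "angular_comp_\<theta> \<gamma> u" by (rule F(1))
  have lhs: "hardy_lhs \<gamma> u = (\<integral>\<^sup>+t. ennreal (mass t) \<partial>lborel)"
    unfolding hardy_lhs_polar[OF C1] mass_def F(2) ..
  have rhs: "hardy_rhs \<gamma> u = (\<integral>\<^sup>+t. ennreal (energy t) \<partial>lborel)"
    unfolding hardy_rhs_polar[OF C1] energy_def energy_density_def[abs_def] F(3) ..
  have mass_le: "mass t \<le> 2 * pi * c\<^sup>2 * exp (2 * \<gamma> * t)" if "\<And>\<theta>. norm (u (polar t \<theta>)) \<le> c" for t c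
  proof -
    have "(radial_comp \<gamma> u t \<theta>)\<^sup>2 + (angular_comp \<gamma> u t \<theta>)\<^sup>2 \<le> exp (2 * \<gamma> * t) * c\<^sup>2" for \<theta>
      unfolding F(2) norm_vec2[symmetric] using that by (intro mult_left_mono power_mono) auto
    then have "mass t \<le> integral {-pi..pi} (\<lambda>\<theta>. exp (2 * \<gamma> * t) * c\<^sup>2)"
      unfolding mass_def by (intro integral_le integrable_continuous_real continuous_intros slice_cont) auto
    then show ?thesis by (simp add: mult_ac)
  qed
  have "(mass \<longlongrightarrow> 0) at_bot"
  proof (cases "\<gamma> > 0")
    case True
    obtain R K where K: "\<And>x. norm (u x) \<le> K" using smooth_compact_support_bounds[OF sm] by metis
    have "filterlim (\<lambda>t. 2 * \<gamma> * t) at_bot at_bot"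
      using True by (intro filterlim_tendsto_pos_mult_at_bot[OF tendsto_const]) (auto simp: filterlim_ident)
    then have "((\<lambda>t. exp (2 * \<gamma> * t)) \<longlongrightarrow> 0) at_bot"
      by (rule filterlim_compose[OF exp_at_bot])
    then have "((\<lambda>t. 2 * pi * K\<^sup>2 * exp (2 * \<gamma> * t)) \<longlongrightarrow> 2 * pi * K\<^sup>2 * 0) at_bot"
      by (rule tendsto_mult_left)
    then have lim: "((\<lambda>t. 2 * pi * K\<^sup>2 * exp (2 * \<gamma> * t)) \<longlongrightarrow> 0) at_bot" by simp
    show ?thesis
    proof (rule real_tendsto_sandwich[OF _ _ tendsto_const lim])
      show "\<forall>\<^sub>F t in at_bot. 0 \<le> mass t" by (intro always_eventually allI mass_nonneg)
      show "\<forall>\<^sub>F t in at_bot. mass t \<le> 2 * pi * K\<^sup>2 * exp (2 * \<gamma> * t)"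
        by (intro always_eventually allI mass_le K)
    qed
  next
    case False
    with assms(1) have "\<gamma> < 0" by simp
    then obtain L where L: "\<And>x. norm (u x) \<le> L * norm x"
      using smooth_compact_support_linear_bound[OF sm u0] by metis
    show ?thesis
    proof (rule decay_of_finite_energy[OF \<open>\<gamma> < 0\<close>])
      show "(\<integral>\<^sup>+t. ennreal (energy t) \<partial>lborel) < \<infinity>" using False \<open>hardy_rhs \<gamma> u \<noteq> \<infinity>\<close> rhs by (simp add: less_top)
      show "mass t \<le> 2 * pi * L\<^sup>2 * exp ((2 * \<gamma> + 2) * t)" for t
      proof -
        have "mass t \<le> 2 * pi * (L * exp t)\<^sup>2 * exp (2 * \<gamma> * t)"
          using L[of "polar t _"] by (intro mass_le) simp
        also have "\<dots> = 2 * pi * L\<^sup>2 * (exp (2 * t) * exp (2 * \<gamma> * t))"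
          by (simp add: exp_double power_mult_distrib)
        finally show ?thesis by (simp add: exp_add[symmetric] algebra_simps)
      qed
    qed
  qed
  from hardy_if_decay[OF this]
  have main: "ennreal (\<gamma>\<^sup>2 + 1 + excess \<gamma>) * hardy_lhs \<gamma> u \<le> hardy_rhs \<gamma> u" unfolding lhs rhs .
  have "hardy_lhs \<gamma> u = ennreal (hardy_const \<gamma>) * (ennreal (\<gamma>\<^sup>2 + 1 + excess \<gamma>) * hardy_lhs \<gamma> u)"
    using hardy_const_eq[OF assms(1)] by (simp add: mult.assoc[symmetric] ennreal_mult[symmetric])
  also have "\<dots> \<le> ennreal (hardy_const \<gamma>) * hardy_rhs \<gamma> u"
    using main by (intro mult_left_mono) auto
  finally show ?thesis .
qed

section \<open>Smooth compactly supported test functions\<close>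

text \<open>The polynomial factor makes the family closed under differentiation, so that smoothness at \<open>0\<close> follows
from one computation.\<close>

definition flat_exp :: "real poly \<Rightarrow> real \<Rightarrow> real" where
  "flat_exp p x = (if x > 0 then poly p (1 / x) * exp (- (1 / x)) else 0)"

lemma poly_exp_tendsto_0: "((\<lambda>y::real. poly p y * exp (- y)) \<longlongrightarrow> 0) at_top"
proof -
  have "((\<lambda>y. \<Sum>i\<le>degree p. coeff p i * (y ^ i / exp y)) \<longlongrightarrow> (\<Sum>i\<le>degree p. coeff p i * 0)) at_top"
    by (intro tendsto_sum tendsto_mult_left tendsto_power_div_exp_0)
  moreover have "(\<Sum>i\<le>degree p. coeff p i * (y ^ i / exp y)) = poly p y * exp (- y)" for y
    by (simp add: poly_altdef sum_distrib_right exp_minus divide_inverse mult.assoc)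
  ultimately show ?thesis by simp
qed

lemma DERIV_flat_exp:
  "(flat_exp p has_real_derivative flat_exp (pCons 0 (pCons 0 (p - pderiv p))) x) (at x)"
proof -
  consider "x < 0" | "x = 0" | "x > 0" by linarith
  then show ?thesis
  proof cases
    case 1
    have "((\<lambda>x. 0) has_real_derivative 0) (at x)" by simp
    then have "(flat_exp p has_real_derivative 0) (at x)"
      by (rule has_field_derivative_transform_within_open[of _ _ _ "{..<0}"])
        (use 1 in \<open>auto simp: flat_exp_def\<close>)
    with 1 show ?thesis by (simp add: flat_exp_def)
  next
    case 2
    have "((\<lambda>h. flat_exp p h / h) \<longlongrightarrow> 0) (at 0)"
    proof (rule filterlim_split_at)
      show "((\<lambda>h. flat_exp p h / h) \<longlongrightarrow> 0) (at_left 0)"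
        by (rule Lim_transform_eventually[OF tendsto_const])
          (auto simp: eventually_at_filter flat_exp_def)
      have "((\<lambda>y. poly (pCons 0 p) y * exp (- y)) \<longlongrightarrow> 0) at_top" by (rule poly_exp_tendsto_0)
      then have "((\<lambda>y. flat_exp p (inverse y) / inverse y) \<longlongrightarrow> 0) at_top"
        by (rule Lim_transform_eventually)
          (use eventually_gt_at_top[of 0] in eventually_elim, simp add: flat_exp_def field_simps)
      then show "((\<lambda>h. flat_exp p h / h) \<longlongrightarrow> 0) (at_right 0)"
        by (simp only: filterlim_at_right_to_top)
    qed
    then show ?thesis unfolding 2 has_field_derivative_iff by (simp add: flat_exp_def)
  next
    case 3
    have "((\<lambda>x. poly p (1 / x) * exp (- (1 / x))) has_real_derivative
      poly (pCons 0 (pCons 0 (p - pderiv p))) (1 / x) * exp (- (1 / x))) (at x)"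
      using 3 by (auto intro!: derivative_eq_intros simp: power2_eq_square field_simps)
    then have "(flat_exp p has_real_derivative
      poly (pCons 0 (pCons 0 (p - pderiv p))) (1 / x) * exp (- (1 / x))) (at x)"
      by (rule has_field_derivative_transform_within_open[of _ _ _ "{0<..}"])
        (use 3 in \<open>auto simp: flat_exp_def\<close>)
    with 3 show ?thesis by (simp add: flat_exp_def)
  qed
qed

primrec bump_poly :: "nat \<Rightarrow> real poly" where
  "bump_poly 0 = 1"
| "bump_poly (Suc n) = pCons 0 (pCons 0 (bump_poly n - pderiv (bump_poly n)))"

text \<open>The successive derivatives of the function that equals \<open>e\<^bsup>-1/x\<^esup>\<close> for \<open>x > 0\<close> and vanishes for
\<open>x \<le> 0\<close>.\<close>

definition flat :: "nat \<Rightarrow> real \<Rightarrow> real" where "flat n = flat_exp (bump_poly n)"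

lemma DERIV_flat: "(flat n has_real_derivative flat (Suc n) x) (at x)"
  unfolding flat_def bump_poly.simps by (rule DERIV_flat_exp)

lemma flat_nonpos: "x \<le> 0 \<Longrightarrow> flat n x = 0"
  by (simp add: flat_def flat_exp_def)

lemma flat_pos: "x > 0 \<Longrightarrow> flat 0 x > 0"
  by (simp add: flat_def flat_exp_def)

lemma continuous_on_flat [continuous_intros]:
  assumes "continuous_on S f"
  shows "continuous_on S (\<lambda>x. flat n (f x))"
proof -
  have "continuous_on UNIV (flat n)"
    using DERIV_flat by (meson DERIV_isCont continuous_at_imp_continuous_on)
  from continuous_on_compose2[OF this assms] show ?thesis by simp
qed

text \<open>A bump in \<open>\<kappa> ln s\<close>, supported in \<open>[e\<^bsup>-1/\<kappa>\<^esup>, e\<^bsup>1/\<kappa>\<^esup>]\<close>, times a power of \<open>s\<close>; logarithms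
and higher derivatives of the bump are included so that derivatives are combinations of members of the same
family.\<close>

definition log_bump :: "real \<Rightarrow> real \<Rightarrow> nat \<Rightarrow> nat \<Rightarrow> real \<Rightarrow> real" where
  "log_bump \<kappa> \<alpha> m n s = (if s > 0 then s powr \<alpha> * ln s ^ m * flat n (1 - (\<kappa> * ln s)\<^sup>2) else 0)"

definition log_bump' :: "real \<Rightarrow> real \<Rightarrow> nat \<Rightarrow> nat \<Rightarrow> real \<Rightarrow> real" where
  "log_bump' \<kappa> \<alpha> m n s = \<alpha> * log_bump \<kappa> (\<alpha> - 1) m n s + real m * log_bump \<kappa> (\<alpha> - 1) (m - 1) n s
     + (- 2 * \<kappa>\<^sup>2) * log_bump \<kappa> (\<alpha> - 1) (Suc m) (Suc n) s"

lemma log_bump_eq_0: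
  assumes "\<kappa> > 0" "s \<le> exp (- (1 / \<kappa>)) \<or> s \<ge> exp (1 / \<kappa>)"
  shows "log_bump \<kappa> \<alpha> m n s = 0"
proof (cases "s > 0")
  case True
  have "ln s \<le> - (1 / \<kappa>) \<or> ln s \<ge> 1 / \<kappa>"
    using assms(2) True by (metis exp_ln exp_le_cancel_iff)
  then have "\<bar>ln s\<bar> \<ge> 1 / \<kappa>" by linarith
  then have "\<bar>\<kappa> * ln s\<bar> \<ge> 1" using assms(1) by (simp add: abs_mult field_simps)
  then have "(\<kappa> * ln s)\<^sup>2 \<ge> 1" by (metis abs_le_square_iff abs_one one_power2)
  then show ?thesis by (simp add: log_bump_def flat_nonpos)
qed (simp add: log_bump_def)

lemma DERIV_log_bump:
  assumes "\<kappa> > 0"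
  shows "(log_bump \<kappa> \<alpha> m n has_real_derivative log_bump' \<kappa> \<alpha> m n s) (at s)"
proof (cases "s > 0")
  case True
  have powr: "s powr \<alpha> * (1 / s) = s powr (\<alpha> - 1)"
    using True by (simp add: powr_diff)
  have "((\<lambda>s. s powr \<alpha> * ln s ^ m * flat n (1 - (\<kappa> * ln s)\<^sup>2)) has_real_derivative
     (\<alpha> * s powr (\<alpha> - 1) * ln s ^ m + real m * ln s ^ (m - 1) * (1 / s) * s powr \<alpha>) * flat n (1 - (\<kappa> * ln s)\<^sup>2)
     + flat (Suc n) (1 - (\<kappa> * ln s)\<^sup>2) * (- (2 * (\<kappa> * ln s) * (\<kappa> * (1 / s)))) * (s powr \<alpha> * ln s ^ m)) (at s)"
  proof (rule DERIV_cong, rule DERIV_mult, rule DERIV_mult, rule has_real_derivative_powr[OF True],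
      rule DERIV_power, rule DERIV_ln_divide[OF True], rule DERIV_chain2[OF DERIV_flat])
    show "((\<lambda>s. 1 - (\<kappa> * ln s)\<^sup>2) has_real_derivative 0 - real 2 * (\<kappa> * (1 / s) * (\<kappa> * ln s) ^ (2 - Suc 0))) (at s)"
      by (intro DERIV_diff DERIV_const DERIV_power DERIV_cmult DERIV_ln_divide[OF True])
  qed (simp add: algebra_simps)
  also have "(\<alpha> * s powr (\<alpha> - 1) * ln s ^ m + real m * ln s ^ (m - 1) * (1 / s) * s powr \<alpha>) * flat n (1 - (\<kappa> * ln s)\<^sup>2)
     + flat (Suc n) (1 - (\<kappa> * ln s)\<^sup>2) * (- (2 * (\<kappa> * ln s) * (\<kappa> * (1 / s)))) * (s powr \<alpha> * ln s ^ m)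
     = log_bump' \<kappa> \<alpha> m n s"
    unfolding log_bump'_def log_bump_def powr[symmetric] using True
    by (simp add: power2_eq_square algebra_simps)
  finally show ?thesis
    by (rule has_field_derivative_transform_within_open[of _ _ _ "{0<..}"])
        (use True in \<open>auto simp: log_bump_def\<close>)
next
  case False
  have "((\<lambda>s. 0) has_real_derivative 0) (at s)" by simp
  then have "(log_bump \<kappa> \<alpha> m n has_real_derivative 0) (at s)"
    by (rule has_field_derivative_transform_within_open[of _ _ _ "{..<exp (- (1 / \<kappa>))}"])
      (use False in \<open>auto simp: log_bump_eq_0[OF assms] intro: le_less_trans[of s 0]\<close>)
  with False show ?thesis by (simp add: log_bump'_def log_bump_def)
qed

text \<open>This class contains all directional derivatives of its members, which makes its members smooth.\<close>

inductive test_fun :: "real \<Rightarrow> (real^2 \<Rightarrow> real) \<Rightarrow> bool" for \<kappa> where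
  const: "test_fun \<kappa> (\<lambda>x. c)"
| coord: "test_fun \<kappa> (\<lambda>x. x $ i)"
| radial: "test_fun \<kappa> (\<lambda>x. log_bump \<kappa> \<alpha> m n ((x $ 1)\<^sup>2 + (x $ 2)\<^sup>2))"
| add: "test_fun \<kappa> f \<Longrightarrow> test_fun \<kappa> g \<Longrightarrow> test_fun \<kappa> (\<lambda>x. f x + g x)"
| mult: "test_fun \<kappa> f \<Longrightarrow> test_fun \<kappa> g \<Longrightarrow> test_fun \<kappa> (\<lambda>x. f x * g x)"

lemma has_derivative_nth: "((\<lambda>x::real^2. x $ i) has_derivative (\<lambda>v. v $ i)) (at x)"
  by (rule bounded_linear_imp_has_derivative[OF bounded_linear_vec_nth])

lemma has_derivative_radial:
  assumes "\<And>s. (\<phi> has_real_derivative \<phi>' s) (at s)"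
  shows "((\<lambda>x::real^2. \<phi> ((x $ 1)\<^sup>2 + (x $ 2)\<^sup>2)) has_derivative
    (\<lambda>v. \<phi>' ((x $ 1)\<^sup>2 + (x $ 2)\<^sup>2) * (2 * (x $ 1) * (v $ 1) + 2 * (x $ 2) * (v $ 2)))) (at x)"
proof -
  have "((\<lambda>x::real^2. (x $ 1)\<^sup>2 + (x $ 2)\<^sup>2) has_derivative (\<lambda>v. 2 * (x $ 1) * (v $ 1) + 2 * (x $ 2) * (v $ 2))) (at x)"
    by (auto intro!: derivative_eq_intros has_derivative_nth)
  from has_derivative_compose[OF this assms[unfolded has_field_derivative_def]] show ?thesis by simp
qed

lemma test_fun_derivative:
  assumes "\<kappa> > 0" "test_fun \<kappa> f"
  shows "\<exists>D. (\<forall>x. (f has_derivative D x) (at x)) \<and> (\<forall>v. test_fun \<kappa> (\<lambda>x. D x v))"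
  using assms(2)
proof induction
  case (const c)
  show ?case by (rule exI[of _ "\<lambda>x v. 0"]) (simp add: test_fun.const)
next
  case (coord i)
  show ?case by (rule exI[of _ "\<lambda>x v. v $ i"]) (simp add: test_fun.const has_derivative_nth)
next
  case (radial \<alpha> m n)
  show ?case
    by (rule exI, rule conjI, rule allI, rule has_derivative_radial[OF DERIV_log_bump[OF assms(1)]])
      (unfold log_bump'_def, intro allI test_fun.intros)
next
  case (add f g)
  then obtain D E where "\<forall>x. (f has_derivative D x) (at x)" "\<forall>v. test_fun \<kappa> (\<lambda>x. D x v)"
    "\<forall>x. (g has_derivative E x) (at x)" "\<forall>v. test_fun \<kappa> (\<lambda>x. E x v)" by blast
  then show ?case
    by (intro exI[of _ "\<lambda>x v. D x v + E x v"] conjI allI has_derivative_add test_fun.add) auto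
next
  case (mult f g)
  then obtain D E where "\<forall>x. (f has_derivative D x) (at x)" "\<forall>v. test_fun \<kappa> (\<lambda>x. D x v)"
    "\<forall>x. (g has_derivative E x) (at x)" "\<forall>v. test_fun \<kappa> (\<lambda>x. E x v)" by blast
  with mult.hyps show ?case
    by (intro exI[of _ "\<lambda>x v. f x * E x v + D x v * g x"] conjI allI has_derivative_mult test_fun.add test_fun.mult) auto
qed

lemma has_derivative_vector2:
  assumes "(f has_derivative D) (at x)" "(g has_derivative E) (at x)"
  shows "((\<lambda>x. vector [f x, g x] :: real^2) has_derivative (\<lambda>v. vector [D v, E v])) (at x)"
proof -
  have vec: "vector [a, b] = a *\<^sub>R (axis 1 1 :: real^2) + b *\<^sub>R axis 2 1" for a b
    by (simp add: vec2_eq_iff axis_def)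
  show ?thesis unfolding vec by (intro has_derivative_add has_derivative_scaleR_left assms)
qed

lemma Ck_test_fun:
  assumes "\<kappa> > 0" "test_fun \<kappa> f" "test_fun \<kappa> g"
  shows "Ck k (\<lambda>x. vector [f x, g x] :: real^2)"
  using assms(2,3)
proof (induction k arbitrary: f g)
  case (0 f g)
  obtain D E where "\<forall>x. (f has_derivative D x) (at x)" "\<forall>x. (g has_derivative E x) (at x)"
    using test_fun_derivative[OF assms(1)] 0 by metis
  then have "continuous_on UNIV f" "continuous_on UNIV g"
    by (meson continuous_at_imp_continuous_on has_derivative_continuous)+
  then show ?case by (simp add: continuous_on_vector2)
next
  case (Suc k f g)
  obtain D E where D: "\<And>x. (f has_derivative D x) (at x)" "\<And>v. test_fun \<kappa> (\<lambda>x. D x v)"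
    and E: "\<And>x. (g has_derivative E x) (at x)" "\<And>v. test_fun \<kappa> (\<lambda>x. E x v)"
    using test_fun_derivative[OF assms(1)] Suc.prems by metis
  have d: "((\<lambda>x. vector [f x, g x] :: real^2) has_derivative (\<lambda>v. vector [D x v, E x v])) (at x)" for x
    by (rule has_derivative_vector2[OF D(1) E(1)])
  have "frechet_derivative (\<lambda>x. vector [f x, g x] :: real^2) (at x) = (\<lambda>v. vector [D x v, E x v])" for x
    using frechet_derivative_at[OF d] by simp
  moreover have "(\<lambda>x. vector [f x, g x] :: real^2) differentiable (at x)" for x
    using d by (auto simp: differentiable_def)
  ultimately show ?case using Suc.IH[OF D(2) E(2)] by simp
qed

lemma smooth_compact_support_test_fun:
  assumes "\<kappa> > 0" "test_fun \<kappa> f" "test_fun \<kappa> g"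
    and "\<And>x. (x $ 1)\<^sup>2 + (x $ 2)\<^sup>2 \<ge> R \<Longrightarrow> f x = 0 \<and> g x = 0"
  shows "smooth_compact_support (\<lambda>x. vector [f x, g x])"
proof -
  have "norm x \<le> \<bar>R\<bar> + 1" if "vector [f x, g x] \<noteq> (0 :: real^2)" for x
  proof -
    have "\<not> (x $ 1)\<^sup>2 + (x $ 2)\<^sup>2 \<ge> R" using that assms(4)[of x] by (auto simp: vec2_eq_iff)
    then have "(norm x)\<^sup>2 < R" by (simp add: norm_vec2)
    also have "R \<le> (\<bar>R\<bar> + 1)\<^sup>2"
    proof -
      have "(\<bar>R\<bar> + 1)\<^sup>2 = R\<^sup>2 + 2 * \<bar>R\<bar> + 1" by (simp add: power2_sum)
      then show ?thesis using zero_le_power2[of R] by linarith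
    qed
    finally show ?thesis using power2_less_imp_less by fastforce
  qed
  then have "bounded {x. vector [f x, g x] \<noteq> (0 :: real^2)}"
    by (auto simp: bounded_iff)
  then show ?thesis
    using Ck_test_fun[OF assms(1-3)] by (simp add: smooth_compact_support_def compact_closure)
qed

lemma partial_vector2:
  assumes "(f has_derivative D) (at x)" "(g has_derivative E) (at x)"
  shows "partial i 1 (\<lambda>x. vector [f x, g x]) x = D (axis i 1)"
    "partial i 2 (\<lambda>x. vector [f x, g x]) x = E (axis i 1)"
  unfolding partial_def vector_2 using assms[THEN frechet_derivative_at] by simp_all

section \<open>Optimality of the constant\<close>

definition bump0 :: "real \<Rightarrow> real" where "bump0 y = flat 0 (1 - y\<^sup>2)"
definition bump1 :: "real \<Rightarrow> real" where "bump1 y = - 2 * y * flat (Suc 0) (1 - y\<^sup>2)"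
definition bump2 :: "real \<Rightarrow> real" where
  "bump2 y = - 2 * flat (Suc 0) (1 - y\<^sup>2) + 4 * y\<^sup>2 * flat (Suc (Suc 0)) (1 - y\<^sup>2)"

lemma DERIV_bump:
  "(bump0 has_real_derivative bump1 y) (at y)" "(bump1 has_real_derivative bump2 y) (at y)"
proof -
  have inner: "((\<lambda>y. 1 - y\<^sup>2) has_real_derivative - 2 * y) (at y)" for y :: real
    by (auto intro!: derivative_eq_intros)
  show "(bump0 has_real_derivative bump1 y) (at y)"
    unfolding bump0_def bump1_def
    by (rule DERIV_cong[OF DERIV_chain2[OF DERIV_flat inner]]) simp
  show "(bump1 has_real_derivative bump2 y) (at y)"
    unfolding bump1_def bump2_def
    by (rule DERIV_cong[OF DERIV_mult[OF DERIV_cmult[OF DERIV_ident] DERIV_chain2[OF DERIV_flat inner]]])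
      (simp add: power2_eq_square)
qed

lemma bump_vanishes:
  assumes "\<bar>y\<bar> \<ge> 1"
  shows "bump0 y = 0" "bump1 y = 0" "bump2 y = 0"
proof -
  have "1 - y\<^sup>2 \<le> 0" using assms by (metis abs_le_square_iff abs_one diff_le_0_iff_le one_power2)
  then show "bump0 y = 0" "bump1 y = 0" "bump2 y = 0"
    by (simp_all add: bump0_def bump1_def bump2_def flat_nonpos)
qed

lemma continuous_on_bump [continuous_intros]:
  assumes "continuous_on S f"
  shows "continuous_on S (\<lambda>x. bump0 (f x))" "continuous_on S (\<lambda>x. bump1 (f x))" "continuous_on S (\<lambda>x. bump2 (f x))"
  unfolding bump0_def bump1_def bump2_def by (intro continuous_intros assms)+

lemma integral_cos_square: "integral {-pi..pi} (\<lambda>\<theta>. a + b * (cos \<theta>)\<^sup>2) = 2 * pi * a + pi * b"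
proof -
  let ?W = "\<lambda>\<theta>. a * \<theta> + b * ((\<theta> + sin \<theta> * cos \<theta>) / 2)"
  have "(?W has_real_derivative a + b * (cos \<theta>)\<^sup>2) (at \<theta>)" for \<theta>
    by (rule DERIV_cong[OF DERIV_add[OF DERIV_cmult[OF DERIV_ident]
        DERIV_cmult[OF DERIV_trig_square_primitives(1)]]]) simp
  then have "((\<lambda>\<theta>. a + b * (cos \<theta>)\<^sup>2) has_integral (?W pi - ?W (- pi))) {-pi..pi}"
    by (intro has_integral_real_derivative) simp_all
  from integral_unique[OF this] show ?thesis by (simp add: algebra_simps)
qed

text \<open>For a field \<open>u = e\<^bsup>-\<gamma>t\<^esup> V\<close> the weights cancel. The functions \<open>W1\<close>, \<open>W2\<close> are
\<open>(\<partial>\<^sub>t - \<gamma>) V\<close>, and \<open>Z1\<close>, \<open>Z2\<close> are \<open>\<partial>\<^sub>\<theta> V\<close>.\<close>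

lemma hardy_integrals_of_profile:
  assumes C1: "Ck (Suc 0) u"
    and V: "\<And>t \<theta>. u (polar t \<theta>) = vector [exp (- \<gamma> * t) * V1 t \<theta>, exp (- \<gamma> * t) * V2 t \<theta>]"
    and W: "\<And>t \<theta>. ((\<lambda>t. V1 t \<theta>) has_real_derivative W1 t \<theta> + \<gamma> * V1 t \<theta>) (at t)"
      "\<And>t \<theta>. ((\<lambda>t. V2 t \<theta>) has_real_derivative W2 t \<theta> + \<gamma> * V2 t \<theta>) (at t)"
    and Z: "\<And>t \<theta>. (V1 t has_real_derivative Z1 t \<theta>) (at \<theta>)" "\<And>t \<theta>. (V2 t has_real_derivative Z2 t \<theta>) (at \<theta>)"
  shows "hardy_lhs \<gamma> u = (\<integral>\<^sup>+t. ennreal (integral {-pi..pi} (\<lambda>\<theta>. (V1 t \<theta>)\<^sup>2 + (V2 t \<theta>)\<^sup>2)) \<partial>lborel)"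
    and "hardy_rhs \<gamma> u = (\<integral>\<^sup>+t. ennreal (integral {-pi..pi}
        (\<lambda>\<theta>. (W1 t \<theta>)\<^sup>2 + (W2 t \<theta>)\<^sup>2 + (Z1 t \<theta>)\<^sup>2 + (Z2 t \<theta>)\<^sup>2)) \<partial>lborel)"
proof -
  have scale: "exp (2 * \<gamma> * t) * (exp (- \<gamma> * t) * x)\<^sup>2 = x\<^sup>2" for t x
  proof -
    have "exp (2 * \<gamma> * t) * (exp (- \<gamma> * t))\<^sup>2 = 1"
      unfolding exp_double[symmetric] exp_add[symmetric] by simp
    then show ?thesis by (simp only: power_mult_distrib mult.assoc[symmetric] mult_1)
  qed
  show "hardy_lhs \<gamma> u = (\<integral>\<^sup>+t. ennreal (integral {-pi..pi} (\<lambda>\<theta>. (V1 t \<theta>)\<^sup>2 + (V2 t \<theta>)\<^sup>2)) \<partial>lborel)"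
    unfolding hardy_lhs_polar[OF C1] V vector_2 distrib_left scale ..
  have e: "((\<lambda>t. exp (- \<gamma> * t)) has_real_derivative - \<gamma> * exp (- \<gamma> * t)) (at t)" for t
    by (auto intro!: derivative_eq_intros)
  have "radial_rate u 1 t \<theta> = exp (- \<gamma> * t) * W1 t \<theta>" for t \<theta>
    using DERIV_unique[OF DERIV_polar(1)[OF C1, of \<theta> 1 t, unfolded V vector_2] DERIV_mult[OF e W(1)]]
    by (simp add: algebra_simps)
  moreover have "radial_rate u 2 t \<theta> = exp (- \<gamma> * t) * W2 t \<theta>" for t \<theta>
    using DERIV_unique[OF DERIV_polar(1)[OF C1, of \<theta> 2 t, unfolded V vector_2] DERIV_mult[OF e W(2)]]
    by (simp add: algebra_simps)
  moreover have "angular_rate u 1 t \<theta> = exp (- \<gamma> * t) * Z1 t \<theta>" for t \<theta>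
    by (rule DERIV_unique[OF DERIV_polar(2)[OF C1, of t 1 \<theta>, unfolded V vector_2] DERIV_cmult[OF Z(1)]])
  moreover have "angular_rate u 2 t \<theta> = exp (- \<gamma> * t) * Z2 t \<theta>" for t \<theta>
    by (rule DERIV_unique[OF DERIV_polar(2)[OF C1, of t 2 \<theta>, unfolded V vector_2] DERIV_cmult[OF Z(2)]])
  ultimately show "hardy_rhs \<gamma> u = (\<integral>\<^sup>+t. ennreal (integral {-pi..pi}
        (\<lambda>\<theta>. (W1 t \<theta>)\<^sup>2 + (W2 t \<theta>)\<^sup>2 + (Z1 t \<theta>)\<^sup>2 + (Z2 t \<theta>)\<^sup>2)) \<partial>lborel)"
    unfolding hardy_rhs_polar[OF C1] by (simp only: distrib_left scale)
qed

text \<open>The profiles \<open>L \<epsilon>\<close> and \<open>R \<epsilon>\<close> are evaluated at \<open>\<epsilon>t\<close>, so both integrals carry the same factor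
\<open>1/\<epsilon>\<close>. After its cancellation both sides are continuous in \<open>\<epsilon>\<close>, and at \<open>\<epsilon> = 0\<close> their quotient is
\<open>l / r\<close>.\<close>

lemma constant_lower_bound:
  fixes L R :: "real \<Rightarrow> real \<Rightarrow> real"
  assumes cont: "continuous_on UNIV (\<lambda>p. L (fst p) (snd p))" "continuous_on UNIV (\<lambda>p. R (fst p) (snd p))"
    and nonneg: "\<And>\<epsilon> y. 0 \<le> L \<epsilon> y" "\<And>\<epsilon> y. 0 \<le> R \<epsilon> y"
    and vanish: "\<And>\<epsilon> y. \<bar>y\<bar> \<ge> 1 \<Longrightarrow> L \<epsilon> y = 0" "\<And>\<epsilon> y. \<bar>y\<bar> \<ge> 1 \<Longrightarrow> R \<epsilon> y = 0"
    and fields: "\<And>\<epsilon>. \<epsilon> > 0 \<Longrightarrow> \<exists>u\<in>admissible \<gamma>. hardy_lhs \<gamma> u = (\<integral>\<^sup>+t. ennreal (L \<epsilon> (\<epsilon> * t)) \<partial>lborel)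
        \<and> hardy_rhs \<gamma> u = (\<integral>\<^sup>+t. ennreal (R \<epsilon> (\<epsilon> * t)) \<partial>lborel)"
    and limit: "\<And>y. L 0 y = l * (bump0 y)\<^sup>2" "\<And>y. R 0 y = r * (bump0 y)\<^sup>2" and "r > 0"
    and C: "\<forall>u\<in>admissible \<gamma>. hardy_lhs \<gamma> u \<le> C * hardy_rhs \<gamma> u"
  shows "ennreal (l / r) \<le> C"
proof (cases C)
  case (real c)
  have slice: "continuous_on S (L \<epsilon>)" "continuous_on S (R \<epsilon>)" for \<epsilon> S
  proof -
    have "continuous_on S (\<lambda>y. (\<epsilon>, y))" by (intro continuous_intros)
    note cont[THEN continuous_on_compose2, OF this subset_UNIV]
    then show "continuous_on S (L \<epsilon>)" "continuous_on S (R \<epsilon>)" by simp_all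
  qed
  have total: "(\<integral>\<^sup>+t. ennreal (F (\<epsilon> * t)) \<partial>lborel) = ennreal (1 / \<epsilon>) * ennreal (integral {-1..1} F)"
    if "\<epsilon> > 0" "continuous_on UNIV F" "\<And>y. 0 \<le> F y" "\<And>y. \<bar>y\<bar> \<ge> 1 \<Longrightarrow> F y = 0" for \<epsilon> F
  proof -
    have "(\<lambda>x. ennreal (F x)) \<in> borel_measurable borel"
      using borel_measurable_continuous_onI[OF that(2)] by measurable
    from nn_integral_real_affine[OF this, of \<epsilon> 0] \<open>\<epsilon> > 0\<close>
    have eq: "(\<integral>\<^sup>+y. ennreal (F y) \<partial>lborel) = ennreal \<epsilon> * (\<integral>\<^sup>+t. ennreal (F (\<epsilon> * t)) \<partial>lborel)" by simp
    have "ennreal (F y) = ennreal (F y) * indicator {-1..1} y" for y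
      using that(4)[of y] by (cases "\<bar>y\<bar> \<ge> 1") (auto simp: indicator_def)
    then have "(\<integral>\<^sup>+y. ennreal (F y) \<partial>lborel) = (\<integral>\<^sup>+y. ennreal (F y) * indicator {-1..1} y \<partial>lborel)" by simp
    also have "\<dots> = ennreal (integral {-1..1} F)"
    proof (rule nn_integral_has_integral_lebesgue')
      show "(F has_integral integral {-1..1} F) {-1..1}"
        by (rule integrable_integral, rule integrable_continuous_real, rule continuous_on_subset[OF that(2)]) simp
    qed (rule that(3))
    finally have "ennreal (1 / \<epsilon>) * ennreal (integral {-1..1} F)
       = ennreal (1 / \<epsilon>) * (ennreal \<epsilon> * (\<integral>\<^sup>+t. ennreal (F (\<epsilon> * t)) \<partial>lborel))" using eq by simp
    also have "\<dots> = (\<integral>\<^sup>+t. ennreal (F (\<epsilon> * t)) \<partial>lborel)"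
      using \<open>\<epsilon> > 0\<close> unfolding mult.assoc[symmetric] by (simp add: ennreal_mult[symmetric])
    finally show ?thesis ..
  qed
  define X where "X \<epsilon> = integral {-1..1} (L \<epsilon>)" for \<epsilon>
  define Y where "Y \<epsilon> = integral {-1..1} (R \<epsilon>)" for \<epsilon>
  have XY: "X \<epsilon> \<le> c * Y \<epsilon>" if pos: "\<epsilon> > 0" for \<epsilon>
  proof -
    have Y0: "0 \<le> Y \<epsilon>" unfolding Y_def
      by (intro integral_nonneg integrable_continuous_real slice nonneg)
    obtain u where u: "u \<in> admissible \<gamma>" "hardy_lhs \<gamma> u = (\<integral>\<^sup>+t. ennreal (L \<epsilon> (\<epsilon> * t)) \<partial>lborel)"
      "hardy_rhs \<gamma> u = (\<integral>\<^sup>+t. ennreal (R \<epsilon> (\<epsilon> * t)) \<partial>lborel)" using fields[OF pos] by blast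
    have "0 \<le> X \<epsilon>" unfolding X_def
      by (intro integral_nonneg integrable_continuous_real slice nonneg)
    with pos have "ennreal (1 / \<epsilon> * X \<epsilon>) = ennreal (1 / \<epsilon>) * ennreal (X \<epsilon>)"
      by (intro ennreal_mult) auto
    also have "\<dots> \<le> C * (ennreal (1 / \<epsilon>) * ennreal (Y \<epsilon>))"
      using C u total[OF pos slice(1) nonneg(1) vanish(1)] total[OF pos slice(2) nonneg(2) vanish(2)]
      unfolding X_def Y_def by metis
    also have "\<dots> = ennreal (1 / \<epsilon> * (c * Y \<epsilon>))"
      using pos Y0 real by (simp add: ennreal_mult[symmetric] mult_ac)
    finally have "ennreal (1 / \<epsilon> * X \<epsilon>) \<le> ennreal (1 / \<epsilon> * (c * Y \<epsilon>))" .
    then have "1 / \<epsilon> * X \<epsilon> \<le> 1 / \<epsilon> * (c * Y \<epsilon>)"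
      using pos Y0 real(1) by (subst (asm) ennreal_le_iff) auto
    then show ?thesis using pos by (simp add: divide_le_cancel)
  qed
  have "continuous_on UNIV X" "continuous_on UNIV Y"
    unfolding X_def Y_def cbox_interval[symmetric]
    by (rule integral_continuous_on_param, simp add: split_beta',
        rule continuous_on_subset[OF cont(1)] continuous_on_subset[OF cont(2)], simp)+
  then have "(X \<longlongrightarrow> X 0) (at_right 0)" "((\<lambda>\<epsilon>. c * Y \<epsilon>) \<longlongrightarrow> c * Y 0) (at_right 0)"
    by (auto simp: continuous_on_eq_continuous_at isCont_def intro: filterlim_mono[OF _ order_refl at_le] tendsto_mult_left)
  moreover have "\<forall>\<^sub>F \<epsilon> in at_right 0. X \<epsilon> \<le> c * Y \<epsilon>"
    using XY by (auto simp: eventually_at_filter)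
  ultimately have "X 0 \<le> c * Y 0"
    using tendsto_le[OF trivial_limit_at_right_real] by blast
  moreover have "L 0 = (\<lambda>y. l * (bump0 y)\<^sup>2)" "R 0 = (\<lambda>y. r * (bump0 y)\<^sup>2)"
    by (rule ext, rule limit)+
  moreover define I where "I = integral {-1..1} (\<lambda>y. (bump0 y)\<^sup>2)"
  ultimately have le: "l * I \<le> c * (r * I)" by (simp add: X_def Y_def)
  have "I \<noteq> 0"
  proof
    assume "I = 0"
    then have "\<forall>y\<in>{-1..1}. (bump0 y)\<^sup>2 = 0"
      unfolding I_def by (subst (asm) integral_eq_0_iff) (auto intro!: continuous_intros)
    then have "bump0 0 = 0" by simp
    then show False using flat_pos[of 1] by (simp add: bump0_def)
  qed
  moreover have "0 \<le> I" unfolding I_def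
    by (intro integral_nonneg integrable_continuous_real continuous_intros) auto
  ultimately have "I > 0" by simp
  with le have "l \<le> c * r" by simp
  then have "l / r \<le> c" using \<open>r > 0\<close> by (simp add: field_simps)
  then show ?thesis using real by (simp add: ennreal_leI)
qed simp

lemma log_bump_exp: "log_bump (\<epsilon> / 2) \<alpha> 0 0 (exp (2 * t)) = exp (2 * \<alpha> * t) * bump0 (\<epsilon> * t)"
  by (simp add: log_bump_def bump0_def exp_powr_real mult_ac)

lemma polar_square: "(polar t \<theta> $ 1)\<^sup>2 + (polar t \<theta> $ 2)\<^sup>2 = exp (2 * t)"
  by (simp only: norm_vec2[symmetric] norm_polar exp_double)

text \<open>A purely rotational field, the mode \<open>k = 0\<close>: its angular component is \<open>e\<^bsup>-\<gamma>t\<^esup>\<close> times a bump in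
\<open>\<epsilon>t\<close>. The parameters use \<open>|x|\<^sup>2 = e\<^bsup>2t\<^esup>\<close>, which accounts for the halves.\<close>

definition swirl :: "real \<Rightarrow> real \<Rightarrow> real^2 \<Rightarrow> real^2" where
  "swirl \<gamma> \<epsilon> x = vector
     [- 1 * (x $ 2 * log_bump (\<epsilon> / 2) (- (\<gamma> + 1) / 2) 0 0 ((x $ 1)\<^sup>2 + (x $ 2)\<^sup>2)),
      x $ 1 * log_bump (\<epsilon> / 2) (- (\<gamma> + 1) / 2) 0 0 ((x $ 1)\<^sup>2 + (x $ 2)\<^sup>2)]"

lemma swirl_admissible:
  assumes "\<epsilon> > 0"
  shows "swirl \<gamma> \<epsilon> \<in> admissible \<gamma>"
proof -
  let ?\<phi> = "log_bump (\<epsilon> / 2) (- (\<gamma> + 1) / 2) 0 0"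
  have \<kappa>: "\<epsilon> / 2 > 0" using assms by simp
  have "smooth_compact_support (swirl \<gamma> \<epsilon>)"
    unfolding swirl_def[abs_def]
    by (rule smooth_compact_support_test_fun[OF \<kappa>, of _ _ "exp (1 / (\<epsilon> / 2))"])
      (intro test_fun.intros, intro test_fun.intros, simp add: log_bump_eq_0[OF \<kappa>])
  moreover have "divergence_free (swirl \<gamma> \<epsilon>)"
  proof -
    note d = has_derivative_radial[OF DERIV_log_bump[OF \<kappa>], of "- (\<gamma> + 1) / 2" 0 0]
    have D: "((\<lambda>x::real^2. - 1 * (x $ 2 * ?\<phi> ((x $ 1)\<^sup>2 + (x $ 2)\<^sup>2))) has_derivative
      (\<lambda>v. - 1 * (x $ 2 * (log_bump' (\<epsilon> / 2) (- (\<gamma> + 1) / 2) 0 0 ((x $ 1)\<^sup>2 + (x $ 2)\<^sup>2) * (2 * (x $ 1) * (v $ 1) + 2 * (x $ 2) * (v $ 2)))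
         + v $ 2 * ?\<phi> ((x $ 1)\<^sup>2 + (x $ 2)\<^sup>2)))) (at x)" for x
      by (intro has_derivative_mult_right has_derivative_mult has_derivative_nth d)
    have E: "((\<lambda>x::real^2. x $ 1 * ?\<phi> ((x $ 1)\<^sup>2 + (x $ 2)\<^sup>2)) has_derivative
      (\<lambda>v. x $ 1 * (log_bump' (\<epsilon> / 2) (- (\<gamma> + 1) / 2) 0 0 ((x $ 1)\<^sup>2 + (x $ 2)\<^sup>2) * (2 * (x $ 1) * (v $ 1) + 2 * (x $ 2) * (v $ 2)))
         + v $ 1 * ?\<phi> ((x $ 1)\<^sup>2 + (x $ 2)\<^sup>2))) (at x)" for x
      by (intro has_derivative_mult has_derivative_nth d)
    show ?thesis
      unfolding divergence_free_def sum_2 swirl_def[abs_def] partial_vector2[OF D E]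
      by (simp add: axis_def)
  qed
  moreover have "swirl \<gamma> \<epsilon> 0 = 0" by (simp add: swirl_def vec2_eq_iff)
  ultimately show ?thesis by (simp add: admissible_def)
qed

lemma DERIV_bump0_scaled: "((\<lambda>t. bump0 (\<epsilon> * t)) has_real_derivative \<epsilon> * bump1 (\<epsilon> * t)) (at t)"
  by (rule DERIV_cong[OF DERIV_chain2[OF DERIV_bump(1) DERIV_cmult[OF DERIV_ident]]]) simp

lemma DERIV_bump1_scaled: "((\<lambda>t. bump1 (\<epsilon> * t)) has_real_derivative \<epsilon> * bump2 (\<epsilon> * t)) (at t)"
  by (rule DERIV_cong[OF DERIV_chain2[OF DERIV_bump(2) DERIV_cmult[OF DERIV_ident]]]) simp

lemma C1_if_admissible: "u \<in> admissible \<gamma> \<Longrightarrow> Ck (Suc 0) u"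
  by (rule C1_if_smooth) (simp add: admissible_def)

lemma swirl_integrals:
  assumes "\<epsilon> > 0"
  shows "hardy_lhs \<gamma> (swirl \<gamma> \<epsilon>) = (\<integral>\<^sup>+t. ennreal (2 * pi * (bump0 (\<epsilon> * t))\<^sup>2) \<partial>lborel)"
    "hardy_rhs \<gamma> (swirl \<gamma> \<epsilon>)
      = (\<integral>\<^sup>+t. ennreal (2 * pi * ((\<epsilon> * bump1 (\<epsilon> * t) - \<gamma> * bump0 (\<epsilon> * t))\<^sup>2 + (bump0 (\<epsilon> * t))\<^sup>2)) \<partial>lborel)"
proof -
  define G where "G t = bump0 (\<epsilon> * t)" for t
  define P where "P t = \<epsilon> * bump1 (\<epsilon> * t) - \<gamma> * bump0 (\<epsilon> * t)" for t
  have G': "(G has_real_derivative P t + \<gamma> * G t) (at t)" for t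
    unfolding G_def[abs_def] P_def by (rule DERIV_cong[OF DERIV_bump0_scaled]) simp
  have V: "swirl \<gamma> \<epsilon> (polar t \<theta>) = vector [exp (- \<gamma> * t) * (- sin \<theta> * G t), exp (- \<gamma> * t) * (cos \<theta> * G t)]" for t \<theta>
  proof -
    have e: "exp t * exp (2 * (- (\<gamma> + 1) / 2) * t) = exp (- \<gamma> * t)"
      unfolding exp_add[symmetric] by (simp add: field_simps)
    show ?thesis
      unfolding swirl_def polar_square log_bump_exp
      unfolding polar_nth G_def e[symmetric] by (simp add: vec2_eq_iff)
  qed
  have circle: "(- sin \<theta> * x)\<^sup>2 + (cos \<theta> * x)\<^sup>2 = x\<^sup>2" "(- cos \<theta> * x)\<^sup>2 + (- sin \<theta> * x)\<^sup>2 = x\<^sup>2" for x \<theta> :: real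
    by (simp_all add: power_mult_distrib flip: distrib_right)
  have W: "((\<lambda>t. - sin \<theta> * G t) has_real_derivative - sin \<theta> * P t + \<gamma> * (- sin \<theta> * G t)) (at t)"
    "((\<lambda>t. cos \<theta> * G t) has_real_derivative cos \<theta> * P t + \<gamma> * (cos \<theta> * G t)) (at t)" for t \<theta>
    by (rule DERIV_cong[OF DERIV_cmult[OF G']], simp add: algebra_simps)+
  have Z: "((\<lambda>\<theta>. - sin \<theta> * G t) has_real_derivative - cos \<theta> * G t) (at \<theta>)"
    "((\<lambda>\<theta>. cos \<theta> * G t) has_real_derivative - sin \<theta> * G t) (at \<theta>)" for t \<theta>
    by (intro DERIV_cmult_right DERIV_minus DERIV_sin DERIV_cos)+
  note I = hardy_integrals_of_profile[OF C1_if_admissible[OF swirl_admissible[OF assms]] V W Z]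
  show "hardy_lhs \<gamma> (swirl \<gamma> \<epsilon>) = (\<integral>\<^sup>+t. ennreal (2 * pi * (bump0 (\<epsilon> * t))\<^sup>2) \<partial>lborel)"
    unfolding I(1) circle by (simp add: G_def)
  have "(- sin \<theta> * P t)\<^sup>2 + (cos \<theta> * P t)\<^sup>2 + (- cos \<theta> * G t)\<^sup>2 + (- sin \<theta> * G t)\<^sup>2 = (P t)\<^sup>2 + (G t)\<^sup>2" for t \<theta>
    unfolding add.assoc[of _ "(- cos \<theta> * G t)\<^sup>2"] circle ..
  then show "hardy_rhs \<gamma> (swirl \<gamma> \<epsilon>)
      = (\<integral>\<^sup>+t. ennreal (2 * pi * ((\<epsilon> * bump1 (\<epsilon> * t) - \<gamma> * bump0 (\<epsilon> * t))\<^sup>2 + (bump0 (\<epsilon> * t))\<^sup>2)) \<partial>lborel)"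
    unfolding I(2) by (simp add: G_def P_def)
qed

text \<open>The field with stream function \<open>x\<^sub>1 \<phi>(|x|\<^sup>2)\<close>, that is, mode \<open>k = 1\<close>. The exponent \<open>- \<gamma> / 2\<close> of
\<open>\<phi>\<close> makes the stream function \<open>e\<^bsup>(1-\<gamma>)t\<^esup> cos \<theta>\<close> times a bump in \<open>\<epsilon>t\<close>.\<close>

definition dipole :: "real \<Rightarrow> real \<Rightarrow> real^2 \<Rightarrow> real^2" where
  "dipole \<gamma> \<epsilon> x = vector
     [2 * (x $ 1 * x $ 2) * log_bump' (\<epsilon> / 2) (- \<gamma> / 2) 0 0 ((x $ 1)\<^sup>2 + (x $ 2)\<^sup>2),
      - 1 * (log_bump (\<epsilon> / 2) (- \<gamma> / 2) 0 0 ((x $ 1)\<^sup>2 + (x $ 2)\<^sup>2)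
           + 2 * (x $ 1 * x $ 1) * log_bump' (\<epsilon> / 2) (- \<gamma> / 2) 0 0 ((x $ 1)\<^sup>2 + (x $ 2)\<^sup>2))]"

lemma DERIV_log_bump':
  assumes "\<kappa> > 0"
  shows "\<exists>\<phi>''. \<forall>s. (log_bump' \<kappa> \<alpha> m n has_real_derivative \<phi>'' s) (at s)"
proof (intro exI allI)
  show "(log_bump' \<kappa> \<alpha> m n has_real_derivative \<alpha> * log_bump' \<kappa> (\<alpha> - 1) m n s
      + real m * log_bump' \<kappa> (\<alpha> - 1) (m - 1) n s + (- 2 * \<kappa>\<^sup>2) * log_bump' \<kappa> (\<alpha> - 1) (Suc m) (Suc n) s) (at s)" for s
    unfolding log_bump'_def[of \<kappa> \<alpha> m n, abs_def]
    by (intro DERIV_add DERIV_cmult DERIV_log_bump assms)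
qed

lemma dipole_admissible:
  assumes "\<epsilon> > 0"
  shows "dipole \<gamma> \<epsilon> \<in> admissible \<gamma>"
proof -
  let ?\<phi> = "log_bump (\<epsilon> / 2) (- \<gamma> / 2) 0 0" and ?\<phi>' = "log_bump' (\<epsilon> / 2) (- \<gamma> / 2) 0 0"
  have \<kappa>: "\<epsilon> / 2 > 0" using assms by simp
  have "smooth_compact_support (dipole \<gamma> \<epsilon>)"
    unfolding dipole_def[abs_def] log_bump'_def
    by (rule smooth_compact_support_test_fun[OF \<kappa>, of _ _ "exp (1 / (\<epsilon> / 2))"])
      (intro test_fun.intros, intro test_fun.intros, simp add: log_bump_eq_0[OF \<kappa>])
  moreover have "divergence_free (dipole \<gamma> \<epsilon>)"
  proof -
    obtain \<phi>'' where \<phi>'': "\<And>s. (?\<phi>' has_real_derivative \<phi>'' s) (at s)"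
      using DERIV_log_bump'[OF \<kappa>] by blast
    note d = has_derivative_radial[OF DERIV_log_bump[OF \<kappa>], of "- \<gamma> / 2" 0 0]
    note d' = has_derivative_radial[OF \<phi>'']
    have D: "((\<lambda>x::real^2. 2 * (x $ 1 * x $ 2) * ?\<phi>' ((x $ 1)\<^sup>2 + (x $ 2)\<^sup>2)) has_derivative
      (\<lambda>v. 2 * (x $ 1 * x $ 2) * (\<phi>'' ((x $ 1)\<^sup>2 + (x $ 2)\<^sup>2) * (2 * (x $ 1) * (v $ 1) + 2 * (x $ 2) * (v $ 2)))
         + 2 * (x $ 1 * v $ 2 + v $ 1 * x $ 2) * ?\<phi>' ((x $ 1)\<^sup>2 + (x $ 2)\<^sup>2))) (at x)" for x
      by (intro has_derivative_mult[OF _ d'] has_derivative_mult_right has_derivative_mult[OF has_derivative_nth has_derivative_nth])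
    have E: "((\<lambda>x::real^2. - 1 * (?\<phi> ((x $ 1)\<^sup>2 + (x $ 2)\<^sup>2) + 2 * (x $ 1 * x $ 1) * ?\<phi>' ((x $ 1)\<^sup>2 + (x $ 2)\<^sup>2))) has_derivative
      (\<lambda>v. - 1 * (?\<phi>' ((x $ 1)\<^sup>2 + (x $ 2)\<^sup>2) * (2 * (x $ 1) * (v $ 1) + 2 * (x $ 2) * (v $ 2))
         + (2 * (x $ 1 * x $ 1) * (\<phi>'' ((x $ 1)\<^sup>2 + (x $ 2)\<^sup>2) * (2 * (x $ 1) * (v $ 1) + 2 * (x $ 2) * (v $ 2)))
         + 2 * (x $ 1 * v $ 1 + v $ 1 * x $ 1) * ?\<phi>' ((x $ 1)\<^sup>2 + (x $ 2)\<^sup>2))))) (at x)" for x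
      by (rule has_derivative_mult_right, rule has_derivative_add[OF d], rule has_derivative_mult[OF _ d'],
          rule has_derivative_mult_right, rule has_derivative_mult[OF has_derivative_nth has_derivative_nth])
    show ?thesis
      unfolding divergence_free_def sum_2 dipole_def[abs_def] partial_vector2[OF D E]
      by (simp add: axis_def algebra_simps)
  qed
  moreover have "dipole \<gamma> \<epsilon> 0 = 0" by (simp add: dipole_def vec2_eq_iff log_bump_def)
  ultimately show ?thesis by (simp add: admissible_def)
qed

text \<open>With \<open>\<epsilon> \<rightarrow> 0\<close> the functions \<open>P\<close> and \<open>Q\<close> approach \<open>- \<gamma> G\<close> and \<open>\<gamma>\<^sup>2 G\<close>, so that the two
integrands tend to \<open>\<pi> (1 + (1-\<gamma>)\<^sup>2) G\<^sup>2\<close> and \<open>\<pi> \<gamma>\<^sup>2 (3 + (1-\<gamma>)\<^sup>2) G\<^sup>2\<close>.\<close>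

lemma dipole_integrals:
  fixes \<gamma> \<epsilon> :: real
  assumes "\<epsilon> > 0"
  defines "G \<equiv> \<lambda>t. bump0 (\<epsilon> * t)"
    and "P \<equiv> \<lambda>t. \<epsilon> * bump1 (\<epsilon> * t) - \<gamma> * bump0 (\<epsilon> * t)"
    and "Q \<equiv> \<lambda>t. \<epsilon>\<^sup>2 * bump2 (\<epsilon> * t) - 2 * \<gamma> * \<epsilon> * bump1 (\<epsilon> * t) + \<gamma>\<^sup>2 * bump0 (\<epsilon> * t)"
  shows "hardy_lhs \<gamma> (dipole \<gamma> \<epsilon>) = (\<integral>\<^sup>+t. ennreal (pi * ((G t)\<^sup>2 + (G t + P t)\<^sup>2)) \<partial>lborel)"
    "hardy_rhs \<gamma> (dipole \<gamma> \<epsilon>) = (\<integral>\<^sup>+t. ennreal (pi * (3 * (P t)\<^sup>2 + (P t + Q t)\<^sup>2)) \<partial>lborel)"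
proof -
  let ?\<phi> = "log_bump (\<epsilon> / 2) (- \<gamma> / 2) 0 0" and ?\<phi>' = "log_bump' (\<epsilon> / 2) (- \<gamma> / 2) 0 0"
  have \<kappa>: "\<epsilon> / 2 > 0" using assms by simp
  have G': "(G has_real_derivative P t + \<gamma> * G t) (at t)" for t
    unfolding G_def P_def by (rule DERIV_cong[OF DERIV_bump0_scaled]) simp
  have P': "(P has_real_derivative Q t + \<gamma> * P t) (at t)" for t
    unfolding P_def Q_def
    by (rule DERIV_cong[OF DERIV_diff[OF DERIV_cmult[OF DERIV_bump1_scaled] DERIV_cmult[OF DERIV_bump0_scaled]]])
      (simp add: power2_eq_square algebra_simps)
  have \<phi>: "?\<phi> (exp (2 * t)) = exp (- \<gamma> * t) * G t" for t
    unfolding log_bump_exp G_def by simp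
  have \<phi>': "2 * exp (2 * t) * ?\<phi>' (exp (2 * t)) = exp (- \<gamma> * t) * P t" for t
  proof -
    have "((\<lambda>t. exp (2 * t)) has_real_derivative 2 * exp (2 * t)) (at t)"
      by (auto intro!: derivative_eq_intros)
    note l = DERIV_chain2[OF DERIV_log_bump[OF \<kappa>] this, of "- \<gamma> / 2" 0 0]
    have "((\<lambda>t. exp (- \<gamma> * t)) has_real_derivative - \<gamma> * exp (- \<gamma> * t)) (at t)"
      by (auto intro!: derivative_eq_intros)
    from DERIV_unique[OF l[unfolded \<phi>] DERIV_mult[OF this G']] show ?thesis
      by (simp add: algebra_simps)
  qed
  have V: "dipole \<gamma> \<epsilon> (polar t \<theta>)
      = vector [exp (- \<gamma> * t) * (cos \<theta> * sin \<theta> * P t), exp (- \<gamma> * t) * (- (G t + (cos \<theta>)\<^sup>2 * P t))]" for t \<theta>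
  proof -
    have key: "2 * (exp t * x * (exp t * y)) * ?\<phi>' (exp (2 * t)) = exp (- \<gamma> * t) * (x * y * P t)" for x y
    proof -
      have "2 * (exp t * x * (exp t * y)) * ?\<phi>' (exp (2 * t)) = x * y * (2 * (exp t)\<^sup>2 * ?\<phi>' (exp (2 * t)))"
        by (simp add: power2_eq_square)
      then show ?thesis unfolding exp_double[symmetric] \<phi>' by simp
    qed
    show ?thesis
      unfolding dipole_def polar_square
      unfolding polar_nth \<phi> key
      by (simp add: vec2_eq_iff power2_eq_square algebra_simps)
  qed
  have W: "((\<lambda>t. cos \<theta> * sin \<theta> * P t) has_real_derivative cos \<theta> * sin \<theta> * Q t + \<gamma> * (cos \<theta> * sin \<theta> * P t)) (at t)"
    "((\<lambda>t. - (G t + (cos \<theta>)\<^sup>2 * P t)) has_real_derivative - (P t + (cos \<theta>)\<^sup>2 * Q t) + \<gamma> * (- (G t + (cos \<theta>)\<^sup>2 * P t))) (at t)" for t \<theta>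
    by (rule DERIV_cong[OF DERIV_cmult[OF P']], simp add: algebra_simps,
        rule DERIV_cong[OF DERIV_minus[OF DERIV_add[OF G' DERIV_cmult[OF P']]]], simp add: algebra_simps)
  have Z: "((\<lambda>\<theta>. cos \<theta> * sin \<theta> * P t) has_real_derivative ((cos \<theta>)\<^sup>2 - (sin \<theta>)\<^sup>2) * P t) (at \<theta>)"
    "((\<lambda>\<theta>. - (G t + (cos \<theta>)\<^sup>2 * P t)) has_real_derivative 2 * cos \<theta> * sin \<theta> * P t) (at \<theta>)" for t \<theta>
    by (auto intro!: derivative_eq_intros simp: power2_eq_square algebra_simps)
  note I = hardy_integrals_of_profile[OF C1_if_admissible[OF dipole_admissible[OF assms(1)]] V W Z]
  have "(cos \<theta> * sin \<theta> * P t)\<^sup>2 + (- (G t + (cos \<theta>)\<^sup>2 * P t))\<^sup>2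
      = (G t)\<^sup>2 + (2 * G t * P t + (P t)\<^sup>2) * (cos \<theta>)\<^sup>2" for t \<theta>
  proof -
    have "(sin \<theta>)\<^sup>2 = 1 - (cos \<theta>)\<^sup>2" by (rule sin_squared_eq)
    then show ?thesis unfolding power2_eq_square by algebra
  qed
  then show "hardy_lhs \<gamma> (dipole \<gamma> \<epsilon>) = (\<integral>\<^sup>+t. ennreal (pi * ((G t)\<^sup>2 + (G t + P t)\<^sup>2)) \<partial>lborel)"
    unfolding I(1) by (simp only: integral_cos_square) (simp add: power2_eq_square algebra_simps)
  have "(cos \<theta> * sin \<theta> * Q t)\<^sup>2 + (- (P t + (cos \<theta>)\<^sup>2 * Q t))\<^sup>2
       + (((cos \<theta>)\<^sup>2 - (sin \<theta>)\<^sup>2) * P t)\<^sup>2 + (2 * cos \<theta> * sin \<theta> * P t)\<^sup>2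
      = 2 * (P t)\<^sup>2 + (2 * P t * Q t + (Q t)\<^sup>2) * (cos \<theta>)\<^sup>2" for t \<theta>
  proof -
    have "(sin \<theta>)\<^sup>2 = 1 - (cos \<theta>)\<^sup>2" by (rule sin_squared_eq)
    then show ?thesis unfolding power2_eq_square by algebra
  qed
  then show "hardy_rhs \<gamma> (dipole \<gamma> \<epsilon>) = (\<integral>\<^sup>+t. ennreal (pi * (3 * (P t)\<^sup>2 + (P t + Q t)\<^sup>2)) \<partial>lborel)"
    unfolding I(2) by (simp only: integral_cos_square) (simp add: power2_eq_square algebra_simps)
qed

theorem hardy_const_optimal:
  assumes "\<gamma> \<noteq> 0" and C: "\<forall>u\<in>admissible \<gamma>. hardy_lhs \<gamma> u \<le> C * hardy_rhs \<gamma> u"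
  shows "ennreal (hardy_const \<gamma>) \<le> C"
proof (cases "\<gamma> \<in> {- sqrt 3 - 1 .. sqrt 3 - 1}")
  case True
  have "ennreal (pi * (1 + (1 - \<gamma>)\<^sup>2) / (pi * (\<gamma>\<^sup>2 * (3 + (1 - \<gamma>)\<^sup>2)))) \<le> C"
  proof (rule constant_lower_bound[where
      L = "\<lambda>\<epsilon> y. pi * ((bump0 y)\<^sup>2 + (bump0 y + (\<epsilon> * bump1 y - \<gamma> * bump0 y))\<^sup>2)" and
      R = "\<lambda>\<epsilon> y. pi * (3 * (\<epsilon> * bump1 y - \<gamma> * bump0 y)\<^sup>2 + (\<epsilon> * bump1 y - \<gamma> * bump0 y
            + (\<epsilon>\<^sup>2 * bump2 y - 2 * \<gamma> * \<epsilon> * bump1 y + \<gamma>\<^sup>2 * bump0 y))\<^sup>2)"])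
    show "pi * (\<gamma>\<^sup>2 * (3 + (1 - \<gamma>)\<^sup>2)) > 0"
      using assms(1) by (intro mult_pos_pos) (auto simp: add_pos_nonneg)
    show "\<exists>u\<in>admissible \<gamma>. hardy_lhs \<gamma> u = (\<integral>\<^sup>+t. ennreal (pi * ((bump0 (\<epsilon> * t))\<^sup>2
            + (bump0 (\<epsilon> * t) + (\<epsilon> * bump1 (\<epsilon> * t) - \<gamma> * bump0 (\<epsilon> * t)))\<^sup>2)) \<partial>lborel)
        \<and> hardy_rhs \<gamma> u = (\<integral>\<^sup>+t. ennreal (pi * (3 * (\<epsilon> * bump1 (\<epsilon> * t) - \<gamma> * bump0 (\<epsilon> * t))\<^sup>2
            + (\<epsilon> * bump1 (\<epsilon> * t) - \<gamma> * bump0 (\<epsilon> * t)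
            + (\<epsilon>\<^sup>2 * bump2 (\<epsilon> * t) - 2 * \<gamma> * \<epsilon> * bump1 (\<epsilon> * t) + \<gamma>\<^sup>2 * bump0 (\<epsilon> * t)))\<^sup>2)) \<partial>lborel)" if "\<epsilon> > 0" for \<epsilon>
      using dipole_integrals[OF that] dipole_admissible[OF that] by blast
    show "pi * ((bump0 y)\<^sup>2 + (bump0 y + (0 * bump1 y - \<gamma> * bump0 y))\<^sup>2) = pi * (1 + (1 - \<gamma>)\<^sup>2) * (bump0 y)\<^sup>2"
      "pi * (3 * (0 * bump1 y - \<gamma> * bump0 y)\<^sup>2 + (0 * bump1 y - \<gamma> * bump0 y
            + (0\<^sup>2 * bump2 y - 2 * \<gamma> * 0 * bump1 y + \<gamma>\<^sup>2 * bump0 y))\<^sup>2)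
        = pi * (\<gamma>\<^sup>2 * (3 + (1 - \<gamma>)\<^sup>2)) * (bump0 y)\<^sup>2" for y
      by (simp_all add: power2_eq_square algebra_simps)
  qed (auto simp: bump_vanishes intro!: continuous_intros C)
  moreover have "pi * (1 + (1 - \<gamma>)\<^sup>2) / (pi * (\<gamma>\<^sup>2 * (3 + (1 - \<gamma>)\<^sup>2))) = hardy_const \<gamma>"
    using True by (simp add: hardy_const_def)
  ultimately show ?thesis by simp
next
  case False
  have "ennreal (2 * pi / (2 * pi * (\<gamma>\<^sup>2 + 1))) \<le> C"
  proof (rule constant_lower_bound[where L = "\<lambda>\<epsilon> y. 2 * pi * (bump0 y)\<^sup>2" and
      R = "\<lambda>\<epsilon> y. 2 * pi * ((\<epsilon> * bump1 y - \<gamma> * bump0 y)\<^sup>2 + (bump0 y)\<^sup>2)"])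
    show "2 * pi * (\<gamma>\<^sup>2 + 1) > 0" by (simp add: add_nonneg_pos)
    show "\<exists>u\<in>admissible \<gamma>. hardy_lhs \<gamma> u = (\<integral>\<^sup>+t. ennreal (2 * pi * (bump0 (\<epsilon> * t))\<^sup>2) \<partial>lborel)
        \<and> hardy_rhs \<gamma> u = (\<integral>\<^sup>+t. ennreal (2 * pi * ((\<epsilon> * bump1 (\<epsilon> * t) - \<gamma> * bump0 (\<epsilon> * t))\<^sup>2 + (bump0 (\<epsilon> * t))\<^sup>2)) \<partial>lborel)"
      if "\<epsilon> > 0" for \<epsilon>
      using swirl_integrals[OF that] swirl_admissible[OF that] by blast
    show "2 * pi * ((0 * bump1 y - \<gamma> * bump0 y)\<^sup>2 + (bump0 y)\<^sup>2) = 2 * pi * (\<gamma>\<^sup>2 + 1) * (bump0 y)\<^sup>2" for y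
      by (simp add: power2_eq_square algebra_simps)
  qed (auto simp: bump_vanishes intro!: continuous_intros C)
  moreover have "2 * pi / (2 * pi * (\<gamma>\<^sup>2 + 1)) = hardy_const \<gamma>"
    using False by (auto simp: hardy_const_def)
  ultimately show ?thesis by simp
qed

theorem theorem2:
  fixes \<gamma> :: real
  assumes "\<gamma> \<noteq> 0"
  shows "(\<forall>u\<in>admissible \<gamma>. hardy_lhs \<gamma> u \<le> ennreal (hardy_const \<gamma>) * hardy_rhs \<gamma> u) \<and>
         (\<forall>C::ennreal. (\<forall>u\<in>admissible \<gamma>. hardy_lhs \<gamma> u \<le> C * hardy_rhs \<gamma> u)
            \<longrightarrow> ennreal (hardy_const \<gamma>) \<le> C)"
  using hardy_inequality[OF assms] hardy_const_optimal[OF assms] by blast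

end
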